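(* If the theory GB + AC + ``Semi-Weak Vopěnka's Principle'' is consistent, then it does not prove Vopěnka's Principle. Likewise, if the theory GB + AC + ``Weak Vopěnka's Principle'' is consistent, then it does not prove Vopěnka's Principle.
   Context: GB + AC is Gödel–Bernays (second-order) set theory, with sets and classes, together with the Axiom of Choice for sets. A graph is a structure $\langle G,E\rangle$ where $G$ is a set and $E$ is an arbitrary binary relation on $G$. A homomorphism from $\langle G,E\rangle$ to $\langle G',E'\rangle$ is a function $h: G\to G'$ such that $\langle v,w\rangle\in E$ implies $\langle h(v),h(w)\rangle\in E'$. Vopěnka's Principle (VP): the category of graphs has no large discrete full subcategory; that is, for every proper class of graphs there is a non-identity homomorphism among the graphs in that class. Weak Vopěnka's Principle (WVP): no (class) sequence of graphs $\langle G_\alpha:\alpha\in\mathrm{Ord}\rangle$ has both of the following properties: whenever $\alpha\le\alpha'$ there is a unique homomorphism $G_{\alpha'}\to G_\alpha$, and whenever $\alpha<\alpha'$ there is no homomorphism $G_\alpha\to G_{\alpha'}$. Semi-Weak Vopěnka's Principle (SWVP): no (class) sequence of graphs $\langle G_\alpha:\alpha\in\mathrm{Ord}\rangle$ has both of the following properties: whenever $\alpha\le\alpha'$ there is a homomorphism $G_{\alpha'}\to G_\alpha$ (not necessarily unique), and whenever $\alpha<\alpha'$ there is no homomorphism $G_\alpha\to G_{\alpha'}$. *)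

theory Defs
  imports Main
begin

section \<open>First-order logic over one binary relation symbol, with equality\<close>

text \<open>
  Formulas use de Bruijn indices. There are no function symbols, so the only terms are variables.
\<close>

datatype fm = Mem nat nat | Eq nat nat | Fls | Imp fm fm | All fm

definition Neg :: "fm \<Rightarrow> fm" where "Neg p = Imp p Fls"
definition Con :: "fm \<Rightarrow> fm \<Rightarrow> fm" where "Con p q = Neg (Imp p (Neg q))"
definition Dis :: "fm \<Rightarrow> fm \<Rightarrow> fm" where "Dis p q = Imp (Neg p) q"
definition Iff :: "fm \<Rightarrow> fm \<Rightarrow> fm" where "Iff p q = Con (Imp p q) (Imp q p)"
definition Ex :: "fm \<Rightarrow> fm" where "Ex p = Neg (All (Neg p))"

primrec ren :: "(nat \<Rightarrow> nat) \<Rightarrow> fm \<Rightarrow> fm" where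
  "ren r (Mem i j) = Mem (r i) (r j)"
| "ren r (Eq i j) = Eq (r i) (r j)"
| "ren r Fls = Fls"
| "ren r (Imp p q) = Imp (ren r p) (ren r q)"
| "ren r (All p) = All (ren (case_nat 0 (\<lambda>i. Suc (r i))) p)"

definition inst :: "nat \<Rightarrow> fm \<Rightarrow> fm" where
  "inst t = ren (case_nat t (\<lambda>i. i))"

text \<open>Classical natural deduction; in \<open>AllI\<close> the shift of the hypotheses makes index 0 fresh.\<close>

inductive deriv :: "fm set \<Rightarrow> fm \<Rightarrow> bool" (infix "\<turnstile>" 50) where
  Assm: "p \<in> \<Gamma> \<Longrightarrow> \<Gamma> \<turnstile> p"
| ImpI: "insert p \<Gamma> \<turnstile> q \<Longrightarrow> \<Gamma> \<turnstile> Imp p q"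
| ImpE: "\<Gamma> \<turnstile> Imp p q \<Longrightarrow> \<Gamma> \<turnstile> p \<Longrightarrow> \<Gamma> \<turnstile> q"
| Contra: "insert (Neg p) \<Gamma> \<turnstile> Fls \<Longrightarrow> \<Gamma> \<turnstile> p"
| AllI: "ren Suc ` \<Gamma> \<turnstile> p \<Longrightarrow> \<Gamma> \<turnstile> All p"
| AllE: "\<Gamma> \<turnstile> All p \<Longrightarrow> \<Gamma> \<turnstile> inst t p"
| EqRefl: "\<Gamma> \<turnstile> Eq t t"
| EqSubst: "\<Gamma> \<turnstile> Eq s t \<Longrightarrow> \<Gamma> \<turnstile> inst s p \<Longrightarrow> \<Gamma> \<turnstile> inst t p"

definition consistent :: "fm set \<Rightarrow> bool" where
  "consistent T \<longleftrightarrow> \<not> T \<turnstile> Fls"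

text \<open>\<open>bnd p\<close> is the least strict upper bound of the free indices of \<open>p\<close>.\<close>

primrec bnd :: "fm \<Rightarrow> nat" where
  "bnd (Mem i j) = max (Suc i) (Suc j)"
| "bnd (Eq i j) = max (Suc i) (Suc j)"
| "bnd Fls = 0"
| "bnd (Imp p q) = max (bnd p) (bnd q)"
| "bnd (All p) = bnd p - 1"

definition univ_closure :: "fm \<Rightarrow> fm" where
  "univ_closure p = (All ^^ bnd p) p"


section \<open>Writing formulas with named bound variables\<close>

text \<open>
  To write concrete sentences legibly, a formula in context is a function from the number \<open>n\<close> of
  enclosing quantifiers to a de Bruijn formula. A variable is the level of its binder, i.e. the
  number of quantifiers enclosing that binder, so at depth \<open>n\<close> level \<open>x\<close> is the index
  \<open>n - Suc x\<close>. Applying a closed formula in context to 0 gives the sentence.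
\<close>

type_synonym cfm = "nat \<Rightarrow> fm"

definition cMem :: "nat \<Rightarrow> nat \<Rightarrow> cfm" (infix "\<^bold>\<in>" 50) where
  "(x \<^bold>\<in> y) = (\<lambda>n. Mem (n - Suc x) (n - Suc y))"
definition cEq :: "nat \<Rightarrow> nat \<Rightarrow> cfm" (infix "\<^bold>=" 50) where
  "(x \<^bold>= y) = (\<lambda>n. Eq (n - Suc x) (n - Suc y))"
definition cNeg :: "cfm \<Rightarrow> cfm" ("\<^bold>\<not> _" [40] 40) where
  "(\<^bold>\<not> P) = (\<lambda>n. Neg (P n))"
definition cCon :: "cfm \<Rightarrow> cfm \<Rightarrow> cfm" (infixr "\<^bold>\<and>" 35) where
  "(P \<^bold>\<and> Q) = (\<lambda>n. Con (P n) (Q n))"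
definition cDis :: "cfm \<Rightarrow> cfm \<Rightarrow> cfm" (infixr "\<^bold>\<or>" 30) where
  "(P \<^bold>\<or> Q) = (\<lambda>n. Dis (P n) (Q n))"
definition cImp :: "cfm \<Rightarrow> cfm \<Rightarrow> cfm" (infixr "\<^bold>\<longrightarrow>" 25) where
  "(P \<^bold>\<longrightarrow> Q) = (\<lambda>n. Imp (P n) (Q n))"
definition cIff :: "cfm \<Rightarrow> cfm \<Rightarrow> cfm" (infixr "\<^bold>\<longleftrightarrow>" 25) where
  "(P \<^bold>\<longleftrightarrow> Q) = (\<lambda>n. Iff (P n) (Q n))"
definition cAll :: "(nat \<Rightarrow> cfm) \<Rightarrow> cfm" (binder "\<^bold>\<forall>" 10) where
  "cAll P = (\<lambda>n. All (P n (Suc n)))"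
definition cEx :: "(nat \<Rightarrow> cfm) \<Rightarrow> cfm" (binder "\<^bold>\<exists>" 10) where
  "cEx P = (\<lambda>n. Ex (P n (Suc n)))"
definition cEx1 :: "(nat \<Rightarrow> cfm) \<Rightarrow> cfm" (binder "\<^bold>\<exists>\<^bold>!" 10) where
  "cEx1 P = (\<^bold>\<exists>x. P x \<^bold>\<and> (\<^bold>\<forall>y. P y \<^bold>\<longrightarrow> y \<^bold>= x))"


section \<open>Class theory\<close>

text \<open>
  All variables range over classes. The sets are the classes that are members of some class.
\<close>

definition is_set :: "nat \<Rightarrow> cfm" where
  "is_set x = (\<^bold>\<exists>y. x \<^bold>\<in> y)"

text \<open>\<open>\<^bold>\<forall>\<^sub>s\<close> and \<open>\<^bold>\<exists>\<^sub>s\<close> quantify over sets.\<close>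

definition sAll :: "(nat \<Rightarrow> cfm) \<Rightarrow> cfm" (binder "\<^bold>\<forall>\<^sub>s" 10) where
  "sAll P = (\<^bold>\<forall>x. is_set x \<^bold>\<longrightarrow> P x)"
definition sEx :: "(nat \<Rightarrow> cfm) \<Rightarrow> cfm" (binder "\<^bold>\<exists>\<^sub>s" 10) where
  "sEx P = (\<^bold>\<exists>x. is_set x \<^bold>\<and> P x)"
definition sEx1 :: "(nat \<Rightarrow> cfm) \<Rightarrow> cfm" (binder "\<^bold>\<exists>\<^sub>s\<^bold>!" 10) where
  "sEx1 P = (\<^bold>\<exists>\<^bold>!x. is_set x \<^bold>\<and> P x)"

definition is_empty :: "nat \<Rightarrow> cfm" where
  "is_empty x = (\<^bold>\<forall>y. \<^bold>\<not> y \<^bold>\<in> x)"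

definition included :: "nat \<Rightarrow> nat \<Rightarrow> cfm" where
  "included x y = (\<^bold>\<forall>z. z \<^bold>\<in> x \<^bold>\<longrightarrow> z \<^bold>\<in> y)"

text \<open>\<open>is_upair p x y\<close>: \<open>p = {x, y}\<close>; \<open>is_pair p x y\<close>: \<open>p = {{x}, {x, y}}\<close>.
  Both force \<open>x\<close> and \<open>y\<close> to be sets, since they are members.\<close>

definition is_upair :: "nat \<Rightarrow> nat \<Rightarrow> nat \<Rightarrow> cfm" where
  "is_upair p x y = (\<^bold>\<forall>w. w \<^bold>\<in> p \<^bold>\<longleftrightarrow> (w \<^bold>= x \<^bold>\<or> w \<^bold>= y))"
definition is_pair :: "nat \<Rightarrow> nat \<Rightarrow> nat \<Rightarrow> cfm" where
  "is_pair p x y = (\<^bold>\<exists>a. \<^bold>\<exists>b. is_upair a x x \<^bold>\<and> is_upair b x y \<^bold>\<and> is_upair p a b)"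

text \<open>\<open>related F x y\<close>: the ordered pair of \<open>x\<close> and \<open>y\<close> is a member of \<open>F\<close>.\<close>

definition related :: "nat \<Rightarrow> nat \<Rightarrow> nat \<Rightarrow> cfm" where
  "related F x y = (\<^bold>\<exists>p. is_pair p x y \<^bold>\<and> p \<^bold>\<in> F)"

text \<open>\<open>F \<subseteq> A \<times> B\<close>\<close>

definition rel_between :: "nat \<Rightarrow> nat \<Rightarrow> nat \<Rightarrow> cfm" where
  "rel_between F A B =
    (\<^bold>\<forall>p. p \<^bold>\<in> F \<^bold>\<longrightarrow> (\<^bold>\<exists>x. \<^bold>\<exists>y. x \<^bold>\<in> A \<^bold>\<and> y \<^bold>\<in> B \<^bold>\<and> is_pair p x y))"

definition fun_between :: "nat \<Rightarrow> nat \<Rightarrow> nat \<Rightarrow> cfm" where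
  "fun_between F A B =
    (rel_between F A B \<^bold>\<and> (\<^bold>\<forall>x. x \<^bold>\<in> A \<^bold>\<longrightarrow> (\<^bold>\<exists>\<^bold>!y. related F x y)))"

text \<open>A class that is a (possibly partial) function.\<close>

definition class_function :: "nat \<Rightarrow> cfm" where
  "class_function F =
    ((\<^bold>\<forall>p. p \<^bold>\<in> F \<^bold>\<longrightarrow> (\<^bold>\<exists>x. \<^bold>\<exists>y. is_pair p x y)) \<^bold>\<and>
     (\<^bold>\<forall>x. \<^bold>\<forall>y. \<^bold>\<forall>z. related F x y \<^bold>\<and> related F x z \<^bold>\<longrightarrow> y \<^bold>= z))"


subsection \<open>Goedel-Bernays set theory with the axiom of choice for sets\<close>

definition ax_extensionality :: cfm where
  "ax_extensionality =
    (\<^bold>\<forall>X. \<^bold>\<forall>Y. (\<^bold>\<forall>z. z \<^bold>\<in> X \<^bold>\<longleftrightarrow> z \<^bold>\<in> Y) \<^bold>\<longrightarrow> X \<^bold>= Y)"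

definition ax_pairing :: cfm where
  "ax_pairing = (\<^bold>\<forall>\<^sub>sx. \<^bold>\<forall>\<^sub>sy. \<^bold>\<exists>\<^sub>sp. is_upair p x y)"

definition ax_union :: cfm where
  "ax_union = (\<^bold>\<forall>\<^sub>sX. \<^bold>\<exists>\<^sub>sU. \<^bold>\<forall>u. u \<^bold>\<in> U \<^bold>\<longleftrightarrow> (\<^bold>\<exists>x. x \<^bold>\<in> X \<^bold>\<and> u \<^bold>\<in> x))"

definition ax_power :: cfm where
  "ax_power = (\<^bold>\<forall>\<^sub>sX. \<^bold>\<exists>\<^sub>sP. \<^bold>\<forall>\<^sub>su. u \<^bold>\<in> P \<^bold>\<longleftrightarrow> included u X)"

definition ax_infinity :: cfm where
  "ax_infinity =
    (\<^bold>\<exists>\<^sub>sI. (\<^bold>\<exists>z. is_empty z \<^bold>\<and> z \<^bold>\<in> I) \<^bold>\<and>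
      (\<^bold>\<forall>x. x \<^bold>\<in> I \<^bold>\<longrightarrow>
        (\<^bold>\<exists>y. y \<^bold>\<in> I \<^bold>\<and> (\<^bold>\<forall>w. w \<^bold>\<in> y \<^bold>\<longleftrightarrow> (w \<^bold>\<in> x \<^bold>\<or> w \<^bold>= x)))))"

text \<open>The image of a set under a class function is a set.\<close>

definition ax_replacement :: cfm where
  "ax_replacement =
    (\<^bold>\<forall>F. class_function F \<^bold>\<longrightarrow>
      (\<^bold>\<forall>\<^sub>sX. \<^bold>\<exists>\<^sub>sY. \<^bold>\<forall>y. y \<^bold>\<in> Y \<^bold>\<longleftrightarrow> (\<^bold>\<exists>x. x \<^bold>\<in> X \<^bold>\<and> related F x y)))"

definition ax_regularity :: cfm where
  "ax_regularity =
    (\<^bold>\<forall>X. \<^bold>\<not> is_empty X \<^bold>\<longrightarrow> (\<^bold>\<exists>x. x \<^bold>\<in> X \<^bold>\<and> \<^bold>\<not> (\<^bold>\<exists>y. y \<^bold>\<in> x \<^bold>\<and> y \<^bold>\<in> X)))"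

text \<open>Every set of nonempty sets has a choice function that is a set.\<close>

definition ax_choice :: cfm where
  "ax_choice =
    (\<^bold>\<forall>\<^sub>sX. (\<^bold>\<forall>x. x \<^bold>\<in> X \<^bold>\<longrightarrow> \<^bold>\<not> is_empty x) \<^bold>\<longrightarrow>
      (\<^bold>\<exists>\<^sub>sf. (\<^bold>\<exists>\<^sub>sU. fun_between f X U) \<^bold>\<and>
        (\<^bold>\<forall>x. \<^bold>\<forall>y. related f x y \<^bold>\<longrightarrow> y \<^bold>\<in> x)))"

text \<open>
  \<open>set_rel p\<close> restricts all quantifiers of \<open>p\<close> to sets, leaving its free variables as class
  parameters; these are the predicative formulas. In \<open>comprehension p\<close>, index 0 of \<open>p\<close> is the
  element variable \<open>x\<close> of \<open>{x. p x}\<close> and the other indices are parameters.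
\<close>

primrec set_rel :: "fm \<Rightarrow> fm" where
  "set_rel (Mem i j) = Mem i j"
| "set_rel (Eq i j) = Eq i j"
| "set_rel Fls = Fls"
| "set_rel (Imp p q) = Imp (set_rel p) (set_rel q)"
| "set_rel (All p) = All (Imp (Ex (Mem 1 0)) (set_rel p))"

definition comprehension :: "fm \<Rightarrow> fm" where
  "comprehension p = univ_closure
    (Ex (All (Iff (Mem 0 1)
      (Con (Ex (Mem 1 0)) (ren (case_nat 0 (\<lambda>i. Suc (Suc i))) (set_rel p))))))"

definition GB_AC :: "fm set" where
  "GB_AC = {ax_extensionality 0, ax_pairing 0, ax_union 0, ax_power 0, ax_infinity 0,
            ax_replacement 0, ax_regularity 0, ax_choice 0} \<union> range comprehension"


subsection \<open>Graphs and homomorphisms\<close>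

text \<open>\<open>graph_with g G E\<close>: \<open>g\<close> is the graph with vertex set \<open>G\<close> and edge relation \<open>E\<close>.\<close>

definition graph_with :: "nat \<Rightarrow> nat \<Rightarrow> nat \<Rightarrow> cfm" where
  "graph_with g G E = (is_pair g G E \<^bold>\<and> rel_between E G G)"

definition is_graph :: "nat \<Rightarrow> cfm" where
  "is_graph g = (\<^bold>\<exists>G. \<^bold>\<exists>E. graph_with g G E)"

definition is_hom :: "nat \<Rightarrow> nat \<Rightarrow> nat \<Rightarrow> cfm" where
  "is_hom h g g' =
    (\<^bold>\<exists>G. \<^bold>\<exists>E. \<^bold>\<exists>G'. \<^bold>\<exists>E'. graph_with g G E \<^bold>\<and> graph_with g' G' E' \<^bold>\<and> fun_between h G G' \<^bold>\<and>
      (\<^bold>\<forall>v. \<^bold>\<forall>w. \<^bold>\<forall>v'. \<^bold>\<forall>w'.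
        related E v w \<^bold>\<and> related h v v' \<^bold>\<and> related h w w' \<^bold>\<longrightarrow> related E' v' w'))"

definition is_identity :: "nat \<Rightarrow> nat \<Rightarrow> nat \<Rightarrow> cfm" where
  "is_identity h g g' =
    (g \<^bold>= g' \<^bold>\<and> is_hom h g g' \<^bold>\<and> (\<^bold>\<forall>x. \<^bold>\<forall>y. related h x y \<^bold>\<longrightarrow> x \<^bold>= y))"


subsection \<open>Ordinals and class sequences of graphs\<close>

text \<open>Regularity makes membership well-founded, so ordinals are the transitive sets that are
  linearly ordered by membership.\<close>

definition is_ordinal :: "nat \<Rightarrow> cfm" where
  "is_ordinal a =
    (is_set a \<^bold>\<and> (\<^bold>\<forall>x. x \<^bold>\<in> a \<^bold>\<longrightarrow> included x a) \<^bold>\<and>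
     (\<^bold>\<forall>x. \<^bold>\<forall>y. x \<^bold>\<in> a \<^bold>\<and> y \<^bold>\<in> a \<^bold>\<longrightarrow> (x \<^bold>\<in> y \<^bold>\<or> x \<^bold>= y \<^bold>\<or> y \<^bold>\<in> x)))"

definition graph_sequence :: "nat \<Rightarrow> cfm" where
  "graph_sequence S =
    ((\<^bold>\<forall>p. p \<^bold>\<in> S \<^bold>\<longrightarrow> (\<^bold>\<exists>a. \<^bold>\<exists>g. is_ordinal a \<^bold>\<and> is_graph g \<^bold>\<and> is_pair p a g)) \<^bold>\<and>
     (\<^bold>\<forall>a. is_ordinal a \<^bold>\<longrightarrow> (\<^bold>\<exists>\<^bold>!g. related S a g)))"


subsection \<open>The Vopenka principles\<close>

definition VP :: fm where
  "VP =
    (\<^bold>\<forall>C. \<^bold>\<not> is_set C \<^bold>\<and> (\<^bold>\<forall>g. g \<^bold>\<in> C \<^bold>\<longrightarrow> is_graph g) \<^bold>\<longrightarrow>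
      (\<^bold>\<exists>g. \<^bold>\<exists>g'. g \<^bold>\<in> C \<^bold>\<and> g' \<^bold>\<in> C \<^bold>\<and>
        (\<^bold>\<exists>\<^sub>sh. is_hom h g g' \<^bold>\<and> \<^bold>\<not> is_identity h g g'))) 0"

definition WVP :: fm where
  "WVP =
    (\<^bold>\<not> (\<^bold>\<exists>S. graph_sequence S \<^bold>\<and>
      (\<^bold>\<forall>a. \<^bold>\<forall>a'. \<^bold>\<forall>g. \<^bold>\<forall>g'. is_ordinal a \<^bold>\<and> is_ordinal a' \<^bold>\<and> related S a g \<^bold>\<and> related S a' g' \<^bold>\<longrightarrow>
        ((a \<^bold>\<in> a' \<^bold>\<or> a \<^bold>= a') \<^bold>\<longrightarrow> (\<^bold>\<exists>\<^sub>s\<^bold>!h. is_hom h g' g)) \<^bold>\<and>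
        (a \<^bold>\<in> a' \<^bold>\<longrightarrow> \<^bold>\<not> (\<^bold>\<exists>\<^sub>sh. is_hom h g g'))))) 0"

definition SWVP :: fm where
  "SWVP =
    (\<^bold>\<not> (\<^bold>\<exists>S. graph_sequence S \<^bold>\<and>
      (\<^bold>\<forall>a. \<^bold>\<forall>a'. \<^bold>\<forall>g. \<^bold>\<forall>g'. is_ordinal a \<^bold>\<and> is_ordinal a' \<^bold>\<and> related S a g \<^bold>\<and> related S a' g' \<^bold>\<longrightarrow>
        ((a \<^bold>\<in> a' \<^bold>\<or> a \<^bold>= a') \<^bold>\<longrightarrow> (\<^bold>\<exists>\<^sub>sh. is_hom h g' g)) \<^bold>\<and>
        (a \<^bold>\<in> a' \<^bold>\<longrightarrow> \<^bold>\<not> (\<^bold>\<exists>\<^sub>sh. is_hom h g g'))))) 0"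

end

(*
  If the theory GB + AC + W, where W is SWVP or WVP, is consistent and proves VP, take a model of it.
  The point is that GB + AC + VP yields a set v such that v with all its subsets as classes is a model
  of GB + AC + SWVP, hence of W. Then an \<in>-minimal transitive set v carrying a model of GB + AC + W
  also satisfies VP by soundness, so it has a smaller such set as a member, and this is a set of the
  same kind from the point of view of the original model: a contradiction.

  To find v, apply VP to the power sets of the levels of the cumulative hierarchy, equipped with
  finitely many relations coded into graphs. This gives a map j between two of them that is not an
  inclusion. Let v be the least level with a subset that is moved. Then j is the identity on v,
  v is a member of the level j(v), and preservation of the relations makes v a Grothendieck universe.
  If <Q_a : a < l> were a counterexample to SWVP over v, then T = j(Q) would extend it to a
  counterexample over j(v). Choose homomorphisms p_a from T_l to T_a = Q_a for a < l. Sending a vertex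
  x to the value at l + 1 of j(<p_a(x) : a < l>) defines a homomorphism from T_l to T_(l+1), which a
  counterexample excludes. This needs only that j preserves a few relations between subsets of v.
*)
theory Submission
  imports Defs "HOL-Library.Countable"
begin

section \<open>Semantics and completeness\<close>

text \<open>The model \<open>D\<close> may be ill-founded and have nonstandard natural numbers.
  Minimal elements in it come from the axiom of regularity only, and this applies only to predicates
  given by predicative formulas. Hence definability (\<open>dfb\<close>) accompanies the
  constructions, and the function \<open>f\<close> obtained from VP comes with a set
  \<open>H\<close> that codes it. By contrast, the collection \<open>sub D u\<close> of all subsets
  of an element \<open>u\<close> is a structure in the metatheory, so soundness applies to it
  directly, however nonstandard \<open>u\<close> is. Over a transitive \<open>u\<close>
  comprehension is automatic, so that being a model reduces to finitely many sentences, whose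
  satisfaction over \<open>u\<close> is definable.

  Graph homomorphisms preserve relations in one direction only and give no elementarity. A property
  wanted of v is therefore enforced by coding its failure as a relation: if it failed for v it would
  fail for j(v), but j(v) has as members v and all subsets of v, and one of these is a
  witness.\<close>

primrec sat :: "'a set \<Rightarrow> ('a \<Rightarrow> 'a \<Rightarrow> bool) \<Rightarrow> (nat \<Rightarrow> 'a) \<Rightarrow> fm \<Rightarrow> bool" where
  "sat D E e (Mem i j) = E (e i) (e j)"
| "sat D E e (Eq i j) = (e i = e j)"
| "sat D E e Fls = False"
| "sat D E e (Imp p q) = (sat D E e p \<longrightarrow> sat D E e q)"
| "sat D E e (All p) = (\<forall>x\<in>D. sat D E (case_nat x e) p)"

lemma sat_connectives [simp]:
  "sat D E e (Neg p) = (\<not> sat D E e p)"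
  "sat D E e (Con p q) = (sat D E e p \<and> sat D E e q)"
  "sat D E e (Dis p q) = (sat D E e p \<or> sat D E e q)"
  "sat D E e (Iff p q) = (sat D E e p \<longleftrightarrow> sat D E e q)"
  "sat D E e (Ex p) = (\<exists>x\<in>D. sat D E (case_nat x e) p)"
  by (auto simp: Neg_def Con_def Dis_def Iff_def Ex_def)

lemma sat_ren: "sat D E e (ren r p) = sat D E (\<lambda>i. e (r i)) p"
proof (induction p arbitrary: e r)
  case (All p)
  have "(\<lambda>i. case_nat x e (case_nat 0 (\<lambda>i. Suc (r i)) i)) = case_nat x (\<lambda>i. e (r i))" for x
    by (auto simp: fun_eq_iff split: nat.split)
  with All show ?case by simp
qed auto

lemma sat_inst: "sat D E e (inst t p) = sat D E (case_nat (e t) e) p"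
proof -
  have "(\<lambda>i. e (case_nat t (\<lambda>i. i) i)) = case_nat (e t) e"
    by (auto simp: fun_eq_iff split: nat.split)
  then show ?thesis by (simp add: inst_def sat_ren)
qed

lemma sat_cong_bnd: "(\<And>i. i < bnd p \<Longrightarrow> e i = e' i) \<Longrightarrow> sat D E e p = sat D E e' p"
proof (induction p arbitrary: e e')
  case (Imp p q)
  have "sat D E e p = sat D E e' p" "sat D E e q = sat D E e' q"
    by (rule Imp.IH, rule Imp.prems, simp)+
  then show ?case by simp
next
  case (All p)
  have "sat D E (case_nat x e) p = sat D E (case_nat x e') p" for x
    by (rule All.IH) (auto intro!: All.prems split: nat.split)
  then show ?case by simp
qed simp_all

lemma sat_closed: "bnd p = 0 \<Longrightarrow> sat D E e p = sat D E e' p"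
  by (rule sat_cong_bnd) auto

lemma soundness:
  assumes "\<Gamma> \<turnstile> p"
  shows "range e \<subseteq> D \<Longrightarrow> \<forall>q\<in>\<Gamma>. sat D E e q \<Longrightarrow> sat D E e p"
  using assms
proof (induction arbitrary: e rule: deriv.induct)
  case (AllI \<Gamma> p)
  have "sat D E (case_nat x e) p" if "x \<in> D" for x
    using that AllI.prems by (intro AllI.IH) (auto simp: sat_ren image_subset_iff split: nat.split)
  then show ?case by simp
next
  case (AllE \<Gamma> p t)
  then show ?case by (auto simp: sat_inst image_subset_iff)
next
  case (EqSubst \<Gamma> s t p)
  then show ?case by (simp add: sat_inst) metis
qed auto

section \<open>Renaming of variables in formulas and derivations\<close>

lemma ren_ren: "ren r (ren s p) = ren (\<lambda>i. r (s i)) p"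
proof (induction p arbitrary: r s)
  case (All p)
  have "(\<lambda>i. case_nat 0 (\<lambda>i. Suc (r i)) (case_nat 0 (\<lambda>i. Suc (s i)) i)) =
        case_nat 0 (\<lambda>i. Suc (r (s i)))"
    by (auto simp: fun_eq_iff split: nat.split)
  with All show ?case by simp
qed auto

lemma ren_id: "ren (\<lambda>i. i) p = p"
proof (induction p)
  case (All p)
  have "case_nat 0 (\<lambda>i. Suc i) = (\<lambda>i. i)"
    by (auto simp: fun_eq_iff split: nat.split)
  with All show ?case by simp
qed auto

primrec fv :: "fm \<Rightarrow> nat set" where
  "fv (Mem i j) = {i, j}"
| "fv (Eq i j) = {i, j}"
| "fv Fls = {}"
| "fv (Imp p q) = fv p \<union> fv q"
| "fv (All p) = {i. Suc i \<in> fv p}"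

lemma finite_fv: "finite (fv p)"
proof (induction p)
  case (All p)
  have "fv (All p) = Suc -` fv p" by auto
  with All show ?case by (metis finite_vimageI inj_Suc)
qed auto

lemma fv_ren: "fv (ren r p) = r ` fv p"
proof (induction p arbitrary: r)
  case (All p)
  have "Suc i \<in> case_nat 0 (\<lambda>i. Suc (r i)) ` A \<longleftrightarrow> (\<exists>j. Suc j \<in> A \<and> i = r j)" for i A
  proof
    assume "Suc i \<in> case_nat 0 (\<lambda>i. Suc (r i)) ` A"
    then obtain k where "k \<in> A" "Suc i = case_nat 0 (\<lambda>i. Suc (r i)) k" by auto
    then show "\<exists>j. Suc j \<in> A \<and> i = r j" by (cases k) auto
  qed (force intro: rev_image_eqI)
  with All show ?case by auto
qed auto

lemma ren_cong_fv: "(\<And>i. i \<in> fv p \<Longrightarrow> r i = s i) \<Longrightarrow> ren r p = ren s p"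
proof (induction p arbitrary: r s)
  case (Imp p q)
  have "ren r p = ren s p" "ren r q = ren s q"
    by (rule Imp.IH, rule Imp.prems, simp)+
  then show ?case by simp
next
  case (All p)
  have "ren (case_nat 0 (\<lambda>i. Suc (r i))) p = ren (case_nat 0 (\<lambda>i. Suc (s i))) p"
    by (rule All.IH) (auto intro!: All.prems split: nat.split)
  then show ?case by simp
qed simp_all

lemma ren_Neg: "ren r (Neg p) = Neg (ren r p)"
  by (simp add: Neg_def)

lemma ren_inst: "ren r (inst t p) = inst (r t) (ren (case_nat 0 (\<lambda>i. Suc (r i))) p)"
  by (auto simp: inst_def ren_ren intro!: arg_cong[of _ _ "\<lambda>f. ren f p"] split: nat.split)

lemma deriv_weaken: "\<Gamma> \<turnstile> p \<Longrightarrow> \<Gamma> \<subseteq> \<Delta> \<Longrightarrow> \<Delta> \<turnstile> p"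
proof (induction arbitrary: \<Delta> rule: deriv.induct)
  case (ImpI p \<Gamma> q)
  then show ?case by (meson deriv.ImpI insert_mono)
next
  case (Contra p \<Gamma>)
  then show ?case by (meson deriv.Contra insert_mono)
next
  case (AllI \<Gamma> p)
  then show ?case by (meson deriv.AllI image_mono)
next
  case (EqSubst \<Gamma> s t p)
  then show ?case by (meson deriv.EqSubst)
qed (blast intro: deriv.intros)+

lemma deriv_ren: "\<Gamma> \<turnstile> p \<Longrightarrow> ren r ` \<Gamma> \<turnstile> ren r p"
proof (induction arbitrary: r rule: deriv.induct)
  case (ImpI p \<Gamma> q)
  then show ?case by (auto intro: deriv.ImpI)
next
  case (Contra p \<Gamma>)
  have "insert (Neg (ren r p)) (ren r ` \<Gamma>) \<turnstile> Fls"
    using Contra.IH[of r] by (simp add: ren_Neg)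
  then show ?case by (rule deriv.Contra)
next
  case (AllI \<Gamma> p)
  have "ren (case_nat 0 (\<lambda>i. Suc (r i))) ` ren Suc ` \<Gamma> = ren Suc ` ren r ` \<Gamma>"
    by (simp add: image_image ren_ren)
  with AllI.IH[of "case_nat 0 (\<lambda>i. Suc (r i))"] show ?case
    by (auto intro: deriv.AllI)
next
  case (AllE \<Gamma> p t)
  then show ?case by (auto simp: ren_inst intro: deriv.AllE)
next
  case (EqSubst \<Gamma> s t p)
  then show ?case by (auto simp: ren_inst intro: deriv.EqSubst)
qed (auto intro: deriv.intros)

lemma deriv_finite: "\<Gamma> \<turnstile> p \<Longrightarrow> \<exists>\<Gamma>0. finite \<Gamma>0 \<and> \<Gamma>0 \<subseteq> \<Gamma> \<and> \<Gamma>0 \<turnstile> p"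
proof (induction rule: deriv.induct)
  case (Assm p \<Gamma>)
  then show ?case by (intro exI[of _ "{p}"]) (auto intro: deriv.Assm)
next
  case (ImpI p \<Gamma> q)
  then obtain \<Gamma>0 where "finite \<Gamma>0" "\<Gamma>0 \<subseteq> insert p \<Gamma>" "\<Gamma>0 \<turnstile> q" by auto
  then show ?case
    by (intro exI[of _ "\<Gamma>0 - {p}"] conjI deriv.ImpI deriv_weaken[OF \<open>\<Gamma>0 \<turnstile> q\<close>]) auto
next
  case (ImpE \<Gamma> p q)
  then obtain \<Gamma>0 \<Gamma>1 where "finite \<Gamma>0" "\<Gamma>0 \<subseteq> \<Gamma>" "\<Gamma>0 \<turnstile> Imp p q" "finite \<Gamma>1" "\<Gamma>1 \<subseteq> \<Gamma>" "\<Gamma>1 \<turnstile> p" by auto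
  then show ?case
    by (intro exI[of _ "\<Gamma>0 \<union> \<Gamma>1"] conjI deriv.ImpE[of _ p q]
        deriv_weaken[OF \<open>\<Gamma>0 \<turnstile> Imp p q\<close>] deriv_weaken[OF \<open>\<Gamma>1 \<turnstile> p\<close>]) auto
next
  case (Contra p \<Gamma>)
  then obtain \<Gamma>0 where "finite \<Gamma>0" "\<Gamma>0 \<subseteq> insert (Neg p) \<Gamma>" "\<Gamma>0 \<turnstile> Fls" by auto
  then show ?case
    by (intro exI[of _ "\<Gamma>0 - {Neg p}"] conjI deriv.Contra[of p] deriv_weaken[OF \<open>\<Gamma>0 \<turnstile> Fls\<close>])
      auto
next
  case (AllI \<Gamma> p)
  then obtain \<Gamma>0 where 0: "finite \<Gamma>0" "\<Gamma>0 \<subseteq> ren Suc ` \<Gamma>" "\<Gamma>0 \<turnstile> p" by auto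
  then obtain \<Gamma>1 where "finite \<Gamma>1" "\<Gamma>1 \<subseteq> \<Gamma>" "\<Gamma>0 = ren Suc ` \<Gamma>1"
    by (meson finite_subset_image)
  with 0 show ?case by (auto intro: deriv.AllI)
next
  case (AllE \<Gamma> p t)
  then show ?case by (auto intro: deriv.AllE)
next
  case (EqRefl \<Gamma> t)
  show ?case by (intro exI[of _ "{}"]) (auto intro: deriv.EqRefl)
next
  case (EqSubst \<Gamma> s t p)
  then obtain \<Gamma>0 \<Gamma>1 where "finite \<Gamma>0" "\<Gamma>0 \<subseteq> \<Gamma>" "\<Gamma>0 \<turnstile> Eq s t"
      "finite \<Gamma>1" "\<Gamma>1 \<subseteq> \<Gamma>" "\<Gamma>1 \<turnstile> inst s p" by auto
  then show ?case
    by (intro exI[of _ "\<Gamma>0 \<union> \<Gamma>1"] conjI deriv.EqSubst[of _ s t p]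
        deriv_weaken[OF \<open>\<Gamma>0 \<turnstile> Eq s t\<close>] deriv_weaken[OF \<open>\<Gamma>1 \<turnstile> inst s p\<close>]) auto
qed

text \<open>Generalization over a named variable, obtained from the shifting rule
  \<open>AllI\<close>: the renaming that sends \<open>k\<close> to 0 and every other index up by one
  turns \<open>inst k q\<close> into \<open>q\<close> and acts on the hypotheses as
  \<open>Suc\<close>.\<close>

lemma deriv_AllI_fresh:
  assumes "\<Gamma> \<turnstile> inst k q" and fresh: "\<forall>p\<in>\<Gamma>. k \<notin> fv p" "k \<notin> fv (All q)"
  shows "\<Gamma> \<turnstile> All q"
proof -
  let ?r = "\<lambda>i. if i = k then 0 else Suc i"
  have "ren ?r (inst k q) = ren (\<lambda>i. i) q"
    using fresh(2) unfolding inst_def ren_ren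
    by (intro ren_cong_fv) (auto split: nat.split)
  moreover have "ren ?r ` \<Gamma> = ren Suc ` \<Gamma>"
    using fresh(1) by (intro image_cong refl ren_cong_fv) auto
  ultimately show ?thesis
    using deriv_ren[OF assms(1), of ?r] by (auto simp: ren_id intro: deriv.AllI)
qed

section \<open>Henkin's maximal consistent sets and the term model\<close>

instance fm :: countable by countable_datatype

text \<open>The witness for a negated universal formula is a variable, so no constants have to be
  added to the language.\<close>

primrec henkin :: "fm set \<Rightarrow> nat \<Rightarrow> fm set" where
  "henkin T 0 = T"
| "henkin T (Suc n) =
    (let \<Gamma> = insert (from_nat n) (henkin T n) in
     if consistent \<Gamma>
     then \<Gamma> \<union> {Neg (inst (SOME k. \<forall>p\<in>\<Gamma>. k \<notin> fv p) q) |q. from_nat n = Neg (All q)}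
     else henkin T n)"

text \<open>If adding the instance were inconsistent, \<open>inst k q\<close> would be derivable,
  and generalizing over the fresh \<open>k\<close> would contradict
  \<open>Neg (All q)\<close>.\<close>

lemma consistent_witness:
  assumes con: "consistent \<Gamma>" and mem: "Neg (All q) \<in> \<Gamma>" and fresh: "\<forall>p\<in>\<Gamma>. k \<notin> fv p"
  shows "consistent (insert (Neg (inst k q)) \<Gamma>)"
proof -
  have "\<Gamma> \<turnstile> Fls" if "insert (Neg (inst k q)) \<Gamma> \<turnstile> Fls"
  proof -
    have "\<Gamma> \<turnstile> inst k q" using that by (rule deriv.Contra)
    moreover have "k \<notin> fv (All q)" using fresh mem by (auto simp: Neg_def)
    ultimately have "\<Gamma> \<turnstile> All q" using fresh by (intro deriv_AllI_fresh)
    moreover have "\<Gamma> \<turnstile> Imp (All q) Fls" using mem by (auto simp: Neg_def intro: deriv.Assm)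
    ultimately show ?thesis by (rule deriv.ImpE[rotated])
  qed
  then show ?thesis using con by (auto simp: consistent_def)
qed

lemma Neg_All_inject: "Neg (All p) = Neg (All q) \<longleftrightarrow> p = q"
  by (simp add: Neg_def)

text \<open>Each stage adds at most two formulas and so uses up only finitely many variables; a
  fresh witness is always left.\<close>

lemma henkin_invariant:
  assumes "consistent T" "infinite {k. \<forall>p\<in>T. k \<notin> fv p}"
  shows "consistent (henkin T n) \<and> infinite {k. \<forall>p\<in>henkin T n. k \<notin> fv p}"
proof (induction n)
  case (Suc n)
  define \<Gamma> where "\<Gamma> = insert (from_nat n) (henkin T n)"
  define k where "k = (SOME k. \<forall>p\<in>\<Gamma>. k \<notin> fv p)"
  have inf: "infinite {k. \<forall>p\<in>\<Gamma>. k \<notin> fv p}"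
  proof -
    have "{k. \<forall>p\<in>\<Gamma>. k \<notin> fv p} = {k. \<forall>p\<in>henkin T n. k \<notin> fv p} - fv (from_nat n)"
      by (auto simp: \<Gamma>_def)
    then show ?thesis using Suc finite_fv by (simp add: Diff_infinite_finite)
  qed
  show ?case
  proof (cases "consistent \<Gamma>")
    case False
    then show ?thesis using Suc by (simp add: \<Gamma>_def)
  next
    case True
    show ?thesis
    proof (cases "\<exists>q. from_nat n = Neg (All q)")
      case False
      then have "henkin T (Suc n) = \<Gamma>" using True by (simp add: \<Gamma>_def)
      then show ?thesis using True inf by simp
    next
      case ex: True
      then obtain q where q: "from_nat n = Neg (All q)" by auto
      then have eq: "henkin T (Suc n) = insert (Neg (inst k q)) \<Gamma>"
      proof -
        have "henkin T (Suc n) = \<Gamma> \<union> {Neg (inst k r) |r. from_nat n = Neg (All r)}"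
          using True by (simp add: \<Gamma>_def k_def Let_def)
        then show ?thesis by (simp add: q Neg_All_inject)
      qed
      have "\<forall>p\<in>\<Gamma>. k \<notin> fv p"
        unfolding k_def using not_finite_existsD[OF inf] by (rule someI_ex)
      then have "consistent (henkin T (Suc n))"
        unfolding eq using True q by (intro consistent_witness) (auto simp: \<Gamma>_def)
      moreover have "{k. \<forall>p\<in>henkin T (Suc n). k \<notin> fv p} =
          {k. \<forall>p\<in>\<Gamma>. k \<notin> fv p} - fv (Neg (inst k q))"
        unfolding eq by auto
      ultimately show ?thesis using inf finite_fv by (simp add: Diff_infinite_finite)
    qed
  qed
qed (use assms in simp)

lemma henkin_mono: "m \<le> n \<Longrightarrow> henkin T m \<subseteq> henkin T n"
  by (rule lift_Suc_mono_le[of "henkin T"]) (auto simp: Let_def)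

lemma henkin_extension:
  assumes "consistent T" "infinite {k. \<forall>p\<in>T. k \<notin> fv p}"
  obtains \<Delta> where "T \<subseteq> \<Delta>" "consistent \<Delta>" "\<And>p. p \<in> \<Delta> \<or> \<not> consistent (insert p \<Delta>)"
    "\<And>q. Neg (All q) \<in> \<Delta> \<Longrightarrow> \<exists>k. Neg (inst k q) \<in> \<Delta>"
proof
  let ?\<Delta> = "\<Union>n. henkin T n"
  show "T \<subseteq> ?\<Delta>" by (auto intro: UN_I[of 0])
  \<comment> \<open>An inconsistency has a derivation from finitely many hypotheses and so already
    occurs at some stage.\<close>
  show con: "consistent ?\<Delta>"
  proof (rule ccontr)
    assume "\<not> consistent ?\<Delta>"
    then obtain \<Gamma> where \<Gamma>: "finite \<Gamma>" "\<Gamma> \<subseteq> ?\<Delta>" "\<Gamma> \<turnstile> Fls"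
      unfolding consistent_def not_not by (meson deriv_finite)
    then obtain n where "\<Gamma> \<subseteq> henkin T n"
    proof -
      have "\<exists>n. \<Gamma> \<subseteq> henkin T n" using \<Gamma>(1,2)
      proof (induction rule: finite_induct)
        case (insert p F)
        then obtain m n where "p \<in> henkin T m" "F \<subseteq> henkin T n" by auto
        then have "insert p F \<subseteq> henkin T (max m n)"
          using henkin_mono[of m "max m n" T] henkin_mono[of n "max m n" T] by auto
        then show ?case by blast
      qed simp
      then show ?thesis using that by blast
    qed
    then show False
      using \<Gamma>(3) henkin_invariant[OF assms, of n] by (meson consistent_def deriv_weaken)
  qed
  show "p \<in> ?\<Delta> \<or> \<not> consistent (insert p ?\<Delta>)" for p
  proof (cases "consistent (insert p (henkin T (to_nat p)))")
    case True
    then have "p \<in> henkin T (Suc (to_nat p))" by simp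
    then show ?thesis by blast
  next
    case False
    then have "\<not> consistent (insert p ?\<Delta>)"
      unfolding consistent_def not_not by (rule deriv_weaken) auto
    then show ?thesis by simp
  qed
  show "\<exists>k. Neg (inst k q) \<in> ?\<Delta>" if "Neg (All q) \<in> ?\<Delta>" for q
  proof -
    let ?n = "to_nat (Neg (All q))"
    have "insert (Neg (All q)) (henkin T ?n) \<subseteq> ?\<Delta>" using that by auto
    then have "consistent (insert (Neg (All q)) (henkin T ?n))"
      using con by (meson consistent_def deriv_weaken)
    then have "\<exists>k. Neg (inst k q) \<in> henkin T (Suc ?n)"
      by (auto simp: Let_def Neg_All_inject)
    then show ?thesis by blast
  qed
qed

theorem model_existence:
  assumes "consistent T"
  obtains D :: "nat set" and E e where "range e \<subseteq> D" "\<forall>p\<in>T. sat D E e p"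
proof -
  text \<open>Moving the free variables of \<open>T\<close> to the even indices leaves room for the witnesses.\<close>
  define T' where "T' = ren (\<lambda>i. 2 * i) ` T"
  have "consistent T'"
  proof -
    have "ren (\<lambda>i. i div 2) ` T' = T" by (simp add: T'_def image_image ren_ren ren_id)
    then show ?thesis
      using assms deriv_ren[of T' Fls "\<lambda>i. i div 2"] by (auto simp: consistent_def)
  qed
  moreover have "infinite {k. \<forall>p\<in>T'. k \<notin> fv p}"
  proof (rule infinite_super)
    show "range (\<lambda>i. Suc (2 * i)) \<subseteq> {k. \<forall>p\<in>T'. k \<notin> fv p}"
      by (auto simp: T'_def fv_ren) presburger
    show "infinite (range (\<lambda>i::nat. Suc (2 * i)))"
      by (simp add: finite_image_iff inj_def)
  qed
  ultimately obtain \<Delta> where sub: "T' \<subseteq> \<Delta>" and con: "consistent \<Delta>"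
    and max: "\<And>p. p \<in> \<Delta> \<or> \<not> consistent (insert p \<Delta>)"
    and wit: "\<And>q. Neg (All q) \<in> \<Delta> \<Longrightarrow> \<exists>k. Neg (inst k q) \<in> \<Delta>"
    by (rule henkin_extension) blast
  have closed: "p \<in> \<Delta>" if "\<Delta> \<turnstile> p" for p
  proof -
    have "\<Delta> \<turnstile> Fls" if "insert p \<Delta> \<turnstile> Fls"
      using \<open>\<Delta> \<turnstile> p\<close> deriv.ImpI[OF that] by (metis deriv.ImpE)
    then show ?thesis using max[of p] con by (auto simp: consistent_def)
  qed
  have Neg: "Neg p \<in> \<Delta> \<longleftrightarrow> p \<notin> \<Delta>" for p
  proof
    assume "Neg p \<in> \<Delta>"
    then show "p \<notin> \<Delta>"
      using con unfolding consistent_def Neg_def by (metis deriv.Assm deriv.ImpE)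
  next
    assume "p \<notin> \<Delta>"
    then have "insert p \<Delta> \<turnstile> Fls" using max[of p] by (simp add: consistent_def)
    then show "Neg p \<in> \<Delta>" unfolding Neg_def by (rule closed[OF deriv.ImpI])
  qed
  have Imp: "Imp p q \<in> \<Delta> \<longleftrightarrow> (p \<in> \<Delta> \<longrightarrow> q \<in> \<Delta>)" for p q
  proof
    assume "Imp p q \<in> \<Delta>"
    then show "p \<in> \<Delta> \<longrightarrow> q \<in> \<Delta>" by (metis closed deriv.Assm deriv.ImpE)
  next
    assume *: "p \<in> \<Delta> \<longrightarrow> q \<in> \<Delta>"
    show "Imp p q \<in> \<Delta>"
    proof (cases "p \<in> \<Delta>")
      case True
      then show ?thesis using * by (auto intro: closed[OF deriv.ImpI[OF deriv.Assm]])
    next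
      case False
      then have "Neg p \<in> \<Delta>" using Neg by simp
      then have "insert p \<Delta> \<turnstile> Fls" unfolding Neg_def
        by (auto intro: deriv.ImpE[OF deriv.Assm deriv.Assm])
      then have "insert p \<Delta> \<turnstile> q"
          by (rule deriv.Contra[OF deriv_weaken]) auto
      then show ?thesis by (rule closed[OF deriv.ImpI])
    qed
  qed
  have All_iff: "All q \<in> \<Delta> \<longleftrightarrow> (\<forall>k. inst k q \<in> \<Delta>)" for q
    using wit[of q] Neg by (metis closed deriv.AllE deriv.Assm)
  have refl: "Eq i i \<in> \<Delta>" for i by (intro closed deriv.EqRefl)
  have subst: "inst j p \<in> \<Delta>" if "Eq i j \<in> \<Delta>" "inst i p \<in> \<Delta>" for i j p
    using that by (intro closed) (metis deriv.EqSubst deriv.Assm)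
  have sym: "Eq j i \<in> \<Delta>" if "Eq i j \<in> \<Delta>" for i j
    using subst[OF that, of "Eq 0 (Suc i)"] refl by (simp add: inst_def)
  have trans: "Eq i k \<in> \<Delta>" if "Eq i j \<in> \<Delta>" "Eq j k \<in> \<Delta>" for i j k
    using subst[OF that(2), of "Eq (Suc i) 0"] that by (simp add: inst_def)
  \<comment> \<open>The domain consists of the least index of each class of indices equated by
    \<open>\<Delta>\<close>, so that \<open>Eq\<close> becomes true equality.\<close>
  define rep where "rep i = (LEAST j. Eq i j \<in> \<Delta>)" for i
  have rep: "Eq i (rep i) \<in> \<Delta>" for i
    unfolding rep_def by (rule LeastI) (rule refl)
  have rep_eq: "rep i = rep j \<longleftrightarrow> Eq i j \<in> \<Delta>" for i j
  proof
    assume "rep i = rep j"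
    then show "Eq i j \<in> \<Delta>" by (metis rep sym trans)
  next
    assume "Eq i j \<in> \<Delta>"
    then have "Eq i k \<in> \<Delta> \<longleftrightarrow> Eq j k \<in> \<Delta>" for k by (metis sym trans)
    then show "rep i = rep j" by (simp add: rep_def)
  qed
  define E where "E i j \<longleftrightarrow> Mem i j \<in> \<Delta>" for i j
  have E_rep: "E (rep i) (rep j) \<longleftrightarrow> Mem i j \<in> \<Delta>" for i j
  proof -
    have cong: "Mem k l \<in> \<Delta>" if "Eq i k \<in> \<Delta>" "Eq j l \<in> \<Delta>" "Mem i j \<in> \<Delta>" for i j k l
      using subst[OF that(1), of "Mem 0 (Suc j)"] subst[OF that(2), of "Mem (Suc k) 0"] that(3)
      by (simp add: inst_def)
    show ?thesis unfolding E_def using cong rep sym by blast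
  qed
  \<comment> \<open>Stated for all renamings \<open>s\<close>, because the quantifier case uses the
    induction hypothesis for \<open>case_nat k s\<close>.\<close>
  have truth: "sat (range rep) E (\<lambda>i. rep (s i)) p \<longleftrightarrow> ren s p \<in> \<Delta>" for s p
  proof (induction p arbitrary: s)
    case Fls
    show ?case using con by (auto simp: consistent_def intro: deriv.Assm)
  next
    case (All p)
    note IH = All.IH
    have "case_nat (rep k) (\<lambda>i. rep (s i)) = (\<lambda>i. rep (case_nat k s i))" for k
      by (auto simp: fun_eq_iff split: nat.split)
    moreover have "inst k (ren (case_nat 0 (\<lambda>i. Suc (s i))) p) = ren (case_nat k s) p" for k
      by (auto simp: inst_def ren_ren intro!: arg_cong[of _ _ "\<lambda>f. ren f p"] split: nat.split)
    ultimately show ?case using IH by (simp add: All_iff)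
  qed (auto simp: rep_eq E_rep Imp)
  have "\<forall>p\<in>T. sat (range rep) E (\<lambda>i. rep (2 * i)) p"
    using sub truth by (auto simp: T'_def)
  then show thesis by (intro that[of "\<lambda>i. rep (2 * i)" "range rep" E]) auto
qed

section \<open>The meaning of the class-theoretic formulas\<close>

text \<open>Level assignments \<open>\<rho>\<close> become de Bruijn environments at depth \<open>n\<close>.\<close>

definition lvl_env :: "(nat \<Rightarrow> 'a) \<Rightarrow> nat \<Rightarrow> (nat \<Rightarrow> 'a) \<Rightarrow> nat \<Rightarrow> 'a" where
  "lvl_env \<rho> n e i = (if i < n then \<rho> (n - Suc i) else e (i - n))"

lemma case_nat_lvl_env: "case_nat x (lvl_env \<rho> n e) = lvl_env (\<rho>(n := x)) (Suc n) e"
  by (auto simp: fun_eq_iff lvl_env_def split: nat.split)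

lemma lvl_env_0: "lvl_env \<rho> 0 e = e"
  by (auto simp: fun_eq_iff lvl_env_def)

locale membership =
  fixes E :: "'a \<Rightarrow> 'a \<Rightarrow> bool" (infix "\<epsilon>" 50)
begin

definition st :: "'a set \<Rightarrow> 'a \<Rightarrow> bool" where
  "st D x \<longleftrightarrow> (\<exists>y\<in>D. x \<epsilon> y)"

definition upr :: "'a set \<Rightarrow> 'a \<Rightarrow> 'a \<Rightarrow> 'a \<Rightarrow> bool" where
  "upr D p x y \<longleftrightarrow> (\<forall>w\<in>D. w \<epsilon> p \<longleftrightarrow> w = x \<or> w = y)"

definition pr :: "'a set \<Rightarrow> 'a \<Rightarrow> 'a \<Rightarrow> 'a \<Rightarrow> bool" where
  "pr D p x y \<longleftrightarrow> (\<exists>a\<in>D. \<exists>b\<in>D. upr D a x x \<and> upr D b x y \<and> upr D p a b)"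

definition rel :: "'a set \<Rightarrow> 'a \<Rightarrow> 'a \<Rightarrow> 'a \<Rightarrow> bool" where
  "rel D F x y \<longleftrightarrow> (\<exists>p\<in>D. pr D p x y \<and> p \<epsilon> F)"

definition relb :: "'a set \<Rightarrow> 'a \<Rightarrow> 'a \<Rightarrow> 'a \<Rightarrow> bool" where
  "relb D F A B \<longleftrightarrow> (\<forall>p\<in>D. p \<epsilon> F \<longrightarrow> (\<exists>x\<in>D. \<exists>y\<in>D. x \<epsilon> A \<and> y \<epsilon> B \<and> pr D p x y))"

definition funb :: "'a set \<Rightarrow> 'a \<Rightarrow> 'a \<Rightarrow> 'a \<Rightarrow> bool" where
  "funb D F A B \<longleftrightarrow> relb D F A B \<and>
    (\<forall>x\<in>D. x \<epsilon> A \<longrightarrow> (\<exists>y\<in>D. rel D F x y \<and> (\<forall>z\<in>D. rel D F x z \<longrightarrow> z = y)))"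

definition clsfun :: "'a set \<Rightarrow> 'a \<Rightarrow> bool" where
  "clsfun D F \<longleftrightarrow> (\<forall>p\<in>D. p \<epsilon> F \<longrightarrow> (\<exists>x\<in>D. \<exists>y\<in>D. pr D p x y)) \<and>
    (\<forall>x\<in>D. \<forall>y\<in>D. \<forall>z\<in>D. rel D F x y \<and> rel D F x z \<longrightarrow> y = z)"

definition grw :: "'a set \<Rightarrow> 'a \<Rightarrow> 'a \<Rightarrow> 'a \<Rightarrow> bool" where
  "grw D g V A \<longleftrightarrow> pr D g V A \<and> relb D A V V"

definition gr :: "'a set \<Rightarrow> 'a \<Rightarrow> bool" where
  "gr D g \<longleftrightarrow> (\<exists>V\<in>D. \<exists>A\<in>D. grw D g V A)"

definition hom :: "'a set \<Rightarrow> 'a \<Rightarrow> 'a \<Rightarrow> 'a \<Rightarrow> bool" where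
  "hom D h g g' \<longleftrightarrow> (\<exists>V\<in>D. \<exists>A\<in>D. \<exists>V'\<in>D. \<exists>A'\<in>D. grw D g V A \<and> grw D g' V' A' \<and> funb D h V V' \<and>
    (\<forall>v\<in>D. \<forall>w\<in>D. \<forall>v'\<in>D. \<forall>w'\<in>D. rel D A v w \<and> rel D h v v' \<and> rel D h w w' \<longrightarrow> rel D A' v' w'))"

definition ident :: "'a set \<Rightarrow> 'a \<Rightarrow> 'a \<Rightarrow> 'a \<Rightarrow> bool" where
  "ident D h g g' \<longleftrightarrow> g = g' \<and> hom D h g g' \<and> (\<forall>x\<in>D. \<forall>y\<in>D. rel D h x y \<longrightarrow> x = y)"

definition ordn :: "'a set \<Rightarrow> 'a \<Rightarrow> bool" where
  "ordn D a \<longleftrightarrow> st D a \<and> (\<forall>x\<in>D. x \<epsilon> a \<longrightarrow> (\<forall>z\<in>D. z \<epsilon> x \<longrightarrow> z \<epsilon> a)) \<and>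
    (\<forall>x\<in>D. \<forall>y\<in>D. x \<epsilon> a \<and> y \<epsilon> a \<longrightarrow> x \<epsilon> y \<or> x = y \<or> y \<epsilon> x)"

definition gseq :: "'a set \<Rightarrow> 'a \<Rightarrow> bool" where
  "gseq D S \<longleftrightarrow> (\<forall>p\<in>D. p \<epsilon> S \<longrightarrow> (\<exists>a\<in>D. \<exists>g\<in>D. ordn D a \<and> gr D g \<and> pr D p a g)) \<and>
    (\<forall>a\<in>D. ordn D a \<longrightarrow> (\<exists>g\<in>D. rel D S a g \<and> (\<forall>g'\<in>D. rel D S a g' \<longrightarrow> g' = g)))"

definition vp :: "'a set \<Rightarrow> bool" where
  "vp D \<longleftrightarrow> (\<forall>C\<in>D. \<not> st D C \<and> (\<forall>g\<in>D. g \<epsilon> C \<longrightarrow> gr D g) \<longrightarrow>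
    (\<exists>g\<in>D. \<exists>g'\<in>D. g \<epsilon> C \<and> g' \<epsilon> C \<and> (\<exists>h\<in>D. st D h \<and> hom D h g g' \<and> \<not> ident D h g g')))"

definition no_hom_up :: "'a set \<Rightarrow> 'a \<Rightarrow> 'a \<Rightarrow> 'a \<Rightarrow> 'a \<Rightarrow> bool" where
  "no_hom_up D a a' g g' \<longleftrightarrow> (a \<epsilon> a' \<longrightarrow> \<not> (\<exists>h\<in>D. st D h \<and> hom D h g g'))"

definition swcex :: "'a set \<Rightarrow> 'a \<Rightarrow> bool" where
  "swcex D S \<longleftrightarrow> gseq D S \<and> (\<forall>a\<in>D. \<forall>a'\<in>D. \<forall>g\<in>D. \<forall>g'\<in>D.
    ordn D a \<and> ordn D a' \<and> rel D S a g \<and> rel D S a' g' \<longrightarrow>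
    (a \<epsilon> a' \<or> a = a' \<longrightarrow> (\<exists>h\<in>D. st D h \<and> hom D h g' g)) \<and> no_hom_up D a a' g g')"

definition wcex :: "'a set \<Rightarrow> 'a \<Rightarrow> bool" where
  "wcex D S \<longleftrightarrow> gseq D S \<and> (\<forall>a\<in>D. \<forall>a'\<in>D. \<forall>g\<in>D. \<forall>g'\<in>D.
    ordn D a \<and> ordn D a' \<and> rel D S a g \<and> rel D S a' g' \<longrightarrow>
    (a \<epsilon> a' \<or> a = a' \<longrightarrow> (\<exists>h\<in>D. (st D h \<and> hom D h g' g) \<and>
       (\<forall>k\<in>D. st D k \<and> hom D k g' g \<longrightarrow> k = h))) \<and> no_hom_up D a a' g g')"

lemma wcex_imp_swcex: "wcex D S \<Longrightarrow> swcex D S"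
  unfolding wcex_def swcex_def by blast

text \<open>Satisfaction at depth \<open>n\<close> with values assigned to levels instead of
  indices. With the rules below, simplification alone translates a formula with named variables; a
  side condition \<open>x < n\<close> says that the level \<open>x\<close> is bound.\<close>

definition csat :: "'a set \<Rightarrow> (nat \<Rightarrow> 'a) \<Rightarrow> (nat \<Rightarrow> 'a) \<Rightarrow> nat \<Rightarrow> cfm \<Rightarrow> bool" where
  "csat D e \<rho> n P \<longleftrightarrow> sat D E (lvl_env \<rho> n e) (P n)"

lemma sat_eq_csat: "sat D E e (P 0) = csat D e \<rho> 0 P"
  by (simp add: csat_def lvl_env_0)

lemma csat_simps [simp]:
  "x < n \<Longrightarrow> y < n \<Longrightarrow> csat D e \<rho> n (x \<^bold>\<in> y) = (\<rho> x \<epsilon> \<rho> y)"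
  "x < n \<Longrightarrow> y < n \<Longrightarrow> csat D e \<rho> n (x \<^bold>= y) = (\<rho> x = \<rho> y)"
  "csat D e \<rho> n (\<^bold>\<not> P) = (\<not> csat D e \<rho> n P)"
  "csat D e \<rho> n (P \<^bold>\<and> Q) = (csat D e \<rho> n P \<and> csat D e \<rho> n Q)"
  "csat D e \<rho> n (P \<^bold>\<or> Q) = (csat D e \<rho> n P \<or> csat D e \<rho> n Q)"
  "csat D e \<rho> n (P \<^bold>\<longrightarrow> Q) = (csat D e \<rho> n P \<longrightarrow> csat D e \<rho> n Q)"
  "csat D e \<rho> n (P \<^bold>\<longleftrightarrow> Q) = (csat D e \<rho> n P \<longleftrightarrow> csat D e \<rho> n Q)"
  "csat D e \<rho> n (cAll R) = (\<forall>x\<in>D. csat D e (\<rho>(n := x)) (Suc n) (R n))"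
  "csat D e \<rho> n (cEx R) = (\<exists>x\<in>D. csat D e (\<rho>(n := x)) (Suc n) (R n))"
  by (auto simp: csat_def cMem_def cEq_def cNeg_def cCon_def cDis_def cImp_def cIff_def cAll_def
      cEx_def case_nat_lvl_env lvl_env_def)

lemma csat_is_set [simp]: "x < n \<Longrightarrow> csat D e \<rho> n (is_set x) = st D (\<rho> x)"
  by (simp add: is_set_def st_def)

lemma csat_sAll [simp]:
  "csat D e \<rho> n (sAll R) = (\<forall>x\<in>D. st D x \<longrightarrow> csat D e (\<rho>(n := x)) (Suc n) (R n))"
  by (simp add: sAll_def)

lemma csat_sEx [simp]:
  "csat D e \<rho> n (sEx R) = (\<exists>x\<in>D. st D x \<and> csat D e (\<rho>(n := x)) (Suc n) (R n))"
  by (simp add: sEx_def)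

lemma csat_is_empty [simp]: "x < n \<Longrightarrow> csat D e \<rho> n (is_empty x) = (\<forall>y\<in>D. \<not> y \<epsilon> \<rho> x)"
  by (simp add: is_empty_def)

lemma csat_included [simp]:
  "x < n \<Longrightarrow> y < n \<Longrightarrow> csat D e \<rho> n (included x y) = (\<forall>z\<in>D. z \<epsilon> \<rho> x \<longrightarrow> z \<epsilon> \<rho> y)"
  by (simp add: included_def)

lemma csat_is_upair [simp]:
  "p < n \<Longrightarrow> x < n \<Longrightarrow> y < n \<Longrightarrow> csat D e \<rho> n (is_upair p x y) = upr D (\<rho> p) (\<rho> x) (\<rho> y)"
  by (simp add: is_upair_def upr_def)

lemma csat_is_pair [simp]:
  "p < n \<Longrightarrow> x < n \<Longrightarrow> y < n \<Longrightarrow> csat D e \<rho> n (is_pair p x y) = pr D (\<rho> p) (\<rho> x) (\<rho> y)"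
  by (simp add: is_pair_def pr_def)

lemma csat_related [simp]:
  "F < n \<Longrightarrow> x < n \<Longrightarrow> y < n \<Longrightarrow> csat D e \<rho> n (related F x y) = rel D (\<rho> F) (\<rho> x) (\<rho> y)"
  by (simp add: related_def rel_def)

lemma csat_rel_between [simp]:
  "F < n \<Longrightarrow> A < n \<Longrightarrow> B < n \<Longrightarrow> csat D e \<rho> n (rel_between F A B) = relb D (\<rho> F) (\<rho> A) (\<rho> B)"
  by (simp add: rel_between_def relb_def)

lemma csat_fun_between [simp]:
  "F < n \<Longrightarrow> A < n \<Longrightarrow> B < n \<Longrightarrow> csat D e \<rho> n (fun_between F A B) = funb D (\<rho> F) (\<rho> A) (\<rho> B)"
  by (simp add: fun_between_def funb_def cEx1_def)

lemma csat_class_function [simp]: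
  "F < n \<Longrightarrow> csat D e \<rho> n (class_function F) = clsfun D (\<rho> F)"
  by (simp add: class_function_def clsfun_def)

lemma csat_graph_with [simp]:
  "g < n \<Longrightarrow> V < n \<Longrightarrow> A < n \<Longrightarrow> csat D e \<rho> n (graph_with g V A) = grw D (\<rho> g) (\<rho> V) (\<rho> A)"
  by (simp add: graph_with_def grw_def)

lemma csat_is_graph [simp]: "g < n \<Longrightarrow> csat D e \<rho> n (is_graph g) = gr D (\<rho> g)"
  by (simp add: is_graph_def gr_def)

lemma csat_is_hom [simp]:
  "h < n \<Longrightarrow> g < n \<Longrightarrow> g' < n \<Longrightarrow> csat D e \<rho> n (is_hom h g g') = hom D (\<rho> h) (\<rho> g) (\<rho> g')"
  by (simp add: is_hom_def hom_def)

lemma csat_is_identity [simp]: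
  "h < n \<Longrightarrow> g < n \<Longrightarrow> g' < n \<Longrightarrow> csat D e \<rho> n (is_identity h g g') = ident D (\<rho> h) (\<rho> g) (\<rho> g')"
  by (simp add: is_identity_def ident_def)

lemma csat_is_ordinal [simp]: "a < n \<Longrightarrow> csat D e \<rho> n (is_ordinal a) = ordn D (\<rho> a)"
  by (simp add: is_ordinal_def ordn_def)

lemma csat_graph_sequence [simp]: "S < n \<Longrightarrow> csat D e \<rho> n (graph_sequence S) = gseq D (\<rho> S)"
  by (simp add: graph_sequence_def gseq_def cEx1_def)

lemma sat_VP: "sat D E e VP \<longleftrightarrow> vp D"
  unfolding VP_def by (subst sat_eq_csat) (simp add: vp_def)

text \<open>The matrix of SWVP as an open formula: at depth 1 the level 0 is the index 0, which
  stands for the sequence. Through it \<open>dfb_sat\<close> makes \<open>swcex\<close> over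
  \<open>sub D u\<close> definable, both in \<open>u\<close> and in the sequence.\<close>

definition sw_body :: fm where
  "sw_body = (graph_sequence 0 \<^bold>\<and>
      (\<^bold>\<forall>a. \<^bold>\<forall>a'. \<^bold>\<forall>g. \<^bold>\<forall>g'. is_ordinal a \<^bold>\<and> is_ordinal a' \<^bold>\<and> related 0 a g \<^bold>\<and> related 0 a' g' \<^bold>\<longrightarrow>
        ((a \<^bold>\<in> a' \<^bold>\<or> a \<^bold>= a') \<^bold>\<longrightarrow> (\<^bold>\<exists>\<^sub>sh. is_hom h g' g)) \<^bold>\<and>
        (a \<^bold>\<in> a' \<^bold>\<longrightarrow> \<^bold>\<not> (\<^bold>\<exists>\<^sub>sh. is_hom h g g')))) 1"

lemma sat_sw_body: "sat D E e sw_body \<longleftrightarrow> swcex D (e 0)"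
proof -
  have "e = lvl_env (\<lambda>_. e 0) 1 (\<lambda>i. e (Suc i))"
    by (auto simp: fun_eq_iff lvl_env_def)
  then have "sat D E e sw_body = sat D E (lvl_env (\<lambda>_. e 0) 1 (\<lambda>i. e (Suc i))) sw_body" by simp
  also have "\<dots> \<longleftrightarrow> swcex D (e 0)"
    unfolding sw_body_def csat_def[symmetric] by (simp add: swcex_def no_hom_up_def)
  finally show ?thesis .
qed

lemma sat_SWVP: "sat D E e SWVP \<longleftrightarrow> \<not> (\<exists>S\<in>D. swcex D S)"
  unfolding SWVP_def by (subst sat_eq_csat) (simp add: swcex_def no_hom_up_def)

lemma sat_WVP: "sat D E e WVP \<longleftrightarrow> \<not> (\<exists>S\<in>D. wcex D S)"
  unfolding WVP_def by (subst sat_eq_csat) (simp add: wcex_def no_hom_up_def sEx1_def cEx1_def)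

lemma sat_ax_extensionality: "sat D E e (ax_extensionality 0) \<longleftrightarrow>
    (\<forall>X\<in>D. \<forall>Y\<in>D. (\<forall>z\<in>D. z \<epsilon> X \<longleftrightarrow> z \<epsilon> Y) \<longrightarrow> X = Y)"
  by (subst sat_eq_csat) (simp add: ax_extensionality_def)

lemma sat_ax_pairing: "sat D E e (ax_pairing 0) \<longleftrightarrow>
    (\<forall>x\<in>D. st D x \<longrightarrow> (\<forall>y\<in>D. st D y \<longrightarrow> (\<exists>p\<in>D. st D p \<and> upr D p x y)))"
  by (subst sat_eq_csat) (simp add: ax_pairing_def)

lemma sat_ax_union: "sat D E e (ax_union 0) \<longleftrightarrow>
    (\<forall>X\<in>D. st D X \<longrightarrow> (\<exists>U\<in>D. st D U \<and> (\<forall>u\<in>D. u \<epsilon> U \<longleftrightarrow> (\<exists>x\<in>D. x \<epsilon> X \<and> u \<epsilon> x))))"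
  by (subst sat_eq_csat) (simp add: ax_union_def)

lemma sat_ax_power: "sat D E e (ax_power 0) \<longleftrightarrow>
    (\<forall>X\<in>D. st D X \<longrightarrow> (\<exists>P\<in>D. st D P \<and>
      (\<forall>u\<in>D. st D u \<longrightarrow> (u \<epsilon> P \<longleftrightarrow> (\<forall>z\<in>D. z \<epsilon> u \<longrightarrow> z \<epsilon> X)))))"
  by (subst sat_eq_csat) (simp add: ax_power_def)

lemma sat_ax_infinity: "sat D E e (ax_infinity 0) \<longleftrightarrow>
    (\<exists>I\<in>D. st D I \<and> (\<exists>z\<in>D. (\<forall>y\<in>D. \<not> y \<epsilon> z) \<and> z \<epsilon> I) \<and>
      (\<forall>x\<in>D. x \<epsilon> I \<longrightarrow> (\<exists>y\<in>D. y \<epsilon> I \<and> (\<forall>w\<in>D. w \<epsilon> y \<longleftrightarrow> w \<epsilon> x \<or> w = x))))"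
  by (subst sat_eq_csat) (simp add: ax_infinity_def)

lemma sat_ax_replacement: "sat D E e (ax_replacement 0) \<longleftrightarrow>
    (\<forall>F\<in>D. clsfun D F \<longrightarrow> (\<forall>X\<in>D. st D X \<longrightarrow>
      (\<exists>Y\<in>D. st D Y \<and> (\<forall>y\<in>D. y \<epsilon> Y \<longleftrightarrow> (\<exists>x\<in>D. x \<epsilon> X \<and> rel D F x y)))))"
  by (subst sat_eq_csat) (simp add: ax_replacement_def)

lemma sat_ax_regularity: "sat D E e (ax_regularity 0) \<longleftrightarrow>
    (\<forall>X\<in>D. (\<exists>x\<in>D. x \<epsilon> X) \<longrightarrow> (\<exists>x\<in>D. x \<epsilon> X \<and> \<not> (\<exists>y\<in>D. y \<epsilon> x \<and> y \<epsilon> X)))"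
  by (subst sat_eq_csat) (simp add: ax_regularity_def)

lemma sat_ax_choice: "sat D E e (ax_choice 0) \<longleftrightarrow>
    (\<forall>X\<in>D. st D X \<longrightarrow> (\<forall>x\<in>D. x \<epsilon> X \<longrightarrow> (\<exists>y\<in>D. y \<epsilon> x)) \<longrightarrow>
      (\<exists>f\<in>D. st D f \<and> (\<exists>U\<in>D. st D U \<and> funb D f X U) \<and>
        (\<forall>x\<in>D. \<forall>y\<in>D. rel D f x y \<longrightarrow> y \<epsilon> x)))"
  by (subst sat_eq_csat) (simp add: ax_choice_def)

abbreviation valid :: "'a set \<Rightarrow> fm \<Rightarrow> bool" where
  "valid D p \<equiv> \<forall>e. range e \<subseteq> D \<longrightarrow> sat D E e p"

lemma valid_All: "valid D (All p) \<longleftrightarrow> valid D p"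
proof
  assume v: "valid D (All p)"
  show "valid D p"
  proof (intro allI impI)
    fix e :: "nat \<Rightarrow> 'a" assume "range e \<subseteq> D"
    then have "sat D E (case_nat (e 0) (\<lambda>i. e (Suc i))) p"
      using v[rule_format, of "\<lambda>i. e (Suc i)"] by (auto simp: image_subset_iff)
    moreover have "case_nat (e 0) (\<lambda>i. e (Suc i)) = e"
      by (auto simp: fun_eq_iff split: nat.split)
    ultimately show "sat D E e p" by simp
  qed
next
  assume "valid D p"
  then show "valid D (All p)" by (auto simp: image_subset_iff split: nat.split)
qed

lemma valid_univ_closure: "valid D (univ_closure p) \<longleftrightarrow> valid D p"
proof -
  have "valid D ((All ^^ n) p) \<longleftrightarrow> valid D p" for n
    by (induction n) (simp_all only: funpow.simps o_apply id_apply valid_All)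
  then show ?thesis by (simp add: univ_closure_def)
qed

text \<open>The universal closure makes the instance a sentence, so its truth in one environment is
  its truth for all values of the parameters.\<close>

lemma sat_comprehension:
  assumes "range e \<subseteq> D"
  shows "sat D E e (comprehension p) \<longleftrightarrow> (\<forall>e. range e \<subseteq> D \<longrightarrow>
    (\<exists>X\<in>D. \<forall>x\<in>D. x \<epsilon> X \<longleftrightarrow> st D x \<and> sat D E (case_nat x e) (set_rel p)))"
proof -
  let ?c = "comprehension p"
  have "bnd ((All ^^ n) q) = bnd q - n" for n q by (induction n) auto
  then have "bnd ?c = 0" by (simp add: comprehension_def univ_closure_def)
  then have "sat D E e ?c \<longleftrightarrow> valid D ?c" using assms sat_closed by blast
  also have "\<dots> \<longleftrightarrow> (\<forall>e. range e \<subseteq> D \<longrightarrow>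
    (\<exists>X\<in>D. \<forall>x\<in>D. x \<epsilon> X \<longleftrightarrow> st D x \<and> sat D E (case_nat x e) (set_rel p)))"
  proof -
    have "sat D E (case_nat x (case_nat X e)) (ren (case_nat 0 (\<lambda>i. Suc (Suc i))) q) =
        sat D E (case_nat x e) q" for x X e q
      unfolding sat_ren
      by (rule arg_cong[of _ _ "\<lambda>e. sat D E e q"]) (auto simp: fun_eq_iff split: nat.split)
    then show ?thesis
      unfolding comprehension_def valid_univ_closure by (simp add: st_def)
  qed
  finally show ?thesis .
qed

end

section \<open>Models of Goedel-Bernays set theory\<close>

lemma set_rel_ren: "set_rel (ren r p) = ren r (set_rel p)"
  by (induction p arbitrary: r) (auto simp: Ex_def Neg_def)

context membership
begin

definition St :: "'a set \<Rightarrow> 'a set" where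
  "St D = {x \<in> D. st D x}"

definition els :: "'a set \<Rightarrow> 'a \<Rightarrow> 'a set" where
  "els D x = {y \<in> D. y \<epsilon> x}"

text \<open>The element of \<open>D\<close> with the given members; junk if there is none.\<close>

definition mk :: "'a set \<Rightarrow> 'a set \<Rightarrow> 'a" where
  "mk D A = (THE x. x \<in> D \<and> els D x = A)"

definition pair :: "'a set \<Rightarrow> 'a \<Rightarrow> 'a \<Rightarrow> 'a" where
  "pair D x y = mk D {mk D {x}, mk D {x, y}}"

lemma sat_set_rel_All:
  "sat D E e (set_rel (All p)) \<longleftrightarrow> (\<forall>x\<in>St D. sat D E (case_nat x e) (set_rel p))"
  by (auto simp: St_def st_def)

end

text \<open>Environments in definability proofs are split in two: the even indices carry the set
  variables \<open>e\<close>, the odd ones the class parameters \<open>c\<close>.\<close>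

definition ilv :: "(nat \<Rightarrow> 'a) \<Rightarrow> (nat \<Rightarrow> 'a) \<Rightarrow> nat \<Rightarrow> 'a" where
  "ilv e c i = (if even i then e (i div 2) else c (i div 2))"

lemma ilv_simps [simp]: "ilv e c (2 * i) = e i" "ilv e c (Suc (2 * i)) = c i"
  "ilv e c 0 = e 0" "ilv e c (Suc 0) = c 0"
  by (auto simp: ilv_def)

lemma range_case_nat: "x \<in> A \<Longrightarrow> range e \<subseteq> A \<Longrightarrow> range (case_nat x e) \<subseteq> A"
  by (auto simp: image_subset_iff split: nat.split)

named_theorems dfb_intro

locale gb = membership E for E :: "'a \<Rightarrow> 'a \<Rightarrow> bool" (infix "\<epsilon>" 50) +
  fixes D :: "'a set"
  assumes nonempty: "D \<noteq> {}"
    and GB_AC: "p \<in> GB_AC \<Longrightarrow> range e \<subseteq> D \<Longrightarrow> sat D E e p"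
begin

abbreviation "S \<equiv> St D"
abbreviation "el \<equiv> els D"

lemma some_env: obtains e :: "nat \<Rightarrow> 'a" where "range e \<subseteq> D"
proof -
  from nonempty obtain x where "x \<in> D" by auto
  then show thesis by (intro that[of "\<lambda>_. x"]) auto
qed

lemma S_D: "x \<in> S \<Longrightarrow> x \<in> D"
  by (simp add: St_def)

lemma el_S: "y \<in> el x \<Longrightarrow> x \<in> D \<Longrightarrow> y \<in> S"
  by (auto simp: St_def els_def st_def)

lemma el_SS: "y \<in> el x \<Longrightarrow> x \<in> S \<Longrightarrow> y \<in> S"
  by (auto simp: St_def els_def st_def)

lemma mem_el: "y \<in> D \<Longrightarrow> y \<in> el x \<longleftrightarrow> y \<epsilon> x"
  by (auto simp: els_def)

lemma el_inject: "x \<in> D \<Longrightarrow> y \<in> D \<Longrightarrow> el x = el y \<longleftrightarrow> x = y"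
proof -
  obtain e :: "nat \<Rightarrow> 'a" where "range e \<subseteq> D" by (rule some_env)
  then have "sat D E e (ax_extensionality 0)" by (intro GB_AC) (auto simp: GB_AC_def)
  then show "x \<in> D \<Longrightarrow> y \<in> D \<Longrightarrow> el x = el y \<longleftrightarrow> x = y"
    unfolding sat_ax_extensionality by (auto simp: els_def)
qed

lemma mk_eq: "x \<in> D \<Longrightarrow> el x = A \<Longrightarrow> mk D A = x"
  unfolding mk_def using el_inject by (intro the_equality) auto

lemma mk_el: "x \<in> D \<Longrightarrow> mk D (el x) = x"
  by (rule mk_eq) auto

text \<open>\<open>cl\<close> and \<open>sm\<close> hold of the external sets that are the extension
  of a class or a set of the model. The existence axioms become closure properties of these two
  predicates, and HOL set notation can be used for internal objects.\<close>

definition cl :: "'a set \<Rightarrow> bool" where "cl A \<longleftrightarrow> A \<in> el ` D"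
definition sm :: "'a set \<Rightarrow> bool" where "sm A \<longleftrightarrow> A \<in> el ` S"

lemma cl_mk: assumes "cl A" shows "mk D A \<in> D" "el (mk D A) = A"
  using assms mk_el by (auto simp: cl_def)

lemma sm_mk: assumes "sm A" shows "mk D A \<in> S" "el (mk D A) = A"
  using assms mk_el S_D by (auto simp: sm_def)

lemma sm_el: "x \<in> S \<Longrightarrow> sm (el x)" by (simp add: sm_def)
lemma cl_el: "x \<in> D \<Longrightarrow> cl (el x)" by (simp add: cl_def)
lemma sm_cl: "sm A \<Longrightarrow> cl A" using S_D by (auto simp: sm_def cl_def)
lemma smE: "sm A \<Longrightarrow> (\<And>x. x \<in> S \<Longrightarrow> el x = A \<Longrightarrow> thesis) \<Longrightarrow> thesis" by (auto simp: sm_def)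
lemma smI: "x \<in> S \<Longrightarrow> el x = A \<Longrightarrow> sm A" by (auto simp: sm_def)
lemma sm_S: "sm A \<Longrightarrow> x \<in> A \<Longrightarrow> x \<in> S" using el_SS by (auto simp: sm_def)

subsection \<open>Definable predicates\<close>

text \<open>\<open>dfb P\<close>: on environments of sets, \<open>P\<close> is given by a predicative formula with class
  parameters; \<open>dft t\<close>: the function \<open>t\<close> has sets as values and a definable graph.\<close>

definition dfb :: "((nat \<Rightarrow> 'a) \<Rightarrow> bool) \<Rightarrow> bool" where
  "dfb P \<longleftrightarrow> (\<exists>p c. range c \<subseteq> D \<and>
    (\<forall>e. range e \<subseteq> S \<longrightarrow> P e = sat D E (ilv e c) (set_rel p)))"

definition dft :: "((nat \<Rightarrow> 'a) \<Rightarrow> 'a) \<Rightarrow> bool" where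
  "dft t \<longleftrightarrow> (\<forall>e. range e \<subseteq> S \<longrightarrow> t e \<in> S) \<and> dfb (\<lambda>e. e 0 = t (\<lambda>i. e (Suc i)))"

lemma dfb_cong: "(\<And>e. range e \<subseteq> S \<Longrightarrow> P e = Q e) \<Longrightarrow> dfb P = dfb Q"
  by (auto simp: dfb_def)

lemma dfbI: "range c \<subseteq> D \<Longrightarrow> (\<And>e. range e \<subseteq> S \<Longrightarrow> P e = sat D E (ilv e c) (set_rel p)) \<Longrightarrow> dfb P"
  by (auto simp: dfb_def)

lemma dfb_mem_var: "dfb (\<lambda>e. e i \<in> el (e j))"
proof -
  obtain c :: "nat \<Rightarrow> 'a" where "range c \<subseteq> D" by (rule some_env)
  then show ?thesis
    by (rule dfbI[where p = "Mem (2 * i) (2 * j)"]) (auto simp: els_def St_def image_subset_iff)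
qed

lemma dfb_eq_var: "dfb (\<lambda>e. e i = e j)"
proof -
  obtain c :: "nat \<Rightarrow> 'a" where "range c \<subseteq> D" by (rule some_env)
  then show ?thesis by (rule dfbI[where p = "Eq (2 * i) (2 * j)"]) auto
qed

lemma dfb_mem_class: "X \<in> D \<Longrightarrow> dfb (\<lambda>e. e i \<in> el X)"
  by (rule dfbI[where p = "Mem (2 * i) 1" and c = "\<lambda>_. X"])
    (auto simp: els_def St_def image_subset_iff)

lemma dfb_eq_const: "x \<in> D \<Longrightarrow> dfb (\<lambda>e. e i = x)"
  by (rule dfbI[where p = "Eq (2 * i) 1" and c = "\<lambda>_. x"]) auto

lemma dfb_const [dfb_intro]: "dfb (\<lambda>e. C)"
proof -
  obtain c :: "nat \<Rightarrow> 'a" where "range c \<subseteq> D" by (rule some_env)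
  then show ?thesis by (rule dfbI[where p = "if C then Imp Fls Fls else Fls"]) auto
qed

lemma dfb_imp [dfb_intro]:
  assumes "dfb P" "dfb Q"
  shows "dfb (\<lambda>e. P e \<longrightarrow> Q e)"
proof -
  from assms(1) obtain p c where c: "range c \<subseteq> D"
    and p: "\<And>e. range e \<subseteq> S \<Longrightarrow> P e = sat D E (ilv e c) (set_rel p)" by (auto simp: dfb_def)
  from assms(2) obtain q d where d: "range d \<subseteq> D"
    and q: "\<And>e. range e \<subseteq> S \<Longrightarrow> Q e = sat D E (ilv e d) (set_rel q)" by (auto simp: dfb_def)
  \<comment> \<open>The parameter lists of both formulas are merged into \<open>ilv c d\<close>: the
    k-th parameter moves to place 2k for \<open>p\<close> and to place 2k+1 for \<open>q\<close>,
    while the set variables stay.\<close>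
  define r1 where "r1 i = (if even i then i else Suc (2 * (2 * (i div 2))))" for i :: nat
  define r2 where "r2 i = (if even i then i else Suc (2 * Suc (2 * (i div 2))))" for i :: nat
  have 1: "(\<lambda>i. ilv e (ilv c d) (r1 i)) = ilv e c" for e
  proof
    fix i :: nat
    show "ilv e (ilv c d) (r1 i) = ilv e c i"
      by (cases "even i") (auto simp: r1_def ilv_def elim!: oddE)
  qed
  have 2: "(\<lambda>i. ilv e (ilv c d) (r2 i)) = ilv e d" for e
  proof
    fix i :: nat
    show "ilv e (ilv c d) (r2 i) = ilv e d i"
      by (cases "even i") (auto simp: r2_def ilv_def elim!: oddE)
  qed
  show ?thesis
  proof (rule dfbI)
    show "range (ilv c d) \<subseteq> D" using c d by (auto simp: ilv_def)
    show "(P e \<longrightarrow> Q e) = sat D E (ilv e (ilv c d)) (set_rel (Imp (ren r1 p) (ren r2 q)))"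
      if "range e \<subseteq> S" for e
      using p[OF that] q[OF that] by (simp add: set_rel_ren sat_ren 1 2)
  qed
qed

lemma dfb_ren:
  assumes "dfb P"
  shows "dfb (\<lambda>e. P (\<lambda>i. e (r i)))"
proof -
  from assms obtain p c where c: "range c \<subseteq> D"
    and p: "\<And>e. range e \<subseteq> S \<Longrightarrow> P e = sat D E (ilv e c) (set_rel p)" by (auto simp: dfb_def)
  define s where "s i = (if even i then 2 * r (i div 2) else i)" for i
  have 1: "(\<lambda>i. ilv e c (s i)) = ilv (\<lambda>i. e (r i)) c" for e
    by (auto simp: fun_eq_iff s_def ilv_def)
  show ?thesis
  proof (rule dfbI[OF c])
    fix e :: "nat \<Rightarrow> 'a" assume "range e \<subseteq> S"
    then show "P (\<lambda>i. e (r i)) = sat D E (ilv e c) (set_rel (ren s p))"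
      by (subst p) (auto simp: set_rel_ren sat_ren 1)
  qed
qed

text \<open>The bound variable is passed as \<open>e 0\<close> with the rest of the environment
  shifted. In this shape \<open>intro dfb_intro\<close> descends through nested quantifiers by
  unification.\<close>

lemma dfb_all [dfb_intro]:
  assumes "dfb (\<lambda>e. P (\<lambda>i. e (Suc i)) (e 0))"
  shows "dfb (\<lambda>e. \<forall>x\<in>S. P e x)"
proof -
  from assms obtain p c where c: "range c \<subseteq> D"
    and p: "\<And>e. range e \<subseteq> S \<Longrightarrow> P (\<lambda>i. e (Suc i)) (e 0) = sat D E (ilv e c) (set_rel p)"
    by (auto simp: dfb_def)
  \<comment> \<open>The quantifier pushes the whole interleaved list up by one, whereas
    \<open>p\<close> expects only the set variables to be shifted. So even indices above 0 go down
    by one and odd ones go up by one.\<close>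
  define s where "s i = (if even i then if i = 0 then 0 else i - 1 else Suc i)" for i :: nat
  have 1: "(\<lambda>i. case_nat x (ilv e c) (s i)) = ilv (case_nat x e) c" for x e
  proof
    fix i :: nat
    show "case_nat x (ilv e c) (s i) = ilv (case_nat x e) c i"
    proof (cases "even i")
      case True
      then obtain k where "i = 2 * k" by (auto elim: evenE)
      then show ?thesis by (cases k) (auto simp: s_def ilv_def)
    next
      case False
      then show ?thesis by (auto simp: s_def ilv_def)
    qed
  qed
  show ?thesis
  proof (rule dfbI[OF c])
    fix e :: "nat \<Rightarrow> 'a" assume e: "range e \<subseteq> S"
    have "P e x = sat D E (ilv (case_nat x e) c) (set_rel p)" if "x \<in> S" for x
    proof -
      have "range (case_nat x e) \<subseteq> S" using that e by (rule range_case_nat)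
      from p[OF this] show ?thesis by simp
    qed
    then show "(\<forall>x\<in>S. P e x) = sat D E (ilv e c) (set_rel (All (ren s p)))"
      unfolding sat_set_rel_All by (simp add: set_rel_ren sat_ren 1)
  qed
qed

lemma dfb_not [dfb_intro]: "dfb P \<Longrightarrow> dfb (\<lambda>e. \<not> P e)"
  using dfb_imp[OF _ dfb_const[of False], of P] by simp

lemma dfb_conj [dfb_intro]: "dfb P \<Longrightarrow> dfb Q \<Longrightarrow> dfb (\<lambda>e. P e \<and> Q e)"
  using dfb_not[OF dfb_imp[OF _ dfb_not, of P Q]] by simp

lemma dfb_disj [dfb_intro]: "dfb P \<Longrightarrow> dfb Q \<Longrightarrow> dfb (\<lambda>e. P e \<or> Q e)"
  using dfb_imp[OF dfb_not, of P Q] by (simp add: imp_conv_disj)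

lemma dfb_iff [dfb_intro]: "dfb P \<Longrightarrow> dfb Q \<Longrightarrow> dfb (\<lambda>e. P e \<longleftrightarrow> Q e)"
  using dfb_conj[OF dfb_imp dfb_imp, of P Q Q P] by (simp add: iff_conv_conj_imp)

lemma dfb_ex [dfb_intro]:
  assumes "dfb (\<lambda>e. P (\<lambda>i. e (Suc i)) (e 0))"
  shows "dfb (\<lambda>e. \<exists>x\<in>S. P e x)"
  using dfb_not[OF dfb_all[of "\<lambda>e x. \<not> P e x", OF dfb_not[OF assms]]] by simp

lemma dfb_ex_nat [dfb_intro]:
  assumes "\<And>i. i < n \<Longrightarrow> dfb (P i)"
  shows "dfb (\<lambda>e. \<exists>i<n::nat. P i e)"
  using assms
proof (induction n)
  case (Suc n)
  have "(\<lambda>e. \<exists>i<Suc n. P i e) = (\<lambda>e. (\<exists>i<n. P i e) \<or> P n e)" by (auto simp: less_Suc_eq)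
  with Suc show ?case by (simp add: dfb_disj)
qed (simp add: dfb_const)

lemma dft_S: "dft t \<Longrightarrow> range e \<subseteq> S \<Longrightarrow> t e \<in> S"
  by (auto simp: dft_def)

lemma dft_var [dfb_intro]: "dft (\<lambda>e. e i)"
  by (auto simp: dft_def dfb_eq_var)

lemma dft_const: "x \<in> S \<Longrightarrow> dft (\<lambda>e. x)"
  using dfb_eq_const S_D by (auto simp: dft_def)

lemma dft_ren: "dft t \<Longrightarrow> dft (\<lambda>e. t (\<lambda>i. e (r i)))"
proof -
  assume t: "dft t"
  then have "dfb (\<lambda>e. e 0 = t (\<lambda>i. e (Suc i)))" by (simp add: dft_def)
  from dfb_ren[OF this, of "case_nat 0 (\<lambda>i. Suc (r i))"] t show ?thesis
    by (auto simp: dft_def image_subset_iff)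
qed

text \<open>\<open>Q (t e) e\<close> says that some set equal to \<open>t e\<close> satisfies
  \<open>Q\<close>; this is equivalent because \<open>t\<close> has sets as values.\<close>

lemma dfb_subst:
  assumes "dfb (\<lambda>e. Q (e 0) (\<lambda>i. e (Suc i)))" "dft t"
  shows "dfb (\<lambda>e. Q (t e) e)"
proof -
  have "dfb (\<lambda>e. \<exists>x\<in>S. x = t e \<and> Q x e)"
    by (rule dfb_ex, rule dfb_conj) (use assms in \<open>auto simp: dft_def\<close>)
  also have "?this \<longleftrightarrow> ?thesis"
    by (rule dfb_cong) (use dft_S[OF assms(2)] in auto)
  finally show ?thesis .
qed

lemma dfb_app1: "(\<And>i. dfb (\<lambda>e. P (e i))) \<Longrightarrow> dft t \<Longrightarrow> dfb (\<lambda>e. P (t e))"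
  by (rule dfb_subst[of "\<lambda>x e. P x"]) auto

lemma dfb_app2:
  assumes "\<And>i j. dfb (\<lambda>e. P (e i) (e j))" "dft s" "dft t"
  shows "dfb (\<lambda>e. P (s e) (t e))"
proof (rule dfb_subst[of "\<lambda>x e. P x (t e)", OF _ assms(2)])
  show "dfb (\<lambda>e. P (e 0) (t (\<lambda>i. e (Suc i))))"
    by (rule dfb_subst[of "\<lambda>y e. P (e 0) y", OF _ dft_ren[OF assms(3)]]) (rule assms(1))
qed

lemma dfb_app3:
  assumes "\<And>i j k. dfb (\<lambda>e. P (e i) (e j) (e k))" "dft s" "dft t" "dft u"
  shows "dfb (\<lambda>e. P (s e) (t e) (u e))"
proof (rule dfb_subst[of "\<lambda>x e. P x (t e) (u e)", OF _ assms(2)])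
  show "dfb (\<lambda>e. P (e 0) (t (\<lambda>i. e (Suc i))) (u (\<lambda>i. e (Suc i))))"
  proof (rule dfb_subst[of "\<lambda>y e. P (e 0) y (u (\<lambda>i. e (Suc i)))", OF _ dft_ren[OF assms(3)]])
    show "dfb (\<lambda>e. P (e (Suc 0)) (e 0) (u (\<lambda>i. e (Suc (Suc i)))))"
      by (rule dfb_subst[of "\<lambda>z e. P (e (Suc 0)) (e 0) z", OF _ dft_ren[OF assms(4)]])
        (rule assms(1))
  qed
qed

lemma dfb_in [dfb_intro]: "dft s \<Longrightarrow> dft t \<Longrightarrow> dfb (\<lambda>e. s e \<in> el (t e))"
  by (rule dfb_app2[of "\<lambda>x y. x \<in> el y"]) (rule dfb_mem_var)

lemma dfb_in_class: "X \<in> D \<Longrightarrow> dft s \<Longrightarrow> dfb (\<lambda>e. s e \<in> el X)"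
  by (rule dfb_app1[of "\<lambda>x. x \<in> el X"]) (rule dfb_mem_class)

lemma dfb_eq [dfb_intro]: "dft s \<Longrightarrow> dft t \<Longrightarrow> dfb (\<lambda>e. s e = t e)"
  by (rule dfb_app2[of "\<lambda>x y. x = y"]) (rule dfb_eq_var)

lemma dfb_ball [dfb_intro]:
  assumes "dft t" "dfb (\<lambda>e. P (\<lambda>i. e (Suc i)) (e 0))"
  shows "dfb (\<lambda>e. \<forall>x\<in>el (t e). P e x)"
proof -
  have "dfb (\<lambda>e. \<forall>x\<in>S. x \<in> el (t e) \<longrightarrow> P e x)"
    by (rule dfb_all, rule dfb_imp[OF dfb_in[OF dft_var dft_ren[OF assms(1)]] assms(2)])
  also have "?this \<longleftrightarrow> ?thesis"
    by (rule dfb_cong) (use dft_S[OF assms(1)] el_SS in blast)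
  finally show ?thesis .
qed

lemma dfb_bex [dfb_intro]:
  assumes "dft t" "dfb (\<lambda>e. P (\<lambda>i. e (Suc i)) (e 0))"
  shows "dfb (\<lambda>e. \<exists>x\<in>el (t e). P e x)"
  using dfb_not[OF dfb_ball[of t "\<lambda>e x. \<not> P e x", OF assms(1) dfb_not[OF assms(2)]]] by simp

lemma dfb_subset [dfb_intro]:
  assumes "dft s" "dft t" shows "dfb (\<lambda>e. el (s e) \<subseteq> el (t e))"
  unfolding subset_eq
  by (rule dfb_ball[OF assms(1)], rule dfb_in[OF dft_var dft_ren[OF assms(2)]])

lemma dft_app1:
  assumes "dft (\<lambda>e. f (e 0))" "dft s" shows "dft (\<lambda>e. f (s e))"
  unfolding dft_def
proof
  have f: "f x \<in> S" if "x \<in> S" for x using dft_S[OF assms(1), of "\<lambda>_. x"] that by auto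
  show "\<forall>e. range e \<subseteq> S \<longrightarrow> f (s e) \<in> S" using f dft_S[OF assms(2)] by auto
  have "dfb (\<lambda>e. e 0 = f (e (Suc 0)))" using assms(1) by (simp add: dft_def)
  from dfb_ren[OF this, of "\<lambda>k. case_nat i (\<lambda>_. j) k" for i j]
  have "dfb (\<lambda>e. e i = f (e j))" for i j by simp
  from dfb_app2[of "\<lambda>x y. x = f y", OF this dft_var[of 0] dft_ren[OF assms(2), of Suc]]
  show "dfb (\<lambda>e. e 0 = f (s (\<lambda>i. e (Suc i))))" by simp
qed

text \<open>A set is determined by its members, so the graph of \<open>mk D (A e)\<close> is
  definable as soon as membership in \<open>A e\<close> is.\<close>

lemma dft_mk:
  assumes "\<And>e. range e \<subseteq> S \<Longrightarrow> sm (A e)" "dfb (\<lambda>e. e 0 \<in> A (\<lambda>i. e (Suc i)))"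
  shows "dft (\<lambda>e. mk D (A e))"
  unfolding dft_def
proof
  show "\<forall>e. range e \<subseteq> S \<longrightarrow> mk D (A e) \<in> S" using assms(1) sm_mk by blast
  have "dfb (\<lambda>e. \<forall>x\<in>S. x \<in> el (e 0) \<longleftrightarrow> x \<in> A (\<lambda>i. e (Suc i)))"
    using dfb_ren[OF assms(2), of "case_nat 0 (\<lambda>i. Suc (Suc i))"]
    by (intro dfb_intro) simp
  also have "?this \<longleftrightarrow> dfb (\<lambda>e. e 0 = mk D (A (\<lambda>i. e (Suc i))))"
  proof (rule dfb_cong)
    fix e :: "nat \<Rightarrow> 'a" assume e: "range e \<subseteq> S"
    then have 0: "e 0 \<in> S" by auto
    have sm: "sm (A (\<lambda>i. e (Suc i)))" using e by (intro assms(1)) auto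
    show "(\<forall>x\<in>S. x \<in> el (e 0) \<longleftrightarrow> x \<in> A (\<lambda>i. e (Suc i))) = (e 0 = mk D (A (\<lambda>i. e (Suc i))))"
      using sm_mk[OF sm] mk_el[OF S_D[OF 0]] sm_S[OF sm] el_SS[OF _ 0] by (metis set_eqI)
  qed
  finally show "dfb (\<lambda>e. e 0 = mk D (A (\<lambda>i. e (Suc i))))" .
qed

subsection \<open>Basic set existence\<close>

lemma S_nonempty: "S \<noteq> {}"
proof -
  obtain e :: "nat \<Rightarrow> 'a" where e: "range e \<subseteq> D" by (rule some_env)
  then have "sat D E e (ax_infinity 0)" by (intro GB_AC) (auto simp: GB_AC_def)
  then show ?thesis unfolding sat_ax_infinity by (auto simp: St_def)
qed

lemma cl_comp:
  assumes "dfb (\<lambda>e. P (e 0))" shows "cl {x \<in> S. P x}"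
proof -
  from assms obtain p c where c: "range c \<subseteq> D"
    and p: "\<And>e. range e \<subseteq> S \<Longrightarrow> P (e 0) = sat D E (ilv e c) (set_rel p)" by (auto simp: dfb_def)
  obtain x0 where x0: "x0 \<in> S" using S_nonempty by auto
  \<comment> \<open>\<open>P\<close> depends on \<open>e 0\<close> alone, so all other set variables
    are redirected to index 1, which holds the dummy \<open>x0\<close>.\<close>
  define q where "q = ren (\<lambda>i. if even i then if i = 0 then 0 else 1 else Suc i) p"
  have comp: "comprehension q \<in> GB_AC" by (simp add: GB_AC_def)
  have *: "range (ilv (\<lambda>_. x0) c) \<subseteq> D" using c S_D[OF x0] by (auto simp: ilv_def)
  have "\<exists>X\<in>D. \<forall>x\<in>D. x \<epsilon> X \<longleftrightarrow> st D x \<and> sat D E (case_nat x (ilv (\<lambda>_. x0) c)) (set_rel q)"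
    using sat_comprehension[OF *, of q] GB_AC[OF comp *] * by blast
  then obtain X where X: "X \<in> D" "\<And>x. x \<in> D \<Longrightarrow>
      x \<epsilon> X \<longleftrightarrow> st D x \<and> sat D E (case_nat x (ilv (\<lambda>_. x0) c)) (set_rel q)" by blast
  have "sat D E (case_nat x (ilv (\<lambda>_. x0) c)) (set_rel q) = P x" if "x \<in> S" for x
  proof -
    have "(\<lambda>i. case_nat x (ilv (\<lambda>_. x0) c) (if even i then if i = 0 then 0 else 1 else Suc i)) =
        ilv (case_nat x (\<lambda>_. x0)) c"
      by (auto simp: fun_eq_iff ilv_def split: nat.split)
    moreover have "range (case_nat x (\<lambda>_. x0)) \<subseteq> S" using that x0 by (intro range_case_nat) auto
    ultimately show ?thesis using p[of "case_nat x (\<lambda>_. x0)"] by (simp add: q_def set_rel_ren sat_ren)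
  qed
  then have "el X = {x \<in> S. P x}" using X by (auto simp: els_def St_def)
  then show ?thesis using X(1) by (auto simp: cl_def)
qed

lemma dfb_cl: "cl A \<Longrightarrow> dft s \<Longrightarrow> dfb (\<lambda>e. s e \<in> A)"
  using dfb_in_class cl_def by auto

lemma sm_pair: "x \<in> S \<Longrightarrow> y \<in> S \<Longrightarrow> sm {x, y}"
proof -
  obtain e :: "nat \<Rightarrow> 'a" where "range e \<subseteq> D" by (rule some_env)
  then have "sat D E e (ax_pairing 0)" by (intro GB_AC) (auto simp: GB_AC_def)
  then have "x \<in> S \<Longrightarrow> y \<in> S \<Longrightarrow> \<exists>p\<in>D. st D p \<and> upr D p x y"
    unfolding sat_ax_pairing by (auto simp: St_def)
  then show "x \<in> S \<Longrightarrow> y \<in> S \<Longrightarrow> sm {x, y}"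
    by (auto simp: sm_def St_def upr_def els_def image_iff)
qed

lemma sm_sing: "x \<in> S \<Longrightarrow> sm {x}"
  using sm_pair[of x x] by simp

lemma sm_Union: "x \<in> S \<Longrightarrow> sm (\<Union>y\<in>el x. el y)"
proof -
  assume x: "x \<in> S"
  obtain e :: "nat \<Rightarrow> 'a" where "range e \<subseteq> D" by (rule some_env)
  then have "sat D E e (ax_union 0)" by (intro GB_AC) (auto simp: GB_AC_def)
  then have "\<exists>U\<in>D. st D U \<and> (\<forall>u\<in>D. u \<epsilon> U \<longleftrightarrow> (\<exists>y\<in>D. y \<epsilon> x \<and> u \<epsilon> y))"
    using x unfolding sat_ax_union St_def by blast
  then obtain U where "U \<in> D" "st D U" "\<forall>u\<in>D. u \<epsilon> U \<longleftrightarrow> (\<exists>y\<in>D. y \<epsilon> x \<and> u \<epsilon> y)" by blast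
  then show ?thesis by (intro smI[of U]) (auto simp: els_def St_def)
qed

lemma sm_Pow: "x \<in> S \<Longrightarrow> sm {y \<in> S. el y \<subseteq> el x}"
proof -
  assume x: "x \<in> S"
  obtain e :: "nat \<Rightarrow> 'a" where "range e \<subseteq> D" by (rule some_env)
  then have "sat D E e (ax_power 0)" by (intro GB_AC) (auto simp: GB_AC_def)
  then have "\<exists>P\<in>D. st D P \<and> (\<forall>u\<in>D. st D u \<longrightarrow> (u \<epsilon> P \<longleftrightarrow> (\<forall>z\<in>D. z \<epsilon> u \<longrightarrow> z \<epsilon> x)))"
    using x unfolding sat_ax_power St_def by blast
  then obtain P where "P \<in> D" "st D P"
      and *: "\<forall>u\<in>D. st D u \<longrightarrow> (u \<epsilon> P \<longleftrightarrow> (\<forall>z\<in>D. z \<epsilon> u \<longrightarrow> z \<epsilon> x))" by blast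
  then have P: "P \<in> S" by (simp add: St_def)
  have "el P = {y \<in> S. el y \<subseteq> el x}"
  proof (rule set_eqI)
    fix y
    show "y \<in> el P \<longleftrightarrow> y \<in> {y \<in> S. el y \<subseteq> el x}"
      using * el_SS[OF _ P, of y] by (auto simp: els_def St_def)
  qed
  with P show ?thesis by (rule smI)
qed

lemma pair_parts:
  assumes "x \<in> S" "y \<in> S"
  shows "mk D {x} \<in> S" "el (mk D {x}) = {x}" "mk D {x, y} \<in> S" "el (mk D {x, y}) = {x, y}"
    "pair D x y \<in> S" "el (pair D x y) = {mk D {x}, mk D {x, y}}"
  using sm_mk[OF sm_sing[OF assms(1)]] sm_mk[OF sm_pair[OF assms]] sm_mk[OF sm_pair]
  by (simp_all add: pair_def)

lemmas pair_S = pair_parts(5)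

lemma upr_iff: "p \<in> D \<Longrightarrow> x \<in> D \<Longrightarrow> y \<in> D \<Longrightarrow> upr D p x y \<longleftrightarrow> el p = {x, y}"
  by (auto simp: upr_def els_def)

lemma pr_iff:
  assumes "p \<in> D" "x \<in> D" "y \<in> D"
  shows "pr D p x y \<longleftrightarrow> x \<in> S \<and> y \<in> S \<and> p = pair D x y"
proof
  assume "pr D p x y"
  then obtain a b where ab: "a \<in> D" "b \<in> D" "el a = {x}" "el b = {x, y}" "el p = {a, b}"
    using assms by (auto simp: pr_def upr_iff)
  then have xy: "x \<in> S" "y \<in> S" using el_S[of _ b] by auto
  then have "a = mk D {x}" "b = mk D {x, y}" using ab mk_eq by metis+
  with xy ab show "x \<in> S \<and> y \<in> S \<and> p = pair D x y"
    unfolding pair_def using assms(1) mk_eq by metis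
next
  assume "x \<in> S \<and> y \<in> S \<and> p = pair D x y"
  then show "pr D p x y"
    using pair_parts[of x y] assms S_D unfolding pr_def
    by (intro bexI[of _ "mk D {x}"] bexI[of _ "mk D {x, y}"]) (auto simp: upr_iff)
qed

lemma pair_inject:
  assumes "x \<in> S" "y \<in> S" "x' \<in> S" "y' \<in> S"
  shows "pair D x y = pair D x' y' \<longleftrightarrow> x = x' \<and> y = y'"
proof
  assume eq: "pair D x y = pair D x' y'"
  note P = pair_parts[OF assms(1,2)] and P' = pair_parts[OF assms(3,4)]
  have "{mk D {x}, mk D {x, y}} = {mk D {x'}, mk D {x', y'}}" using eq P(6) P'(6) by simp
  then show "x = x' \<and> y = y'"
    using P(2,4) P'(2,4) by (metis doubleton_eq_iff insert_absorb2)
qed simp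

lemma rel_iff:
  assumes "F \<in> D" "x \<in> D" "y \<in> D"
  shows "rel D F x y \<longleftrightarrow> x \<in> S \<and> y \<in> S \<and> pair D x y \<in> el F"
proof -
  have "rel D F x y \<longleftrightarrow> (\<exists>p\<in>D. (x \<in> S \<and> y \<in> S \<and> p = pair D x y) \<and> p \<epsilon> F)"
    unfolding rel_def by (rule bex_cong[OF refl]) (simp add: pr_iff assms)
  also have "\<dots> \<longleftrightarrow> x \<in> S \<and> y \<in> S \<and> pair D x y \<in> el F"
    using S_D[OF pair_S[of x y]] unfolding els_def by blast
  finally show ?thesis .
qed

lemma dft_pair [dfb_intro]:
  assumes "dft s" "dft t" shows "dft (\<lambda>e. pair D (s e) (t e))"
proof -
  have sing: "dft (\<lambda>e. mk D {s e, t e})" if "dft s" "dft t" for s t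
  proof (rule dft_mk[OF sm_pair])
    have "dfb (\<lambda>e. e 0 = s (\<lambda>i. e (Suc i)) \<or> e 0 = t (\<lambda>i. e (Suc i)))"
      by (intro dfb_disj dfb_eq dft_var dft_ren[OF that(1)] dft_ren[OF that(2)])
    then show "dfb (\<lambda>e. e 0 \<in> {s (\<lambda>i. e (Suc i)), t (\<lambda>i. e (Suc i))})" by simp
  qed (use dft_S[OF that(1)] dft_S[OF that(2)] in auto)
  have "dft (\<lambda>e. mk D {s e})" using sing[OF assms(1) assms(1)] by simp
  from sing[OF this sing[OF assms]] show ?thesis unfolding pair_def .
qed

text \<open>The class handed to replacement contains only pairs with first component in
  \<open>X\<close>, so \<open>Q\<close> may be multivalued elsewhere.\<close>

lemma class_function_image:
  assumes "X \<in> S" and Q: "dfb (\<lambda>e. Q (e 0) (e (Suc 0)))"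
    and func: "\<And>x y z. x \<in> el X \<Longrightarrow> y \<in> S \<Longrightarrow> z \<in> S \<Longrightarrow> Q x y \<Longrightarrow> Q x z \<Longrightarrow> y = z"
  shows "sm {y \<in> S. \<exists>x\<in>el X. Q x y}"
proof -
  obtain e :: "nat \<Rightarrow> 'a" where "range e \<subseteq> D" by (rule some_env)
  then have rep: "sat D E e (ax_replacement 0)" by (intro GB_AC) (auto simp: GB_AC_def)
  have Qij: "dfb (\<lambda>e. Q (e i) (e j))" for i j
    using dfb_ren[OF Q, of "case_nat i (\<lambda>_. j)"] by simp
  define F where "F = mk D {z \<in> S. \<exists>x\<in>el X. \<exists>y\<in>S. z = pair D x y \<and> Q x y}"
  have "cl {z \<in> S. \<exists>x\<in>el X. \<exists>y\<in>S. z = pair D x y \<and> Q x y}"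
    by (intro cl_comp dfb_intro dft_const assms Qij)
  from cl_mk[OF this]
  have F: "F \<in> D" "el F = {z \<in> S. \<exists>x\<in>el X. \<exists>y\<in>S. z = pair D x y \<and> Q x y}"
    by (simp_all add: F_def)
  have relF: "rel D F x y \<longleftrightarrow> x \<in> el X \<and> y \<in> S \<and> Q x y" if "x \<in> D" "y \<in> D" for x y
    unfolding rel_iff[OF F(1) that] F(2) using el_SS[OF _ assms(1)]
    by (auto simp: pair_inject pair_S intro: pair_S)
  have "clsfun D F"
    unfolding clsfun_def
  proof (intro conjI ballI impI)
    fix p assume "p \<in> D" "p \<epsilon> F"
    then have "p \<in> el F" by (simp add: els_def)
    then obtain x y where "x \<in> el X" "y \<in> S" "p = pair D x y" using F(2) by blast
    moreover from this have "x \<in> S" using el_SS[OF _ assms(1)] by blast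
    ultimately show "\<exists>x\<in>D. \<exists>y\<in>D. pr D p x y" using pr_iff[OF \<open>p \<in> D\<close>] S_D by blast
  qed (use relF func in blast)
  then have "\<exists>Y\<in>D. st D Y \<and> (\<forall>y\<in>D. y \<epsilon> Y \<longleftrightarrow> (\<exists>x\<in>D. x \<epsilon> X \<and> rel D F x y))"
    using rep F(1) assms(1) unfolding sat_ax_replacement St_def by blast
  then obtain Y where "Y \<in> D" "st D Y"
      and *: "\<forall>y\<in>D. y \<epsilon> Y \<longleftrightarrow> (\<exists>x\<in>D. x \<epsilon> X \<and> rel D F x y)" by blast
  then have Y: "Y \<in> S" by (simp add: St_def)
  have "el Y = {y \<in> S. \<exists>x\<in>el X. Q x y}"
  proof (rule set_eqI)
    fix y
    show "y \<in> el Y \<longleftrightarrow> y \<in> {y \<in> S. \<exists>x\<in>el X. Q x y}"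
      using * relF[of _ y] S_D[of y] by (auto simp: els_def)
  qed
  with Y show ?thesis by (rule smI)
qed

lemma sm_image:
  assumes "X \<in> S" "dft (\<lambda>e. f (e 0))" shows "sm (f ` el X)"
proof -
  have f: "f x \<in> S" if "x \<in> S" for x using dft_S[OF assms(2), of "\<lambda>_. x"] that by auto
  have "sm {y \<in> S. \<exists>x\<in>el X. y = f x}"
    by (rule class_function_image[OF assms(1)]) (auto intro!: dfb_intro dft_app1[OF assms(2)])
  also have "{y \<in> S. \<exists>x\<in>el X. y = f x} = f ` el X" using f el_SS[OF _ assms(1)] by auto
  finally show ?thesis .
qed

text \<open>Separation, by replacement along the identity restricted to \<open>A\<close>.\<close>

lemma sm_subset:
  assumes "cl A" "A \<subseteq> B" "sm B" shows "sm A"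
proof -
  obtain b where b: "b \<in> S" "el b = B" using assms(3) by (rule smE)
  have "sm {y \<in> S. \<exists>x\<in>el b. y = x \<and> x \<in> A}"
    by (rule class_function_image[OF b(1)]) (auto intro!: dfb_intro dfb_cl[OF assms(1)])
  also have "{y \<in> S. \<exists>x\<in>el b. y = x \<and> x \<in> A} = A" using assms(2) b el_SS by auto
  finally show ?thesis .
qed

lemma sm_sep:
  assumes "sm B" "dfb (\<lambda>e. P (e 0))" shows "sm {x \<in> B. P x}"
proof -
  have "sm {x \<in> S. x \<in> B \<and> P x}"
  proof (rule sm_subset[OF _ _ assms(1)])
    show "cl {x \<in> S. x \<in> B \<and> P x}"
      by (rule cl_comp, rule dfb_conj[OF dfb_cl[OF sm_cl[OF assms(1)] dft_var] assms(2)])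
  qed auto
  also have "{x \<in> S. x \<in> B \<and> P x} = {x \<in> B. P x}" using sm_S[OF assms(1)] by auto
  finally show ?thesis .
qed

lemma sm_Un: assumes "sm A" "sm B" shows "sm (A \<union> B)"
proof -
  obtain a b where ab: "a \<in> S" "b \<in> S" "el a = A" "el b = B" using assms by (metis smE)
  have "sm (\<Union>y\<in>el (mk D {a, b}). el y)" by (intro sm_Union sm_mk sm_pair ab)
  then show ?thesis using sm_mk[OF sm_pair[OF ab(1,2)]] ab by simp
qed

lemma sm_insert: "x \<in> S \<Longrightarrow> sm A \<Longrightarrow> sm (insert x A)"
  using sm_Un[OF sm_sing, of x A] by simp

lemma sm_empty: "sm {}"
proof -
  obtain x where "x \<in> S" using S_nonempty by auto
  have "sm {y \<in> el x. False}" by (intro sm_sep sm_el \<open>x \<in> S\<close> dfb_intro)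
  then show ?thesis by simp
qed

lemma sm_finite: "finite A \<Longrightarrow> A \<subseteq> S \<Longrightarrow> sm A"
  by (induction rule: finite_induct) (auto intro: sm_insert sm_empty)

lemma sm_UN:
  assumes "sm A" "dft (\<lambda>e. f (e 0))" shows "sm (\<Union>x\<in>A. el (f x))"
proof -
  obtain a where a: "a \<in> S" "el a = A" using assms(1) by (rule smE)
  have "sm (\<Union>y\<in>el (mk D (f ` el a)). el y)"
    by (intro sm_Union sm_mk sm_image a assms(2))
  then show ?thesis using sm_mk(2)[OF sm_image[OF a(1) assms(2)]] a by simp
qed

lemma sm_times:
  assumes "sm A" "sm B" shows "sm {pair D x y |x y. x \<in> A \<and> y \<in> B}"
proof -
  obtain b where b: "b \<in> S" "el b = B" using assms(2) by (rule smE)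
  define f where "f x = mk D (pair D x ` el b)" for x
  have 1: "sm (pair D x ` el b)" if "x \<in> S" for x
    by (intro sm_image b dfb_intro dft_const that)
  have "dft (\<lambda>e. f (e 0))"
    unfolding f_def by (rule dft_mk) (auto simp: image_iff intro!: 1 dfb_intro dft_const b)
  then have "sm (\<Union>x\<in>A. el (f x))" by (rule sm_UN[OF assms(1)])
  also have "(\<Union>x\<in>A. el (f x)) = (\<Union>x\<in>A. pair D x ` el b)"
    unfolding f_def using sm_mk(2)[OF 1] sm_S[OF assms(1)] by auto
  also have "\<dots> = {pair D x y |x y. x \<in> A \<and> y \<in> B}" using b by auto
  finally show ?thesis .
qed

lemma regularity:
  assumes "cl A" "A \<noteq> {}" obtains x where "x \<in> A" "el x \<inter> A = {}"
proof -
  obtain e :: "nat \<Rightarrow> 'a" where "range e \<subseteq> D" by (rule some_env)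
  then have reg: "sat D E e (ax_regularity 0)" by (intro GB_AC) (auto simp: GB_AC_def)
  obtain X where X: "X \<in> D" "el X = A" using assms(1) by (auto simp: cl_def)
  then obtain x where "x \<in> D" "x \<epsilon> X" "\<not> (\<exists>y\<in>D. y \<epsilon> x \<and> y \<epsilon> X)"
    using assms(2) reg unfolding sat_ax_regularity by (auto simp: els_def)
  then show ?thesis using X by (intro that[of x]) (auto simp: els_def)
qed

text \<open>Least-counterexample arguments for definable predicates; this takes the place of
  induction on rank.\<close>

lemma regularity_pred:
  assumes "dfb (\<lambda>e. P (e 0))" "x0 \<in> S" "P x0"
  obtains x where "x \<in> S" "P x" "\<And>y. y \<in> el x \<Longrightarrow> \<not> P y"
proof -
  have "cl {x \<in> S. P x}" by (rule cl_comp[OF assms(1)])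
  then obtain x where "x \<in> {x \<in> S. P x}" "el x \<inter> {x \<in> S. P x} = {}"
    by (rule regularity) (use assms in auto)
  then show ?thesis using el_SS by (intro that[of x]) auto
qed

lemma not_in_self: "x \<in> S \<Longrightarrow> x \<notin> el x"
  using regularity[OF sm_cl[OF sm_sing[of x]]] by auto

lemma not_sm_S: "\<not> sm S"
  by (metis smE not_in_self)

lemma choice:
  assumes "X \<in> S" "\<And>x. x \<in> el X \<Longrightarrow> el x \<noteq> {}"
  obtains f where "f \<in> S" "\<And>x. x \<in> el X \<Longrightarrow> \<exists>!y. y \<in> S \<and> pair D x y \<in> el f"
    "\<And>x y. x \<in> S \<Longrightarrow> y \<in> S \<Longrightarrow> pair D x y \<in> el f \<Longrightarrow> y \<in> el x"
proof -
  obtain e :: "nat \<Rightarrow> 'a" where "range e \<subseteq> D" by (rule some_env)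
  then have ac: "sat D E e (ax_choice 0)" by (intro GB_AC) (auto simp: GB_AC_def)
  have "X \<in> D" "st D X" using assms(1) by (auto simp: St_def)
  moreover have "\<forall>x\<in>D. x \<epsilon> X \<longrightarrow> (\<exists>y\<in>D. y \<epsilon> x)"
    using assms(2) by (auto simp: els_def)
  ultimately have "\<exists>f\<in>D. st D f \<and> (\<exists>U\<in>D. st D U \<and> funb D f X U) \<and>
      (\<forall>x\<in>D. \<forall>y\<in>D. rel D f x y \<longrightarrow> y \<epsilon> x)"
    using ac[unfolded sat_ax_choice, rule_format, of X] by blast
  then obtain f U where f: "f \<in> D" "st D f" "funb D f X U"
      "\<forall>x\<in>D. \<forall>y\<in>D. rel D f x y \<longrightarrow> y \<epsilon> x" by blast
  show ?thesis
  proof (rule that)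
    show "f \<in> S" using f by (simp add: St_def)
    show "\<exists>!y. y \<in> S \<and> pair D x y \<in> el f" if "x \<in> el X" for x
    proof -
      have x: "x \<in> S" "x \<in> D" "x \<epsilon> X" using that el_SS[OF that assms(1)] S_D by (auto simp: els_def)
      have "\<exists>y\<in>D. rel D f x y \<and> (\<forall>z\<in>D. rel D f x z \<longrightarrow> z = y)"
        using f(3) x unfolding funb_def by blast
      then show ?thesis using S_D x(1) rel_iff[OF f(1) x(2)] by metis
    qed
    show "y \<in> el x" if "x \<in> S" "y \<in> S" "pair D x y \<in> el f" for x y
      using that f(4) S_D rel_iff[OF f(1), of x y] by (auto simp: els_def)
  qed
qed

subsection \<open>Levels of the cumulative hierarchy\<close>

text \<open>Levels are defined without ordinals, through histories (Potter, Button): a history is a set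
  \<open>h\<close> each of whose members \<open>x\<close> is the set of all subsets of members of \<open>x \<inter> h\<close>.\<close>

definition hist :: "'a \<Rightarrow> bool" where
  "hist h \<longleftrightarrow> (\<forall>x\<in>el h. \<forall>y\<in>S. y \<in> el x \<longleftrightarrow> (\<exists>c\<in>el x. c \<in> el h \<and> el y \<subseteq> el c))"

definition lev :: "'a \<Rightarrow> bool" where
  "lev s \<longleftrightarrow> (\<exists>h\<in>S. hist h \<and> (\<forall>y\<in>S. y \<in> el s \<longleftrightarrow> (\<exists>c\<in>el h. el y \<subseteq> el c)))"

lemma dfb_hist: "dfb (\<lambda>e. hist (e i))"
  unfolding hist_def by (intro dfb_intro)

lemma dfb_lev_var: "dfb (\<lambda>e. lev (e i))"
  unfolding lev_def by (intro dfb_intro dfb_hist)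

lemma dfb_lev [dfb_intro]: "dft t \<Longrightarrow> dfb (\<lambda>e. lev (t e))"
  by (rule dfb_app1[OF dfb_lev_var])

text \<open>Take an \<open>\<in>\<close>-minimal failure \<open>c\<close>, with \<open>z\<close> in
  \<open>y\<close> in \<open>c\<close> and \<open>z\<close> not in \<open>c\<close>. The set
  \<open>y\<close> is included in some \<open>d\<close> of the history that is a member of
  \<open>c\<close>. By minimality \<open>d\<close> is transitive, so \<open>z\<close> is included in
  \<open>d\<close>, which puts \<open>z\<close> into \<open>c\<close>.\<close>

lemma hist_trans:
  assumes h: "h \<in> S" "hist h" and "c \<in> el h" "d \<in> el c"
  shows "el d \<subseteq> el c"
proof (rule ccontr)
  assume "\<not> el d \<subseteq> el c"
  then have bad: "c \<in> el h \<and> (\<exists>d\<in>el c. \<not> el d \<subseteq> el c)" using assms by auto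
  have "dfb (\<lambda>e. e 0 \<in> el h \<and> (\<exists>d\<in>el (e 0). \<not> el d \<subseteq> el (e 0)))"
    by (intro dfb_intro dft_const h)
  moreover have "c \<in> S" using bad h el_SS by blast
  ultimately obtain c where c: "c \<in> S" "c \<in> el h" "\<exists>d\<in>el c. \<not> el d \<subseteq> el c"
    and min: "\<And>y. y \<in> el c \<Longrightarrow> \<not> (y \<in> el h \<and> (\<exists>d\<in>el y. \<not> el d \<subseteq> el y))"
    using bad by (elim regularity_pred[where P = "\<lambda>c. c \<in> el h \<and> (\<exists>d\<in>el c. \<not> el d \<subseteq> el c)"]) auto
  from c obtain y z where yz: "y \<in> el c" "z \<in> el y" "z \<notin> el c" by blast
  have yS: "y \<in> S" and zS: "z \<in> S" using yz c(1) el_SS by blast+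
  from yz(1) yS obtain d where d: "d \<in> el c" "d \<in> el h" "el y \<subseteq> el d"
    using h(2) c(2) unfolding hist_def by blast
  then have "el z \<subseteq> el d" using min[OF d(1)] yz(2) by blast
  then have "z \<in> el c" using h(2) c(2) zS d unfolding hist_def by blast
  with yz show False by simp
qed

lemma lev_trans: "lev s \<Longrightarrow> s \<in> S \<Longrightarrow> x \<in> el s \<Longrightarrow> el x \<subseteq> el s"
proof
  fix z assume s: "lev s" "s \<in> S" and x: "x \<in> el s" and z: "z \<in> el x"
  have S: "x \<in> S" "z \<in> S" using s x z el_SS by blast+
  obtain h where h: "h \<in> S" "hist h" "\<And>y. y \<in> S \<Longrightarrow> y \<in> el s \<longleftrightarrow> (\<exists>c\<in>el h. el y \<subseteq> el c)"
    using s(1) unfolding lev_def by blast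
  from h(3)[OF S(1)] x obtain c where c: "c \<in> el h" "el x \<subseteq> el c" by blast
  with z have "el z \<subseteq> el c" using hist_trans[OF h(1,2) c(1)] by blast
  then show "z \<in> el s" using h(3)[OF S(2)] c by blast
qed

lemma lev_subset_mem: "lev s \<Longrightarrow> s \<in> S \<Longrightarrow> x \<in> el s \<Longrightarrow> y \<in> S \<Longrightarrow> el y \<subseteq> el x \<Longrightarrow> y \<in> el s"
  unfolding lev_def by (metis el_SS subset_trans)

lemma sm_restrict: "h \<in> S \<Longrightarrow> c \<in> S \<Longrightarrow> sm (el c \<inter> el h)"
  using sm_sep[OF sm_el[of c], of "\<lambda>x. x \<in> el h"] by (simp add: Int_def dfb_intro dft_const)

text \<open>The members of \<open>c\<close> that belong to \<open>h\<close> form a history again,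
  and this history generates \<open>c\<close>.\<close>

lemma hist_lev:
  assumes h: "h \<in> S" "hist h" and c: "c \<in> el h"
  shows "lev c"
proof -
  have cS: "c \<in> S" using c h(1) el_SS by blast
  define k where "k = mk D (el c \<inter> el h)"
  have k: "k \<in> S" "el k = el c \<inter> el h"
    using sm_mk[OF sm_restrict[OF h(1) cS]] by (simp_all add: k_def)
  have "hist k"
    unfolding hist_def
  proof (intro ballI)
    fix x y assume x: "x \<in> el k" and y: "y \<in> S"
    then have "el x \<subseteq> el c" "x \<in> el h" using k hist_trans[OF h c] by auto
    then show "y \<in> el x \<longleftrightarrow> (\<exists>d\<in>el x. d \<in> el k \<and> el y \<subseteq> el d)"
      using h(2) y k(2) unfolding hist_def by blast
  qed
  moreover have "\<forall>y\<in>S. y \<in> el c \<longleftrightarrow> (\<exists>d\<in>el k. el y \<subseteq> el d)"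
    using h(2) c k(2) unfolding hist_def by blast
  ultimately show ?thesis unfolding lev_def using k(1) by blast
qed

text \<open>From here on histories can be forgotten: a level is generated by the levels below
  it.\<close>

lemma lev_mem_iff:
  assumes "lev s" "s \<in> S" "x \<in> S"
  shows "x \<in> el s \<longleftrightarrow> (\<exists>r\<in>el s. lev r \<and> el x \<subseteq> el r)"
proof
  assume x: "x \<in> el s"
  obtain h where h: "h \<in> S" "hist h" "\<And>y. y \<in> S \<Longrightarrow> y \<in> el s \<longleftrightarrow> (\<exists>c\<in>el h. el y \<subseteq> el c)"
    using assms(1) unfolding lev_def by blast
  then obtain c where c: "c \<in> el h" "el x \<subseteq> el c" using x assms(3) by blast
  have "c \<in> S" using c h(1) el_SS by blast
  then have "c \<in> el s" using h(3) c by blast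
  with c hist_lev[OF h(1,2)] show "\<exists>r\<in>el s. lev r \<and> el x \<subseteq> el r" by blast
next
  assume "\<exists>r\<in>el s. lev r \<and> el x \<subseteq> el r"
  then show "x \<in> el s" using lev_subset_mem assms by blast
qed

text \<open>Choose \<open>s\<close> minimal among the levels incomparable with some level, then
  \<open>t\<close> minimal among those incomparable with this \<open>s\<close>. Every level below
  one of them is comparable with the other, and by \<open>lev_mem_iff\<close> the two include each
  other.\<close>

lemma lev_linear:
  assumes "lev s" "s \<in> S" "lev t" "t \<in> S"
  shows "s \<in> el t \<or> s = t \<or> t \<in> el s"
proof (rule ccontr)
  define inc where "inc s t \<longleftrightarrow> lev t \<and> \<not> (s \<in> el t \<or> s = t \<or> t \<in> el s)" for s t
  assume "\<not> ?thesis"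
  then have "lev s \<and> (\<exists>t\<in>S. inc s t)" using assms by (auto simp: inc_def)
  moreover have "dfb (\<lambda>e. lev (e 0) \<and> (\<exists>t\<in>S. inc (e 0) t))"
    unfolding inc_def by (intro dfb_intro)
  ultimately obtain s where s: "s \<in> S" "lev s" "\<exists>t\<in>S. inc s t"
    and mins: "\<And>r. r \<in> el s \<Longrightarrow> \<not> (lev r \<and> (\<exists>t\<in>S. inc r t))"
    using assms(2) by (elim regularity_pred[where P = "\<lambda>s. lev s \<and> (\<exists>t\<in>S. inc s t)"]) auto
  have "dfb (\<lambda>e. inc s (e 0))"
    unfolding inc_def by (intro dfb_intro dft_const s)
  with s(3) obtain t where t: "t \<in> S" "inc s t" and mint: "\<And>r. r \<in> el t \<Longrightarrow> \<not> inc s r"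
    by (elim bexE regularity_pred[where P = "inc s"]) auto
  have tl: "lev t" using t by (simp add: inc_def)
  have "x \<in> el t" if "x \<in> el s" for x
  proof -
    have xS: "x \<in> S" using that s(1) el_SS by blast
    with that obtain r where r: "r \<in> el s" "lev r" "el x \<subseteq> el r" using lev_mem_iff s by blast
    have "r \<in> S" using r(1) s(1) el_SS by blast
    have "\<not> inc r t" using mins[OF r(1)] r(2) t(1) by blast
    then consider "r \<in> el t" | "r = t" | "t \<in> el r" using tl by (auto simp: inc_def)
    then show ?thesis
    proof cases
      case 1
      then show ?thesis using lev_subset_mem[OF tl t(1) _ xS] r by blast
    next
      case 2
      then show ?thesis using r(1) t(2) by (simp add: inc_def)
    next
      case 3
      then have "t \<in> el s" using lev_trans[OF s(2,1) r(1)] by blast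
      then show ?thesis using t(2) by (simp add: inc_def)
    qed
  qed
  moreover have "x \<in> el s" if "x \<in> el t" for x
  proof -
    have xS: "x \<in> S" using that t(1) el_SS by blast
    with that obtain r where r: "r \<in> el t" "lev r" "el x \<subseteq> el r" using lev_mem_iff tl t(1) by blast
    have "\<not> inc s r" using mint[OF r(1)] .
    then consider "s \<in> el r" | "s = r" | "r \<in> el s" using r(2) by (auto simp: inc_def)
    then show ?thesis
    proof cases
      case 1
      then have "s \<in> el t" using lev_trans[OF tl t(1) r(1)] by blast
      then show ?thesis using t(2) by (simp add: inc_def)
    next
      case 2
      then show ?thesis using r(1) t(2) by (simp add: inc_def)
    next
      case 3
      then show ?thesis using lev_subset_mem[OF s(2,1) _ xS] r by blast
    qed
  qed
  ultimately have "el s = el t" by blast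
  then have "s = t" using el_inject s(1) t(1) S_D by blast
  with t(2) show False by (simp add: inc_def)
qed

lemma lev_psubset: 
  assumes "lev s" "s \<in> S" "lev t" "t \<in> S" "el s \<subseteq> el t" "s \<noteq> t"
  shows "s \<in> el t"
  using lev_linear[OF assms(1-4)] assms(5,6) not_in_self[OF assms(4)] by blast

lemma lev_least:
  assumes "dfb (\<lambda>e. P (e 0))" "s \<in> S" "lev s" "P s"
  obtains r where "r \<in> S" "lev r" "P r" "\<And>q. q \<in> S \<Longrightarrow> lev q \<Longrightarrow> P q \<Longrightarrow> r = q \<or> r \<in> el q"
proof -
  have "dfb (\<lambda>e. lev (e 0) \<and> P (e 0))" by (intro dfb_conj dfb_lev dft_var assms(1))
  then obtain r where r: "r \<in> S" "lev r \<and> P r" "\<And>q. q \<in> el r \<Longrightarrow> \<not> (lev q \<and> P q)"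
    using assms(2-4) by (elim regularity_pred[where P = "\<lambda>s. lev s \<and> P s"]) auto
  show thesis
  proof (rule that)
    fix q assume "q \<in> S" "lev q" "P q"
    then show "r = q \<or> r \<in> el q" using r(3)[of q] lev_linear[of r q] r(1,2) by blast
  qed (use r in auto)
qed

lemma sm_subsets_of_members:
  assumes h: "h \<in> S" shows "sm {y \<in> S. \<exists>c\<in>el h. el y \<subseteq> el c}"
proof (rule sm_subset)
  show "cl {y \<in> S. \<exists>c\<in>el h. el y \<subseteq> el c}" by (intro cl_comp dfb_intro dft_const h)
  let ?U = "mk D (\<Union>c\<in>el h. el c)"
  have U: "?U \<in> S" "el ?U = (\<Union>c\<in>el h. el c)" using sm_mk[OF sm_Union[OF h]] by auto
  show "sm {y \<in> S. el y \<subseteq> el ?U}" by (rule sm_Pow[OF U(1)])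
  show "{y \<in> S. \<exists>c\<in>el h. el y \<subseteq> el c} \<subseteq> {y \<in> S. el y \<subseteq> el ?U}" using U(2) by blast
qed

text \<open>For an \<open>\<in>\<close>-minimal \<open>x\<close> outside all levels, replacement
  collects the least levels of the members of \<open>x\<close>. A history built from them yields a
  level that contains \<open>x\<close>.\<close>

lemma mem_some_lev:
  assumes "x \<in> S" shows "\<exists>s\<in>S. lev s \<and> x \<in> el s"
proof (rule ccontr)
  define P where "P x \<longleftrightarrow> (\<exists>s\<in>S. lev s \<and> x \<in> el s)" for x
  have dP: "dfb (\<lambda>e. P (e i))" for i unfolding P_def by (intro dfb_intro)
  assume "\<not> ?thesis"
  then have "\<not> P x" by (simp add: P_def)
  from regularity_pred[where P = "\<lambda>x. \<not> P x", OF dfb_not[OF dP] assms this]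
  obtain x where x: "x \<in> S" "\<not> P x" "\<And>y. y \<in> el x \<Longrightarrow> P y"
    by auto
  define L where "L y s \<longleftrightarrow> lev s \<and> y \<in> el s \<and> (\<forall>q\<in>S. lev q \<and> y \<in> el q \<longrightarrow> s = q \<or> s \<in> el q)" for y s
  have L_ex: "\<exists>s\<in>S. L y s" if y: "y \<in> el x" for y
  proof -
    have yS: "y \<in> S" using y x(1) el_SS by blast
    obtain s where s: "s \<in> S" "lev s" "y \<in> el s" using x(3)[OF y] by (auto simp: P_def)
    have d: "dfb (\<lambda>e. y \<in> el (e 0))" by (intro dfb_intro dft_const yS)
    from lev_least[where P = "\<lambda>s. y \<in> el s", OF d s] show ?thesis unfolding L_def by metis
  qed
  have L_un: "s = t" if "s \<in> S" "t \<in> S" "L y s" "L y t" for y s t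
    using that not_in_self lev_trans[of s t] unfolding L_def by blast
  define A where "A = {s \<in> S. \<exists>y\<in>el x. L y s}"
  have "sm A"
    unfolding A_def
  proof (rule class_function_image[OF x(1)])
    show "dfb (\<lambda>e. L (e 0) (e (Suc 0)))" unfolding L_def by (intro dfb_intro)
  qed (use L_un in blast)
  then obtain a where a: "a \<in> S" "el a = A" by (rule smE)
  \<comment> \<open>A history has to contain every level that is a member of one of its members, so
    \<open>A\<close> is closed downward.\<close>
  define B where "B = {r \<in> A \<union> (\<Union>s\<in>el a. el s). lev r}"
  have smB: "sm B"
    unfolding B_def
    by (rule sm_sep[OF sm_Un[OF \<open>sm A\<close> sm_Union[OF a(1)]]]) (intro dfb_intro)
  then obtain h where h: "h \<in> S" "el h = B" by (rule smE)
  have AB: "A \<subseteq> B" by (auto simp: A_def B_def L_def)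
  have AS: "A \<subseteq> S" by (auto simp: A_def)
  have Blev: "lev r" "r \<in> S" if "r \<in> B" for r
    using that sm_S[OF smB] by (auto simp: B_def)
  have Bdown: "q \<in> B" if rq: "r \<in> B" "q \<in> el r" "lev q" for r q
  proof -
    have "q \<in> (\<Union>s\<in>el a. el s)"
    proof (cases "r \<in> A")
      case True
      then show ?thesis using a rq by blast
    next
      case False
      then obtain s where s: "s \<in> A" "r \<in> el s" using rq(1) a by (auto simp: B_def)
      then have "lev s" "s \<in> S" by (auto simp: A_def L_def)
      then show ?thesis using lev_trans[of s r] s a rq(2) by blast
    qed
    with rq(3) show ?thesis by (simp add: B_def)
  qed
  define s where "s = mk D {y \<in> S. \<exists>c\<in>el h. el y \<subseteq> el c}"
  have s: "s \<in> S" "el s = {y \<in> S. \<exists>c\<in>el h. el y \<subseteq> el c}"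
    using sm_mk[OF sm_subsets_of_members[OF h(1)]] by (simp_all add: s_def)
  have Bs: "B \<subseteq> el s" using s(2) h(2) Blev by blast
  have xs: "el x \<subseteq> el s"
  proof
    fix y assume y: "y \<in> el x"
    then obtain l where l: "l \<in> S" "L y l" using L_ex by blast
    then have "l \<in> B" using y AB by (auto simp: A_def)
    moreover have "el y \<subseteq> el l" using l lev_trans unfolding L_def by blast
    moreover have "y \<in> S" using y x(1) el_SS by blast
    ultimately show "y \<in> el s" using s(2) h(2) by blast
  qed
  \<comment> \<open>\<open>x\<close> is only a subset of the level \<open>s\<close> generated by
    \<open>B\<close>; one more step is made to have it as a member.\<close>
  define k where "k = mk D (insert s B)"
  have k: "k \<in> S" "el k = insert s B" using sm_mk[OF sm_insert[OF s(1) smB]] by (simp_all add: k_def)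
  have histB: "y \<in> el r \<longleftrightarrow> (\<exists>c\<in>el r. c \<in> B \<and> el y \<subseteq> el c)" if "r \<in> B" "y \<in> S" for r y
    using lev_mem_iff[OF Blev[OF that(1)] that(2)] Bdown[OF that(1)] Blev by blast
  have sB: "s \<notin> el r" if "r \<in> B" for r
    using that s not_in_self[OF s(1)] Blev[OF that] lev_trans[of r] h(2) by blast
  have "hist k"
    unfolding hist_def
  proof (intro ballI)
    fix r y assume r: "r \<in> el k" and y: "y \<in> S"
    show "y \<in> el r \<longleftrightarrow> (\<exists>c\<in>el r. c \<in> el k \<and> el y \<subseteq> el c)"
    proof (cases "r = s")
      case True
      then show ?thesis using s y h(2) k(2) Bs not_in_self[OF s(1)] by auto
    next
      case False
      then have "r \<in> B" using r k by auto
      then show ?thesis using histB[OF _ y] sB k(2) by auto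
    qed
  qed
  define l where "l = mk D {y \<in> S. \<exists>c\<in>el k. el y \<subseteq> el c}"
  have l: "l \<in> S" "el l = {y \<in> S. \<exists>c\<in>el k. el y \<subseteq> el c}"
    using sm_mk[OF sm_subsets_of_members[OF k(1)]] by (simp_all add: l_def)
  have "lev l" unfolding lev_def using k(1) \<open>hist k\<close> l by blast
  moreover have "x \<in> el l" using l(2) k(2) xs x(1) by blast
  ultimately show False using x(2) l(1) by (auto simp: P_def)
qed

lemma not_sm_lev: "\<not> sm {s \<in> S. lev s}"
proof
  assume "sm {s \<in> S. lev s}"
  then obtain a where a: "a \<in> S" "el a = {s \<in> S. lev s}" by (rule smE)
  have "(\<Union>s\<in>el a. el s) = S"
  proof
    show "(\<Union>s\<in>el a. el s) \<subseteq> S" unfolding a(2) using el_SS by auto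
    show "S \<subseteq> (\<Union>s\<in>el a. el s)" unfolding a(2) using mem_some_lev by fast
  qed
  then show False using sm_Union[OF a(1)] not_sm_S by simp
qed

subsection \<open>Graphs and homomorphisms\<close>

definition graph :: "'a \<Rightarrow> 'a \<Rightarrow> bool" where
  "graph V A \<longleftrightarrow> V \<in> S \<and> A \<in> S \<and> (\<forall>p\<in>el A. \<exists>x\<in>el V. \<exists>y\<in>el V. p = pair D x y)"

lemma relb_iff:
  assumes "F \<in> D" "A \<in> D" "B \<in> D"
  shows "relb D F A B \<longleftrightarrow> (\<forall>p\<in>el F. \<exists>x\<in>el A. \<exists>y\<in>el B. p = pair D x y)"
proof
  assume r: "relb D F A B"
  show "\<forall>p\<in>el F. \<exists>x\<in>el A. \<exists>y\<in>el B. p = pair D x y"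
  proof
    fix p assume "p \<in> el F"
    then have p: "p \<in> D" "p \<epsilon> F" by (auto simp: els_def)
    then obtain x y where "x \<in> D" "y \<in> D" "x \<epsilon> A" "y \<epsilon> B" "pr D p x y"
      using r unfolding relb_def by blast
    then show "\<exists>x\<in>el A. \<exists>y\<in>el B. p = pair D x y"
      using pr_iff[OF p(1)] by (auto simp: els_def)
  qed
next
  assume r: "\<forall>p\<in>el F. \<exists>x\<in>el A. \<exists>y\<in>el B. p = pair D x y"
  show "relb D F A B"
    unfolding relb_def
  proof (intro ballI impI)
    fix p assume p: "p \<in> D" "p \<epsilon> F"
    then have "p \<in> el F" by (auto simp: els_def)
    then obtain x y where xy: "x \<in> el A" "y \<in> el B" "p = pair D x y" using r by blast
    moreover have "x \<in> S" "y \<in> S" using xy el_S assms by blast+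
    moreover from this have "x \<in> D" "y \<in> D" using S_D by blast+
    ultimately show "\<exists>x\<in>D. \<exists>y\<in>D. x \<epsilon> A \<and> y \<epsilon> B \<and> pr D p x y"
      using pr_iff[OF p(1)] mem_el by blast
  qed
qed

lemma grw_iff:
  assumes "g \<in> D" "V \<in> D" "A \<in> D"
  shows "grw D g V A \<longleftrightarrow> graph V A \<and> g = pair D V A"
  using pr_iff[OF assms] relb_iff[OF assms(3,2,2)] by (auto simp: grw_def graph_def)

lemma gr_iff: "g \<in> D \<Longrightarrow> gr D g \<longleftrightarrow> (\<exists>V A. graph V A \<and> g = pair D V A)"
  unfolding gr_def using grw_iff[of g] S_D by (metis graph_def)

definition fun_on :: "'a \<Rightarrow> 'a \<Rightarrow> ('a \<Rightarrow> 'a) \<Rightarrow> 'a \<Rightarrow> bool" where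
  "fun_on F A f B \<longleftrightarrow> (\<forall>x\<in>el A. f x \<in> el B) \<and> el F = {pair D x (f x) |x. x \<in> el A}"

lemma fun_on_iff:
  assumes "fun_on F A f B" "A \<in> S" "B \<in> S" "x \<in> S" "y \<in> S"
  shows "pair D x y \<in> el F \<longleftrightarrow> x \<in> el A \<and> y = f x"
proof
  assume "pair D x y \<in> el F"
  then obtain x' where "x' \<in> el A" "pair D x y = pair D x' (f x')"
    using assms(1) by (auto simp: fun_on_def)
  moreover from this have "x' \<in> S" "f x' \<in> S" using assms el_SS by (auto simp: fun_on_def)
  ultimately show "x \<in> el A \<and> y = f x" using assms(4,5) by (simp add: pair_inject)
qed (use assms in \<open>auto simp: fun_on_def\<close>)

lemma funb_iff:
  assumes "F \<in> D" "A \<in> S" "B \<in> S"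
  shows "funb D F A B \<longleftrightarrow> (\<exists>f. fun_on F A f B)"
proof
  assume fb: "funb D F A B"
  have AB: "A \<in> D" "B \<in> D" using assms S_D by auto
  have r: "\<forall>p\<in>el F. \<exists>x\<in>el A. \<exists>y\<in>el B. p = pair D x y"
    using fb relb_iff[OF assms(1) AB] by (simp add: funb_def)
  have ex1: "\<exists>y\<in>S. pair D x y \<in> el F \<and> (\<forall>z\<in>S. pair D x z \<in> el F \<longrightarrow> z = y)" if "x \<in> el A" for x
  proof -
    have x: "x \<in> S" "x \<in> D" "x \<epsilon> A" using that el_SS[OF that assms(2)] S_D by (auto simp: els_def)
    then have "\<exists>y\<in>D. rel D F x y \<and> (\<forall>z\<in>D. rel D F x z \<longrightarrow> z = y)"
      using fb unfolding funb_def by blast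
    then show ?thesis using S_D x(1) rel_iff[OF assms(1) x(2)] by metis
  qed
  define f where "f x = (SOME y. y \<in> S \<and> pair D x y \<in> el F)" for x
  have f: "f x \<in> S \<and> pair D x (f x) \<in> el F" if "x \<in> el A" for x
    unfolding f_def using ex1[OF that] by (intro someI_ex[of "\<lambda>y. y \<in> S \<and> pair D x y \<in> el F"]) blast
  have un: "y = f x" if "x \<in> el A" "y \<in> S" "pair D x y \<in> el F" for x y
    using ex1[OF that(1)] f[OF that(1)] that(2,3) by blast
  have "f x \<in> el B" if x: "x \<in> el A" for x
  proof -
    obtain x' y' where "x' \<in> el A" "y' \<in> el B" "pair D x (f x) = pair D x' y'"
      using f[OF x] r by blast
    then show ?thesis using f[OF x] x el_SS assms by (metis pair_inject)
  qed
  moreover have "el F = {pair D x (f x) |x. x \<in> el A}"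
  proof
    show "el F \<subseteq> {pair D x (f x) |x. x \<in> el A}"
    proof
      fix p assume p: "p \<in> el F"
      then obtain x y where xy: "x \<in> el A" "y \<in> el B" "p = pair D x y" using r by blast
      then have "y = f x" using un p el_SS assms(3) by blast
      then show "p \<in> {pair D x (f x) |x. x \<in> el A}" using xy by blast
    qed
  qed (use f in blast)
  ultimately show "\<exists>f. fun_on F A f B" unfolding fun_on_def by blast
next
  assume "\<exists>f. fun_on F A f B"
  then obtain f where f: "fun_on F A f B" by blast
  have AB: "A \<in> D" "B \<in> D" using assms S_D by auto
  have "relb D F A B"
    unfolding relb_iff[OF assms(1) AB] using f by (auto simp: fun_on_def)
  moreover have "\<exists>y\<in>D. rel D F x y \<and> (\<forall>z\<in>D. rel D F x z \<longrightarrow> z = y)" if "x \<in> D" "x \<epsilon> A" for x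
  proof -
    have x: "x \<in> el A" "x \<in> S" using that el_SS[OF _ assms(2)] by (auto simp: els_def)
    then have fx: "f x \<in> S" "f x \<in> D" using f el_SS[OF _ assms(3)] S_D by (auto simp: fun_on_def)
    have "rel D F x z \<longleftrightarrow> z \<in> S \<and> z = f x" if "z \<in> D" for z
      unfolding rel_iff[OF assms(1) \<open>x \<in> D\<close> that] using fun_on_iff[OF f assms(2,3) x(2)] x by blast
    then show ?thesis using fx by blast
  qed
  ultimately show "funb D F A B" by (simp add: funb_def)
qed

definition ghom :: "('a \<Rightarrow> 'a) \<Rightarrow> 'a \<Rightarrow> 'a \<Rightarrow> 'a \<Rightarrow> 'a \<Rightarrow> bool" where
  "ghom f V A V' A' \<longleftrightarrow> (\<forall>x\<in>el V. f x \<in> el V') \<and>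
    (\<forall>v\<in>el V. \<forall>w\<in>el V. pair D v w \<in> el A \<longrightarrow> pair D (f v) (f w) \<in> el A')"

text \<open>Trades a homomorphism of the model for a HOL function, so that later constructions can
  use ordinary application.\<close>

lemma hom_iff:
  assumes "graph V A" "graph V' A'" "h \<in> D"
  shows "hom D h (pair D V A) (pair D V' A') \<longleftrightarrow> (\<exists>f. fun_on h V f V' \<and> ghom f V A V' A')"
proof -
  have VS: "V \<in> S" "A \<in> S" "V' \<in> S" "A' \<in> S" using assms by (auto simp: graph_def)
  then have VD: "V \<in> D" "A \<in> D" "V' \<in> D" "A' \<in> D" "pair D V A \<in> D" "pair D V' A' \<in> D"
    using S_D pair_S by auto
  have g: "grw D (pair D V A) X Y \<longleftrightarrow> X = V \<and> Y = A" if "X \<in> D" "Y \<in> D" for X Y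
    unfolding grw_iff[OF VD(5) that] using assms(1) pair_inject VS by (auto simp: graph_def)
  have g': "grw D (pair D V' A') X Y \<longleftrightarrow> X = V' \<and> Y = A'" if "X \<in> D" "Y \<in> D" for X Y
    unfolding grw_iff[OF VD(6) that] using assms(2) pair_inject VS by (auto simp: graph_def)
  have "hom D h (pair D V A) (pair D V' A') \<longleftrightarrow> funb D h V V' \<and>
    (\<forall>v\<in>D. \<forall>w\<in>D. \<forall>v'\<in>D. \<forall>w'\<in>D. rel D A v w \<and> rel D h v v' \<and> rel D h w w' \<longrightarrow> rel D A' v' w')"
    unfolding hom_def using g g' VD by (auto cong: bex_cong)
  also have "\<dots> \<longleftrightarrow> (\<exists>f. fun_on h V f V' \<and>
    (\<forall>v\<in>D. \<forall>w\<in>D. \<forall>v'\<in>D. \<forall>w'\<in>D. rel D A v w \<and> rel D h v v' \<and> rel D h w w' \<longrightarrow> rel D A' v' w'))"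
    using funb_iff[OF assms(3) VS(1,3)] by blast
  also have "\<dots> \<longleftrightarrow> (\<exists>f. fun_on h V f V' \<and> ghom f V A V' A')"
  proof (intro ex_cong1 conj_cong refl)
    fix f assume f: "fun_on h V f V'"
    have fV: "f x \<in> el V'" "f x \<in> S" "f x \<in> D" "x \<in> S" "x \<in> D" if "x \<in> el V" for x
      using f that el_SS[of _ V'] el_SS[of _ V] VS S_D by (auto simp: fun_on_def)
    have hiff: "rel D h v v' \<longleftrightarrow> v \<in> el V \<and> v' = f v" if "v \<in> D" "v' \<in> D" for v v'
    proof -
      have "rel D h v v' \<longleftrightarrow> v \<in> S \<and> v' \<in> S \<and> pair D v v' \<in> el h" by (rule rel_iff[OF assms(3) that])
      also have "\<dots> \<longleftrightarrow> v \<in> el V \<and> v' = f v" using fun_on_iff[OF f VS(1,3)] fV by metis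
      finally show ?thesis .
    qed
    show "(\<forall>v\<in>D. \<forall>w\<in>D. \<forall>v'\<in>D. \<forall>w'\<in>D. rel D A v w \<and> rel D h v v' \<and> rel D h w w' \<longrightarrow> rel D A' v' w')
      \<longleftrightarrow> ghom f V A V' A'" (is "?l \<longleftrightarrow> _")
    proof
      assume l: ?l
      show "ghom f V A V' A'"
        unfolding ghom_def
      proof (intro conjI ballI impI)
        fix v w assume vw: "v \<in> el V" "w \<in> el V" "pair D v w \<in> el A"
        then have "rel D A v w" using rel_iff[OF VD(2), of v w] fV by blast
        moreover have "rel D h v (f v)" "rel D h w (f w)" using hiff fV vw by blast+
        ultimately have "rel D A' (f v) (f w)" using l fV vw by blast
        then show "pair D (f v) (f w) \<in> el A'" using rel_iff[OF VD(4)] fV vw by blast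
      qed (use fV in blast)
    next
      assume gh: "ghom f V A V' A'"
      show ?l
      proof (intro ballI impI, elim conjE)
        fix v w v' w' assume d: "v \<in> D" "w \<in> D" "v' \<in> D" "w' \<in> D"
          and r: "rel D A v w" "rel D h v v'" "rel D h w w'"
        then have eq: "v \<in> el V" "v' = f v" "w \<in> el V" "w' = f w" using hiff by auto
        have "pair D v w \<in> el A" using r(1) rel_iff[OF VD(2)] d by blast
        then have "pair D (f v) (f w) \<in> el A'" using gh eq unfolding ghom_def by blast
        then show "rel D A' v' w'" using rel_iff[OF VD(4)] d eq fV by blast
      qed
    qed
  qed
  finally show ?thesis .
qed

lemma ident_iff:
  assumes "graph V A" "graph V' A'" "h \<in> D" "fun_on h V f V'" "ghom f V A V' A'"
  shows "ident D h (pair D V A) (pair D V' A') \<longleftrightarrow>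
    pair D V A = pair D V' A' \<and> (\<forall>x\<in>el V. f x = x)"
proof -
  have VS: "V \<in> S" "V' \<in> S" using assms by (auto simp: graph_def)
  have fV: "f x \<in> S" "f x \<in> D" "x \<in> S" "x \<in> D" if "x \<in> el V" for x
    using assms(4) that el_SS[of _ V'] el_SS[of _ V] VS S_D by (auto simp: fun_on_def)
  have hiff: "rel D h v v' \<longleftrightarrow> v \<in> el V \<and> v' = f v" if "v \<in> D" "v' \<in> D" for v v'
  proof -
    have "rel D h v v' \<longleftrightarrow> v \<in> S \<and> v' \<in> S \<and> pair D v v' \<in> el h" by (rule rel_iff[OF assms(3) that])
    also have "\<dots> \<longleftrightarrow> v \<in> el V \<and> v' = f v" using fun_on_iff[OF assms(4) VS] fV by metis
    finally show ?thesis .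
  qed
  have "(\<forall>x\<in>D. \<forall>y\<in>D. rel D h x y \<longrightarrow> x = y) \<longleftrightarrow> (\<forall>x\<in>el V. f x = x)"
    using hiff fV by metis
  then show ?thesis
    unfolding ident_def using hom_iff[OF assms(1-3)] assms(4,5) by blast
qed

subsection \<open>Coding binary relations by graphs\<close>

text \<open>Iterated singletons of the empty set: distinct sets indexed by the numbers of the
  metatheory, which serve as labels for the types of vertices.\<close>

primrec tag :: "nat \<Rightarrow> 'a" where
  "tag 0 = mk D {}"
| "tag (Suc i) = mk D {tag i}"

lemma tag_S: "tag i \<in> S"
  by (induction i) (auto intro!: sm_mk sm_empty sm_sing)

lemma el_tag: "el (tag 0) = {}" "el (tag (Suc i)) = {tag i}"
  using sm_mk(2)[OF sm_empty] sm_mk(2)[OF sm_sing[OF tag_S]] by simp_all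

lemma tag_inject: "tag i = tag j \<longleftrightarrow> i = j"
proof (induction i arbitrary: j)
  case 0
  show ?case by (cases j) (use el_tag(1) el_tag(2)[of "j - 1"] in force)+
next
  case (Suc i)
  show ?case
  proof (cases j)
    case 0
    then show ?thesis using el_tag(1) el_tag(2)[of i] by force
  next
    case (Suc k)
    then show ?thesis using el_tag(2)[of i] el_tag(2)[of k] Suc.IH[of k] by (metis singleton_inject)
  qed
qed

definition vert :: "nat \<Rightarrow> 'a \<Rightarrow> 'a" where
  "vert i x = pair D (tag i) x"

lemma vert_S: "x \<in> S \<Longrightarrow> vert i x \<in> S"
  by (simp add: vert_def pair_S tag_S)

lemma vert_inject: "x \<in> S \<Longrightarrow> y \<in> S \<Longrightarrow> vert i x = vert j y \<longleftrightarrow> i = j \<and> x = y"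
  by (simp add: vert_def pair_inject tag_S tag_inject)

lemma dft_vert [dfb_intro]: "dft t \<Longrightarrow> dft (\<lambda>e. vert i (t e))"
  unfolding vert_def by (intro dft_pair dft_const tag_S)

text \<open>The vertices with second component \<open>A\<close> form a rigid core; the others are copies of the
  members of \<open>A\<close>, one for each type \<open>i < n + 2\<close>, and a copy of type \<open>i\<close> points to the core
  vertices \<open>0\<close> and \<open>i + 1\<close>. As \<open>n + 2\<close> is the only core vertex pointing to \<open>0\<close> and points to nothing
  else, homomorphisms respect types.\<close>

definition node :: "nat \<Rightarrow> 'a \<Rightarrow> nat \<Rightarrow> 'a \<Rightarrow> bool" where
  "node n A i x \<longleftrightarrow> x \<in> el A \<and> i < n + 2 \<or> x = A \<and> i \<le> n + 2"

definition arc :: "nat \<Rightarrow> (nat \<Rightarrow> 'a \<Rightarrow> 'a \<Rightarrow> 'a \<Rightarrow> bool) \<Rightarrow> 'a \<Rightarrow> nat \<Rightarrow> 'a \<Rightarrow> nat \<Rightarrow> 'a \<Rightarrow> bool" where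
  "arc n R A i x j y \<longleftrightarrow> node n A i x \<and> node n A j y \<and>
    (x = A \<and> y = A \<and> (i < j \<or> i = n + 2 \<and> j = 0) \<or>
     x \<in> el A \<and> y = A \<and> (j = 0 \<or> j = Suc i) \<or>
     x \<in> el A \<and> y \<in> el A \<and> (j = Suc i \<and> x = y \<or> j = Suc (Suc i) \<and> R i A x y))"

definition vset :: "nat \<Rightarrow> 'a \<Rightarrow> 'a" where
  "vset n A = mk D {z \<in> S. \<exists>i<n+3. \<exists>x\<in>S. z = vert i x \<and> node n A i x}"

definition aset :: "nat \<Rightarrow> (nat \<Rightarrow> 'a \<Rightarrow> 'a \<Rightarrow> 'a \<Rightarrow> bool) \<Rightarrow> 'a \<Rightarrow> 'a" where
  "aset n R A = mk D {z \<in> S. \<exists>i<n+3. \<exists>j<n+3. \<exists>x\<in>S. \<exists>y\<in>S.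
     z = pair D (vert i x) (vert j y) \<and> arc n R A i x j y}"

lemma dfb_node: "dft s \<Longrightarrow> dft t \<Longrightarrow> dfb (\<lambda>e. node n (s e) i (t e))"
  unfolding node_def by (intro dfb_intro)

lemma node_S: "A \<in> S \<Longrightarrow> node n A i x \<Longrightarrow> x \<in> S"
  using el_SS by (auto simp: node_def)

lemma sm_vset:
  assumes "A \<in> S"
  shows "sm {z \<in> S. \<exists>i<n+3. \<exists>x\<in>S. z = vert i x \<and> node n A i x}" (is "sm ?V")
proof (rule sm_subset)
  show "cl ?V" by (intro cl_comp dfb_intro dfb_node dft_const assms)
  have "sm (tag ` {..<n+3})" by (intro sm_finite) (auto simp: tag_S)
  from sm_times[OF this sm_insert[OF assms sm_el[OF assms]]]
  show "sm {pair D x y |x y. x \<in> tag ` {..<n+3} \<and> y \<in> insert A (el A)}" .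
  show "?V \<subseteq> {pair D x y |x y. x \<in> tag ` {..<n+3} \<and> y \<in> insert A (el A)}"
    by (auto simp: node_def vert_def)
qed

lemma vset:
  assumes "A \<in> S"
  shows "vset n A \<in> S" "z \<in> el (vset n A) \<longleftrightarrow> (\<exists>i x. z = vert i x \<and> node n A i x)"
proof -
  show "vset n A \<in> S" unfolding vset_def by (rule sm_mk[OF sm_vset[OF assms]])
  have n: "i < n + 3 \<and> x \<in> S" if "node n A i x" for i x
    using that node_S[OF assms that] by (auto simp: node_def)
  have "z \<in> el (vset n A) \<longleftrightarrow> z \<in> S \<and> (\<exists>i<n+3. \<exists>x\<in>S. z = vert i x \<and> node n A i x)"
    unfolding vset_def sm_mk(2)[OF sm_vset[OF assms]] by simp
  also have "\<dots> \<longleftrightarrow> (\<exists>i x. z = vert i x \<and> node n A i x)"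
    using n vert_S by metis
  finally show "z \<in> el (vset n A) \<longleftrightarrow> (\<exists>i x. z = vert i x \<and> node n A i x)" .
qed

lemma vert_vset: "A \<in> S \<Longrightarrow> x \<in> S \<Longrightarrow> vert i x \<in> el (vset n A) \<longleftrightarrow> node n A i x"
  using vset(2) vert_inject node_S by metis

context
  fixes n :: nat and R :: "nat \<Rightarrow> 'a \<Rightarrow> 'a \<Rightarrow> 'a \<Rightarrow> bool"
  assumes dR: "\<And>k i j l. k < n \<Longrightarrow> dfb (\<lambda>e. R k (e i) (e j) (e l))"
begin

lemma dfb_arc:
  assumes "dft s" "dft t" "dft u"
  shows "dfb (\<lambda>e. arc n R (s e) i (t e) j (u e))"
proof (cases "i < n")
  case True
  have "dfb (\<lambda>e. R i (s e) (t e) (u e))"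
    by (rule dfb_app3[where P = "R i"]) (use dR[OF True] assms in simp_all)
  then show ?thesis
    unfolding arc_def by (intro dfb_intro dfb_node assms)
next
  case False
  \<comment> \<open>For \<open>i \<ge> n\<close> nothing is known about the definability of
    \<open>R i\<close>, but \<open>i + 2\<close> is then too large for the type of a copy, so the
    clause with \<open>R\<close> never applies.\<close>
  have "dfb (\<lambda>e. arc n (\<lambda>_ _ _ _. False) (s e) i (t e) j (u e))"
    unfolding arc_def by (intro dfb_intro dfb_node assms)
  also have "?this \<longleftrightarrow> ?thesis"
  proof (rule dfb_cong)
    fix e :: "nat \<Rightarrow> 'a" assume "range e \<subseteq> S"
    then show "arc n (\<lambda>_ _ _ _. False) (s e) i (t e) j (u e) = arc n R (s e) i (t e) j (u e)"
      using False not_in_self[OF dft_S[OF assms(1)]] by (auto simp: arc_def node_def)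
  qed
  finally show ?thesis .
qed

lemma sm_aset:
  assumes "A \<in> S"
  shows "sm {z \<in> S. \<exists>i<n+3. \<exists>j<n+3. \<exists>x\<in>S. \<exists>y\<in>S.
     z = pair D (vert i x) (vert j y) \<and> arc n R A i x j y}" (is "sm ?E")
proof (rule sm_subset)
  show "cl ?E" by (intro cl_comp dfb_intro dfb_arc dft_const assms)
  show "sm {pair D x y |x y. x \<in> el (vset n A) \<and> y \<in> el (vset n A)}"
    by (intro sm_times sm_el vset assms)
  show "?E \<subseteq> {pair D x y |x y. x \<in> el (vset n A) \<and> y \<in> el (vset n A)}"
    by (auto simp: vset(2)[OF assms] arc_def)
qed

lemma aset:
  assumes "A \<in> S"
  shows "aset n R A \<in> S"
    "z \<in> el (aset n R A) \<longleftrightarrow> (\<exists>i j x y. z = pair D (vert i x) (vert j y) \<and> arc n R A i x j y)"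
proof -
  show "aset n R A \<in> S" unfolding aset_def by (rule sm_mk[OF sm_aset[OF assms]])
  have n: "i < n + 3 \<and> j < n + 3 \<and> x \<in> S \<and> y \<in> S" if "arc n R A i x j y" for i j x y
    using that node_S[OF assms] by (auto simp: arc_def node_def)
  have "z \<in> el (aset n R A) \<longleftrightarrow> z \<in> S \<and> (\<exists>i<n+3. \<exists>j<n+3. \<exists>x\<in>S. \<exists>y\<in>S.
     z = pair D (vert i x) (vert j y) \<and> arc n R A i x j y)"
    unfolding aset_def sm_mk(2)[OF sm_aset[OF assms]] by simp
  also have "\<dots> \<longleftrightarrow> (\<exists>i j x y. z = pair D (vert i x) (vert j y) \<and> arc n R A i x j y)"
    using n vert_S pair_S by metis
  finally show "z \<in> el (aset n R A) \<longleftrightarrow>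
    (\<exists>i j x y. z = pair D (vert i x) (vert j y) \<and> arc n R A i x j y)" .
qed

lemma pair_aset:
  assumes "A \<in> S" "x \<in> S" "y \<in> S"
  shows "pair D (vert i x) (vert j y) \<in> el (aset n R A) \<longleftrightarrow> arc n R A i x j y"
proof
  assume "pair D (vert i x) (vert j y) \<in> el (aset n R A)"
  then obtain i' j' x' y' where *: "pair D (vert i x) (vert j y) = pair D (vert i' x') (vert j' y')"
      "arc n R A i' x' j' y'"
    using aset(2)[OF assms(1)] by blast
  then have "x' \<in> S" "y' \<in> S" using node_S[OF assms(1)] by (auto simp: arc_def)
  then show "arc n R A i x j y" using * assms by (simp add: pair_inject vert_S vert_inject)
qed (use aset(2)[OF assms(1)] in blast)

lemma graph_code:
  assumes "A \<in> S" shows "graph (vset n A) (aset n R A)"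
  unfolding graph_def
proof (intro conjI ballI vset(1) aset(1) assms)
  fix p assume "p \<in> el (aset n R A)"
  then obtain i j x y where "p = pair D (vert i x) (vert j y)" "node n A i x" "node n A j y"
    using aset(2)[OF assms] unfolding arc_def by blast
  then show "\<exists>x\<in>el (vset n A). \<exists>y\<in>el (vset n A). p = pair D x y"
    using vset(2)[OF assms] by blast
qed

text \<open>The core is mapped to the core, and identically because the map on its types is strictly
  increasing. The arcs into the core then fix the type of each copy. Arcs from type \<open>i\<close>
  to \<open>i + 1\<close> make all copies of one \<open>x\<close> move together, and arcs from
  \<open>i\<close> to \<open>i + 2\<close> carry the relations.\<close>

lemma code_hom:
  assumes AB: "A \<in> S" "B \<in> S"
    and h: "ghom h (vset n A) (aset n R A) (vset n B) (aset n R B)"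
  shows "\<exists>f. (\<forall>x\<in>el A. f x \<in> el B \<and> (\<forall>i<n+2. h (vert i x) = vert i (f x))) \<and>
    (\<forall>i\<le>n+2. h (vert i A) = vert i B) \<and>
    (\<forall>k<n. \<forall>x\<in>el A. \<forall>y\<in>el A. R k A x y \<longrightarrow> R k B (f x) (f y))"
proof -
  let ?m = "n + 2"
  note [simp] = not_in_self[OF AB(1)] not_in_self[OF AB(2)]
  define ty where "ty i x = (SOME p. h (vert i x) = vert (fst p) (snd p) \<and> node n B (fst p) (snd p))" for i x
  define t where "t i x = fst (ty i x)" for i x
  define g where "g i x = snd (ty i x)" for i x
  have hv: "h (vert i x) = vert (t i x) (g i x)" and hn: "node n B (t i x) (g i x)"
    if "node n A i x" for i x
  proof -
    have "vert i x \<in> el (vset n A)" using that vset(2)[OF AB(1)] by blast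
    then have "h (vert i x) \<in> el (vset n B)" using h by (simp add: ghom_def)
    then have "\<exists>p. h (vert i x) = vert (fst p) (snd p) \<and> node n B (fst p) (snd p)"
      using vset(2)[OF AB(2)] by auto
    from someI_ex[OF this] show "h (vert i x) = vert (t i x) (g i x)" "node n B (t i x) (g i x)"
      by (simp_all add: t_def g_def ty_def)
  qed
  have ha: "arc n R B (t i x) (g i x) (t j y) (g j y)" if a: "arc n R A i x j y" for i x j y
  proof -
    have n: "node n A i x" "node n A j y" using a by (auto simp: arc_def)
    have xy: "x \<in> S" "y \<in> S" "g i x \<in> S" "g j y \<in> S"
      using n hn node_S AB by blast+
    have "pair D (vert i x) (vert j y) \<in> el (aset n R A)"
      using a pair_aset[OF AB(1) xy(1,2)] by simp
    moreover have "vert i x \<in> el (vset n A)" "vert j y \<in> el (vset n A)"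
      using n vert_vset[OF AB(1)] xy by auto
    ultimately have "pair D (h (vert i x)) (h (vert j y)) \<in> el (aset n R B)"
      using h by (simp add: ghom_def)
    then show ?thesis using pair_aset[OF AB(2) xy(3,4)] hv n by simp
  qed
  have coreA: "node n A i A" if "i \<le> ?m" for i using that by (simp add: node_def)
  have core_arc: "arc n R A i A j A" if "i < j \<or> i = ?m \<and> j = 0" "i \<le> ?m" "j \<le> ?m" for i j
    using that coreA by (simp add: arc_def)
  define \<pi> where "\<pi> i = t i A" for i
  text \<open>Arcs never lead from the core to a copy and between copies they increase the type, so the
    closed walks lie in the core.\<close>
  have fwd: "y = B" if "arc n R B i B j y" for i j y using that by (auto simp: arc_def)
  have up: "i < j" if "arc n R B i x j y" "y \<noteq> B" for i x j y using that by (auto simp: arc_def)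
  have walk: "arc n R B (\<pi> 0) (g 0 A) (\<pi> i) (g i A) \<and> arc n R B (\<pi> i) (g i A) (\<pi> ?m) (g ?m A) \<and>
      arc n R B (\<pi> ?m) (g ?m A) (\<pi> 0) (g 0 A)" if "0 < i" "i < ?m" for i
    unfolding \<pi>_def using that by (intro conjI ha core_arc) auto
  have in_core: "g 0 A = B \<and> g i A = B \<and> g ?m A = B" if "0 < i" "i < ?m" for i
  proof (cases "g 0 A = B \<or> g i A = B \<or> g ?m A = B")
    case True
    then show ?thesis using walk[OF that] fwd by metis
  next
    case False
    then have "\<pi> 0 < \<pi> i" "\<pi> i < \<pi> ?m" "\<pi> ?m < \<pi> 0" using walk[OF that] up by blast+
    then show ?thesis by simp
  qed
  have gA: "g i A = B" if "i \<le> ?m" for i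
    using in_core[of i] in_core[of 1] that by (cases "i = 0 \<or> i = ?m") auto
  have \<pi>_le: "\<pi> i \<le> ?m" if "i \<le> ?m" for i
    using hn[OF coreA[OF that]] gA[OF that] by (simp add: \<pi>_def node_def)
  have \<pi>_arc: "\<pi> i < \<pi> j \<or> \<pi> i = ?m \<and> \<pi> j = 0" if "i < j \<or> i = ?m \<and> j = 0" "i \<le> ?m" "j \<le> ?m" for i j
    using ha[OF core_arc[OF that]] gA that by (simp add: \<pi>_def arc_def)
  \<comment> \<open>The arcs among 0, 1 and \<open>?m\<close> give
    \<open>\<pi> 0 < \<pi> ?m\<close>, so the arc from \<open>?m\<close> back to 0 must be mapped to
    the only descending arc of the core.\<close>
  have "\<pi> 0 = 0"
    using \<pi>_arc[of 0 1] \<pi>_arc[of 1 ?m] \<pi>_arc[of 0 ?m] \<pi>_arc[of ?m 0] by auto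
  then have mono: "\<pi> i < \<pi> j" if "i < j" "j \<le> ?m" for i j
    using \<pi>_arc[of i j] \<pi>_arc[of 0 j] that by auto
  \<comment> \<open>A strictly increasing map of \<open>{0..?m}\<close> into itself is the identity;
    \<open>ge\<close> and \<open>le\<close> are the two halves.\<close>
  have ge: "i \<le> \<pi> i" if "i \<le> ?m" for i
    using that
  proof (induction i)
    case (Suc i)
    then show ?case using mono[of i "Suc i"] by simp
  qed simp
  have le: "\<pi> (?m - k) \<le> ?m - k" if "k \<le> ?m" for k
    using that
  proof (induction k)
    case 0
    show ?case using \<pi>_le[of ?m] by simp
  next
    case (Suc k)
    have "?m - Suc k < ?m - k" using Suc.prems by simp
    then have "\<pi> (?m - Suc k) < \<pi> (?m - k)" by (rule mono) simp
    then show ?case using Suc by simp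
  qed
  have \<pi>_id: "\<pi> i = i" if "i \<le> ?m" for i
    using ge[OF that] le[of "?m - i"] that by simp
  have copy: "g i x \<in> el B \<and> g i x \<noteq> B \<and> t i x = i" if x: "x \<in> el A" and i: "i < ?m" for i x
  proof -
    have n: "node n A i x" using that by (simp add: node_def)
    \<comment> \<open>These two arcs exclude an image in the core: there only \<open>?m\<close>
      points to 0, and \<open>?m\<close> does not point to \<open>Suc i\<close>. The second arc then
      determines the type.\<close>
    have "arc n R A i x 0 A" "arc n R A i x (Suc i) A"
      using that n coreA by (auto simp: arc_def)
    from this[THEN ha] have "arc n R B (t i x) (g i x) 0 B" "arc n R B (t i x) (g i x) (Suc i) B"
      using gA \<pi>_id i by (simp_all add: \<pi>_def)
    then show ?thesis using i not_in_self[OF AB(2)] by (cases "g i x = B") (auto simp: arc_def)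
  qed
  have same: "g i x = g 0 x" if x: "x \<in> el A" and i: "i < ?m" for i x
    using i
  proof (induction i)
    case (Suc i)
    have "arc n R A i x (Suc i) x"
      using x Suc.prems by (simp add: arc_def node_def)
    from ha[OF this] have "g i x = g (Suc i) x"
      using copy[OF x, of i] copy[OF x, of "Suc i"] Suc.prems by (auto simp: arc_def)
    then show ?case using Suc by simp
  qed simp
  show ?thesis
  proof (intro exI[of _ "g 0"] conjI ballI allI impI)
    fix x assume x: "x \<in> el A"
    show "g 0 x \<in> el B" using copy[OF x, of 0] by simp
    fix i assume i: "i < ?m"
    then have "node n A i x" using x by (simp add: node_def)
    then show "h (vert i x) = vert i (g 0 x)" using hv copy[OF x i] same[OF x i] by simp
  next
    fix i assume "i \<le> ?m"
    then show "h (vert i A) = vert i B" using hv[OF coreA] gA \<pi>_id by (simp add: \<pi>_def)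
  next
    fix k x y assume k: "k < n" and x: "x \<in> el A" and y: "y \<in> el A" and R: "R k A x y"
    have "arc n R A k x (Suc (Suc k)) y" using k x y R by (simp add: arc_def node_def)
    from ha[OF this] show "R k B (g 0 x) (g 0 y)"
      using copy[OF x, of k] copy[OF y, of "Suc (Suc k)"] same[OF x, of k]
        same[OF y, of "Suc (Suc k)"] k by (auto simp: arc_def)
  qed
qed

lemma dft_code: "dft (\<lambda>e. pair D (vset n (e i)) (aset n R (e i)))"
proof (rule dft_pair)
  show "dft (\<lambda>e. vset n (e i))"
    unfolding vset_def
  proof (rule dft_mk)
    have "dfb (\<lambda>e. \<exists>j<n+3. \<exists>x\<in>S. e 0 = vert j x \<and> node n (e (Suc i)) j x)"
      by (intro dfb_intro dfb_node)
    also have "?this \<longleftrightarrow> dfb (\<lambda>e. e 0 \<in> {z \<in> S. \<exists>j<n+3. \<exists>x\<in>S. z = vert j x \<and> node n (e (Suc i)) j x})"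
      by (rule dfb_cong) auto
    finally show "dfb (\<lambda>e. e 0 \<in> {z \<in> S. \<exists>j<n+3. \<exists>x\<in>S. z = vert j x \<and> node n (e (Suc i)) j x})" .
  qed (intro sm_vset, auto)
  show "dft (\<lambda>e. aset n R (e i))"
    unfolding aset_def
  proof (rule dft_mk)
    have "dfb (\<lambda>e. \<exists>j<n+3. \<exists>k<n+3. \<exists>x\<in>S. \<exists>y\<in>S.
     e 0 = pair D (vert j x) (vert k y) \<and> arc n R (e (Suc i)) j x k y)"
      by (intro dfb_intro dfb_arc)
    also have "?this \<longleftrightarrow> dfb (\<lambda>e. e 0 \<in> {z \<in> S. \<exists>j<n+3. \<exists>k<n+3. \<exists>x\<in>S. \<exists>y\<in>S.
     z = pair D (vert j x) (vert k y) \<and> arc n R (e (Suc i)) j x k y})"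
      by (rule dfb_cong) auto
    finally show "dfb (\<lambda>e. e 0 \<in> {z \<in> S. \<exists>j<n+3. \<exists>k<n+3. \<exists>x\<in>S. \<exists>y\<in>S.
     z = pair D (vert j x) (vert k y) \<and> arc n R (e (Suc i)) j x k y})" .
  qed (intro sm_aset, auto)
qed

lemma vset_inject:
  assumes "A \<in> S" "B \<in> S" "vset n A = vset n B" shows "A = B"
proof -
  have "node n A i x \<longleftrightarrow> node n B i x" if "x \<in> S" for i x
    using vert_vset assms that by metis
  from this[of A "n + 2"] show ?thesis using assms by (auto simp: node_def)
qed

text \<open>The coding is injective, so a proper class of sets gives a proper class of graphs. A
  homomorphism that is the identity on the members of \<open>A\<close> also fixes the core, hence is
  the identity of the graph. The set \<open>H\<close> is read off from the copies of type 0 and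
  makes statements about \<open>f\<close> definable.\<close>

theorem vopenka_structures:
  assumes vp: "vp D" and X: "cl X" "\<not> sm X"
  obtains A B f H where "A \<in> X" "B \<in> X" "H \<in> S" "fun_on H A f B"
    "\<And>k x y. k < n \<Longrightarrow> x \<in> el A \<Longrightarrow> y \<in> el A \<Longrightarrow> R k A x y \<Longrightarrow> R k B (f x) (f y)"
    "A \<noteq> B \<or> (\<exists>x\<in>el A. f x \<noteq> x)"
proof -
  define G where "G A = pair D (vset n A) (aset n R A)" for A
  have dG: "dft (\<lambda>e. G (e i))" for i unfolding G_def by (rule dft_code)
  have XS: "A \<in> S" if "A \<in> X" for A using that X(1) el_S by (auto simp: cl_def)
  have G_inj: "A = B" if "A \<in> S" "B \<in> S" "G A = G B" for A B
  proof -
    have "vset n A = vset n B"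
      using that(3) pair_inject[OF vset(1)[OF that(1)] aset(1)[OF that(1)]
        vset(1)[OF that(2)] aset(1)[OF that(2)]] unfolding G_def by blast
    then show ?thesis by (rule vset_inject[OF that(1,2)])
  qed
  define C where "C = {g \<in> S. \<exists>A\<in>S. A \<in> X \<and> g = G A}"
  have "cl C" unfolding C_def by (intro cl_comp dfb_intro dfb_cl X dG)
  then obtain c where c: "c \<in> D" "el c = C" by (auto simp: cl_def)
  have "\<not> sm C"
  proof
    assume "sm C"
    then obtain c where c: "c \<in> S" "el c = C" by (rule smE)
    have "sm {A \<in> S. \<exists>g\<in>el c. A \<in> X \<and> g = G A}"
      by (rule class_function_image[OF c(1)]) (auto intro!: dfb_intro dfb_cl X dG dest: G_inj)
    also have "{A \<in> S. \<exists>g\<in>el c. A \<in> X \<and> g = G A} = X"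
      using c(2) XS dft_S[OF dG[of 0], of "\<lambda>_. A" for A] by (auto simp: C_def image_subset_iff)
    finally show False using X(2) by simp
  qed
  then have "\<not> st D c" using c by (auto simp: sm_def St_def)
  moreover have "gr D g" if "g \<in> D" "g \<epsilon> c" for g
  proof -
    have "g \<in> C" using that c by (auto simp: els_def)
    then show ?thesis unfolding gr_iff[OF that(1)] using graph_code XS by (auto simp: C_def G_def)
  qed
  ultimately obtain g g' h where g: "g \<in> D" "g' \<in> D" "g \<epsilon> c" "g' \<epsilon> c" and
    h: "h \<in> D" "st D h" "hom D h g g'" "\<not> ident D h g g'"
    using vp[unfolded vp_def, rule_format, OF c(1)] by blast
  then have "g \<in> C" "g' \<in> C" using c by (auto simp: els_def)
  then obtain A B where A: "A \<in> X" "g = G A" and B: "B \<in> X" "g' = G B" by (auto simp: C_def)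
  have AB: "A \<in> S" "B \<in> S" using A B XS by auto
  note gA = graph_code[OF AB(1)] and gB = graph_code[OF AB(2)]
  obtain k where k: "fun_on h (vset n A) k (vset n B)"
      "ghom k (vset n A) (aset n R A) (vset n B) (aset n R B)"
    using h(3) hom_iff[OF gA gB h(1)] A B by (auto simp: G_def)
  from code_hom[OF AB k(2)] obtain f where
    f: "\<And>x. x \<in> el A \<Longrightarrow> f x \<in> el B" "\<And>x i. x \<in> el A \<Longrightarrow> i < n + 2 \<Longrightarrow> k (vert i x) = vert i (f x)"
    and core: "\<And>i. i \<le> n + 2 \<Longrightarrow> k (vert i A) = vert i B"
    and R: "\<And>k x y. k < n \<Longrightarrow> x \<in> el A \<Longrightarrow> y \<in> el A \<Longrightarrow> R k A x y \<Longrightarrow> R k B (f x) (f y)" by blast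
  have hS: "h \<in> S" using h by (simp add: St_def)
  have "A \<noteq> B \<or> (\<exists>x\<in>el A. f x \<noteq> x)"
  proof (rule ccontr)
    assume "\<not> ?thesis"
    then have id: "A = B" "\<And>x. x \<in> el A \<Longrightarrow> f x = x" by auto
    have "k z = z" if zV: "z \<in> el (vset n A)" for z
    proof -
      obtain i x where z: "z = vert i x" "node n A i x" using zV vset(2)[OF AB(1)] by blast
      then show ?thesis using id f core by (auto simp: node_def)
    qed
    then have "ident D h g g'"
      using ident_iff[OF gA gB h(1) k] A B id(1) by (simp add: G_def)
    with h(4) show False by simp
  qed
  moreover
  define W where "W = {z \<in> {pair D x y |x y. x \<in> el A \<and> y \<in> el B}.
    \<exists>x\<in>S. \<exists>y\<in>S. z = pair D x y \<and> pair D (vert 0 x) (vert 0 y) \<in> el h}"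
  have "sm W"
    unfolding W_def
    by (rule sm_sep[OF sm_times[OF sm_el[OF AB(1)] sm_el[OF AB(2)]]])
      (intro dfb_intro dft_const hS)
  then obtain H where H: "H \<in> S" "el H = W" by (rule smE)
  have "fun_on H A f B"
    unfolding fun_on_def
  proof
    have key: "pair D (vert 0 x) (vert 0 y) \<in> el h \<longleftrightarrow> y = f x" if "x \<in> el A" "y \<in> S" for x y
    proof -
      have x: "x \<in> S" "f x \<in> S" using that f(1) el_SS AB by blast+
      have v: "vert 0 x \<in> el (vset n A)"
        using vert_vset[OF AB(1) x(1)] that(1) by (simp add: node_def)
      show ?thesis
        using fun_on_iff[OF k(1) vset(1)[OF AB(1)] vset(1)[OF AB(2)] vert_S[OF x(1), of 0]
            vert_S[OF that(2), of 0]] v f(2)[OF that(1), of 0] vert_inject[OF that(2) x(2), of 0 0]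
        by simp
    qed
    show "el H = {pair D x (f x) |x. x \<in> el A}"
    proof
      show "el H \<subseteq> {pair D x (f x) |x. x \<in> el A}"
      proof
        fix z assume "z \<in> el H"
        then obtain x y x' y' where *: "z = pair D x' y'" "x' \<in> el A" "y' \<in> el B" "x \<in> S" "y \<in> S"
            "z = pair D x y" "pair D (vert 0 x) (vert 0 y) \<in> el h"
          using H(2) by (auto simp: W_def)
        then have "x' \<in> S" "y' \<in> S" using el_SS AB by blast+
        then have "x = x'" "y = y'" using * pair_inject by metis+
        then show "z \<in> {pair D x (f x) |x. x \<in> el A}" using * key by blast
      qed
      show "{pair D x (f x) |x. x \<in> el A} \<subseteq> el H"
      proof
        fix z assume "z \<in> {pair D x (f x) |x. x \<in> el A}"
        then obtain x where x: "x \<in> el A" "z = pair D x (f x)" by blast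
        then have "x \<in> S" "f x \<in> S" "f x \<in> el B" using f(1) el_SS AB by blast+
        then show "z \<in> el H" using key[OF x(1)] x H(2) by (auto simp: W_def)
      qed
    qed
  qed (use f in blast)
  ultimately show thesis using that[of A B H f] A(1) B(1) H(1) R by blast
qed

end

end

definition (in membership) sub :: "'a set \<Rightarrow> 'a \<Rightarrow> 'a set" where
  "sub D u = {x \<in> D. els D x \<subseteq> els D u}"

context gb
begin

subsection \<open>The classes over a set\<close>

lemma sub_D: "x \<in> sub D u \<Longrightarrow> x \<in> D"
  by (simp add: sub_def)

lemma subset_set:
  assumes "x \<in> D" "u \<in> S" "el x \<subseteq> el u" shows "x \<in> S"
proof -
  have "sm (el x)" using sm_subset[OF cl_el[OF assms(1)] assms(3) sm_el[OF assms(2)]] .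
  then obtain y where "y \<in> S" "el y = el x" by (rule smE)
  then show ?thesis using el_inject S_D assms(1) by metis
qed

lemma sub_iff: "u \<in> S \<Longrightarrow> x \<in> sub D u \<longleftrightarrow> x \<in> S \<and> el x \<subseteq> el u"
  using subset_set S_D by (auto simp: sub_def)

lemma self_sub: "u \<in> S \<Longrightarrow> u \<in> sub D u"
  using sub_iff by blast

text \<open>Replaces all odd-numbered set variables by parameters at once; an environment of a
  formula over \<open>sub D u\<close> provides infinitely many of them.\<close>

lemma dfb_param:
  assumes "dfb P" "range c \<subseteq> S" shows "dfb (\<lambda>e. P (ilv e c))"
proof -
  from assms obtain p d where d: "range d \<subseteq> D"
    and p: "\<And>e. range e \<subseteq> S \<Longrightarrow> P e = sat D E (ilv e d) (set_rel p)" by (auto simp: dfb_def)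
  define s where "s i = (if even i then if even (i div 2) then i div 2 else Suc (2 * (2 * (i div 2 div 2)))
      else Suc (2 * Suc (2 * (i div 2))))" for i :: nat
  have 1: "(\<lambda>i. ilv e (ilv c d) (s i)) = ilv (ilv e c) d" for e
  proof
    fix i :: nat
    show "ilv e (ilv c d) (s i) = ilv (ilv e c) d i"
    proof (cases "even i")
      case True
      then obtain k where k: "i = 2 * k" by (auto elim: evenE)
      show ?thesis
      proof (cases "even k")
        case True
        then obtain l where "k = 2 * l" by (auto elim: evenE)
        then show ?thesis using k by (simp add: s_def ilv_def)
      next
        case False
        then obtain l where "k = Suc (2 * l)" by (auto elim: oddE)
        then show ?thesis using k by (simp add: s_def ilv_def)
      qed
    next
      case False
      then obtain k where "i = Suc (2 * k)" by (auto elim: oddE)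
      then show ?thesis by (simp add: s_def ilv_def)
    qed
  qed
  show ?thesis
  proof (rule dfbI)
    show "range (ilv c d) \<subseteq> D" using d assms(2) S_D by (auto simp: ilv_def)
    fix e :: "nat \<Rightarrow> 'a" assume "range e \<subseteq> S"
    then have "range (ilv e c) \<subseteq> S" using assms(2) by (auto simp: ilv_def)
    then show "P (ilv e c) = sat D E (ilv e (ilv c d)) (set_rel (ren s p))"
      by (simp add: p set_rel_ren sat_ren 1)
  qed
qed

text \<open>Induction on \<open>p\<close> in the metatheory. The classes over \<open>u\<close> are
  sets of the large model, so even class quantifiers of \<open>p\<close> turn into set quantifiers
  and the result is predicative.\<close>

lemma dfb_sat: "dfb (\<lambda>e. sat (sub D (e u)) E (\<lambda>k. e (v k)) p)"
proof (induction p arbitrary: u v)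
  case (Mem i j)
  have "dfb (\<lambda>e. e (v i) \<in> el (e (v j)))" by (intro dfb_intro)
  also have "?this \<longleftrightarrow> dfb (\<lambda>e. sat (sub D (e u)) E (\<lambda>k. e (v k)) (Mem i j))"
  proof (rule dfb_cong)
    fix e :: "nat \<Rightarrow> 'a" assume "range e \<subseteq> S"
    then have "e (v i) \<in> D" using S_D by blast
    then show "(e (v i) \<in> el (e (v j))) = sat (sub D (e u)) E (\<lambda>k. e (v k)) (Mem i j)"
      using mem_el by simp
  qed
  finally show ?case .
next
  case (All p)
  have "dfb (\<lambda>e. \<forall>x\<in>S. el x \<subseteq> el (e u) \<longrightarrow> sat (sub D (e u)) E (case_nat x (\<lambda>k. e (v k))) p)"
  proof (rule dfb_all, rule dfb_imp)
    show "dfb (\<lambda>e. el (e 0) \<subseteq> el (e (Suc u)))" by (intro dfb_intro)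
    have "(\<lambda>k. e (case_nat 0 (\<lambda>k. Suc (v k)) k)) = case_nat (e 0) (\<lambda>k. e (Suc (v k)))"
      for e :: "nat \<Rightarrow> 'a"
      by (auto simp: fun_eq_iff split: nat.split)
    then show "dfb (\<lambda>e. sat (sub D (e (Suc u))) E (case_nat (e 0) (\<lambda>k. e (Suc (v k)))) p)"
      using All[of "Suc u" "case_nat 0 (\<lambda>k. Suc (v k))"] by simp
  qed
  also have "?this \<longleftrightarrow> dfb (\<lambda>e. sat (sub D (e u)) E (\<lambda>k. e (v k)) (All p))"
  proof (rule dfb_cong)
    fix e :: "nat \<Rightarrow> 'a" assume "range e \<subseteq> S"
    then have "e u \<in> S" by blast
    then show "(\<forall>x\<in>S. el x \<subseteq> el (e u) \<longrightarrow> sat (sub D (e u)) E (case_nat x (\<lambda>k. e (v k))) p) =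
      sat (sub D (e u)) E (\<lambda>k. e (v k)) (All p)"
      using sub_iff by auto
  qed
  finally show ?case .
qed (auto intro!: dfb_intro)

lemma dfb_sat_const:
  assumes "u \<in> S" "range c \<subseteq> S"
  shows "dfb (\<lambda>e. sat (sub D u) E (case_nat (e 0) c) p)"
proof -
  define v where "v = case_nat 0 (\<lambda>k. Suc (2 * Suc k))"
  have "(\<lambda>k. ilv e (case_nat u c) (v k)) = case_nat (e 0) c" for e
    by (auto simp: fun_eq_iff v_def ilv_def split: nat.split)
  then show ?thesis
    using dfb_param[OF dfb_sat[of 1 v p] range_case_nat[OF assms]] by simp
qed

context
  fixes u assumes u: "u \<in> S" and tr: "\<forall>x\<in>el u. el x \<subseteq> el u"
begin

lemma trans_sub_mem: "x \<in> el u \<Longrightarrow> x \<in> sub D u"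
  using sub_iff[OF u] el_SS[OF _ u] tr by blast

lemma trans_els_sub: "x \<in> sub D u \<Longrightarrow> els (sub D u) x = el x"
  using trans_sub_mem sub_iff[OF u] sub_D unfolding els_def by blast

lemma trans_mem_sub: "x \<in> sub D u \<Longrightarrow> y \<in> sub D u \<Longrightarrow> y \<epsilon> x \<longleftrightarrow> y \<in> el x"
  using mem_el sub_D by blast

lemma trans_st_sub: "x \<in> sub D u \<Longrightarrow> st (sub D u) x \<longleftrightarrow> x \<in> el u"
  unfolding st_def using self_sub[OF u] trans_mem_sub sub_iff[OF u] by blast

lemma trans_St_sub: "St (sub D u) = el u"
  unfolding St_def using trans_st_sub trans_sub_mem by blast

text \<open>The instance defines a subset of \<open>u\<close>, and this is a set because
  satisfaction over \<open>u\<close> is definable. Thus the infinite schema comes for free.\<close>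

lemma comprehension_sub:
  assumes "range e \<subseteq> sub D u" shows "sat (sub D u) E e (comprehension p)"
  unfolding sat_comprehension[OF assms]
proof (intro allI impI)
  fix e :: "nat \<Rightarrow> 'a" assume e: "range e \<subseteq> sub D u"
  then have eS: "range e \<subseteq> S" using sub_iff[OF u] by blast
  have "sm {x \<in> el u. sat (sub D u) E (case_nat x e) (set_rel p)}"
    by (rule sm_sep[OF sm_el[OF u] dfb_sat_const[OF u eS]])
  then obtain X where X: "X \<in> S" "el X = {x \<in> el u. sat (sub D u) E (case_nat x e) (set_rel p)}"
    by (rule smE)
  then have XU: "X \<in> sub D u" using sub_iff[OF u] by blast
  show "\<exists>X\<in>sub D u. \<forall>x\<in>sub D u. x \<epsilon> X \<longleftrightarrow>
      st (sub D u) x \<and> sat (sub D u) E (case_nat x e) (set_rel p)"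
    using XU X(2) trans_mem_sub[OF XU] trans_st_sub by (intro bexI[of _ X]) auto
qed

end

section \<open>Ordinals inside a model\<close>

definition ord :: "'a \<Rightarrow> bool" where
  "ord a \<longleftrightarrow> (\<forall>x\<in>el a. el x \<subseteq> el a) \<and>
    (\<forall>x\<in>el a. \<forall>y\<in>el a. x \<in> el y \<or> x = y \<or> y \<in> el x)"

lemma dfb_ord [dfb_intro]: "dft t \<Longrightarrow> dfb (\<lambda>e. ord (t e))"
proof (rule dfb_app1)
  show "dfb (\<lambda>e. ord (e i))" for i unfolding ord_def by (intro dfb_intro)
qed

text \<open>By linearity in \<open>a\<close>, a member \<open>y\<close> of a member of
  \<open>b\<close> is comparable with \<open>b\<close>; regularity excludes the membership cycles of
  length two and three that the wrong cases would produce.\<close>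

lemma ord_mem:
  assumes "ord a" "a \<in> S" "b \<in> el a" shows "ord b"
  unfolding ord_def
proof (intro conjI ballI subsetI)
  fix x y assume x: "x \<in> el b" and y: "y \<in> el x"
  have S: "b \<in> S" "x \<in> S" "y \<in> S" using assms x y el_SS by blast+
  have a: "x \<in> el a" "y \<in> el a" using assms x y unfolding ord_def by blast+
  have "y \<in> el b \<or> y = b \<or> b \<in> el y" using assms a unfolding ord_def by blast
  moreover have "y \<noteq> b"
  proof
    assume "y = b"
    have "sm {b, x}" using S by (intro sm_pair)
    from regularity[OF sm_cl[OF this]] show False using x y \<open>y = b\<close> by auto
  qed
  moreover have "b \<notin> el y"
  proof
    assume "b \<in> el y"
    have "sm {b, x, y}" using S by (intro sm_insert sm_pair)
    from regularity[OF sm_cl[OF this]] show False using x y \<open>b \<in> el y\<close> by auto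
  qed
  ultimately show "y \<in> el b" by blast
qed (use assms in \<open>unfold ord_def, blast\<close>)

text \<open>The intersection of the two ordinals equals each of them or is a member of it, and it
  cannot be a member of both.\<close>

lemma ord_linear:
  assumes "ord a" "a \<in> S" "ord b" "b \<in> S"
  shows "a \<in> el b \<or> a = b \<or> b \<in> el a"
proof -
  have "sm (el a \<inter> el b)" by (rule sm_restrict[OF assms(4,2)])
  then obtain c where c: "c \<in> S" "el c = el a \<inter> el b" by (rule smE)
  have key: "c = d \<or> c \<in> el d" if d: "ord d" "d \<in> S" "el c \<subseteq> el d"
    and tr: "\<And>x. x \<in> el c \<Longrightarrow> el x \<subseteq> el c" for d
  proof (cases "el d \<subseteq> el c")
    case True
    then have "el c = el d" using that by auto
    then show ?thesis using el_inject S_D c(1) d(2) by auto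
  next
    case False
    have "sm {x \<in> el d. x \<notin> el c}" by (intro sm_sep sm_el dfb_intro dft_const d c)
    then obtain x where x: "x \<in> {x \<in> el d. x \<notin> el c}" "el x \<inter> {x \<in> el d. x \<notin> el c} = {}"
      using regularity[OF sm_cl] False by (metis (no_types, lifting) empty_iff mem_Collect_eq subsetI)
    have "el x \<subseteq> el c" using x d(1) unfolding ord_def by blast
    moreover have "el c \<subseteq> el x"
    proof
      fix y assume y: "y \<in> el c"
      then have "y \<in> el x \<or> y = x \<or> x \<in> el y" using x d unfolding ord_def by blast
      then show "y \<in> el x" using y x tr[OF y] by blast
    qed
    ultimately have "el x = el c" by blast
    moreover have "x \<in> S" using x d(2) el_SS by blast
    ultimately have "x = c" using el_inject S_D c(1) by blast
    then show ?thesis using x by auto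
  qed
  have tr: "el x \<subseteq> el c" if "x \<in> el c" for x
    using that c assms unfolding ord_def by blast
  have "c = a \<or> c \<in> el a" "c = b \<or> c \<in> el b"
    using key[of a] key[of b] tr assms c by auto
  moreover have "\<not> (c \<in> el a \<and> c \<in> el b)" using c not_in_self by blast
  ultimately show ?thesis by blast
qed

section \<open>Limit levels and Grothendieck universes\<close>

definition limlev :: "'a \<Rightarrow> bool" where
  "limlev u \<longleftrightarrow> lev u \<and> (\<forall>x\<in>el u. \<exists>p\<in>el u. \<forall>y\<in>S. y \<in> el p \<longleftrightarrow> el y \<subseteq> el x)"

definition ind_set :: "'a \<Rightarrow> bool" where
  "ind_set I \<longleftrightarrow> (\<exists>z\<in>el I. \<forall>y\<in>S. y \<notin> el z) \<and>
    (\<forall>x\<in>el I. \<exists>y\<in>el I. \<forall>w\<in>S. w \<in> el y \<longleftrightarrow> w \<in> el x \<or> w = x)"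

definition func :: "'a \<Rightarrow> bool" where
  "func F \<longleftrightarrow> (\<forall>x\<in>S. \<forall>y\<in>S. \<forall>z\<in>S. pair D x y \<in> el F \<and> pair D x z \<in> el F \<longrightarrow> y = z)"

text \<open>Replacement is split into a relation between \<open>F\<close> and its domain and a
  relation between \<open>F\<close> and \<open>u\<close> (\<open>ran_in\<close>), because the graph
  coding handles binary relations.\<close>

definition fdom :: "'a \<Rightarrow> 'a \<Rightarrow> bool" where
  "fdom F d \<longleftrightarrow> func F \<and> (\<forall>x\<in>S. x \<in> el d \<longleftrightarrow> (\<exists>y\<in>S. pair D x y \<in> el F))"

definition ran_in :: "'a \<Rightarrow> 'a \<Rightarrow> bool" where
  "ran_in F u \<longleftrightarrow> (\<exists>r\<in>el u. \<forall>y\<in>S. y \<in> el r \<longleftrightarrow> (\<exists>x\<in>S. pair D x y \<in> el F))"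

definition univ :: "'a \<Rightarrow> bool" where
  "univ u \<longleftrightarrow> limlev u \<and> (\<exists>I\<in>el u. ind_set I) \<and>
    (\<forall>F\<in>S. \<forall>d\<in>el u. el F \<subseteq> el u \<and> fdom F d \<longrightarrow> ran_in F u)"

lemma dfb_ind_set [dfb_intro]: "dft t \<Longrightarrow> dfb (\<lambda>e. ind_set (t e))"
proof (rule dfb_app1)
  show "dfb (\<lambda>e. ind_set (e i))" for i unfolding ind_set_def by (intro dfb_intro)
qed

lemma dfb_func [dfb_intro]: "dft t \<Longrightarrow> dfb (\<lambda>e. func (t e))"
proof (rule dfb_app1)
  show "dfb (\<lambda>e. func (e i))" for i unfolding func_def by (intro dfb_intro)
qed

lemma dfb_fdom [dfb_intro]: "dft s \<Longrightarrow> dft t \<Longrightarrow> dfb (\<lambda>e. fdom (s e) (t e))"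
proof (rule dfb_app2)
  show "dfb (\<lambda>e. fdom (e i) (e j))" for i j unfolding fdom_def by (intro dfb_intro)
qed

lemma dfb_ran_in [dfb_intro]: "dft s \<Longrightarrow> dft t \<Longrightarrow> dfb (\<lambda>e. ran_in (s e) (t e))"
proof (rule dfb_app2)
  show "dfb (\<lambda>e. ran_in (e i) (e j))" for i j unfolding ran_in_def by (intro dfb_intro)
qed

lemma dfb_univ [dfb_intro]: "dft t \<Longrightarrow> dfb (\<lambda>e. univ (t e))"
proof (rule dfb_app1)
  show "dfb (\<lambda>e. univ (e i))" for i unfolding univ_def limlev_def by (intro dfb_intro)
qed

context
  fixes u assumes u: "limlev u" "u \<in> S"
begin

lemma limlev_lev: "lev u"
  using u by (simp add: limlev_def)

lemma limlev_subset: "x \<in> el u \<Longrightarrow> y \<in> S \<Longrightarrow> el y \<subseteq> el x \<Longrightarrow> y \<in> el u"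
  by (rule lev_subset_mem[OF limlev_lev u(2)])

lemma limlev_trans: "x \<in> el u \<Longrightarrow> el x \<subseteq> el u"
  by (rule lev_trans[OF limlev_lev u(2)])

lemma limlev_S: "x \<in> el u \<Longrightarrow> x \<in> S"
  using u(2) el_SS by blast

lemma limlev_pow:
  assumes "x \<in> el u" shows "mk D {y \<in> S. el y \<subseteq> el x} \<in> el u"
proof -
  obtain p where p: "p \<in> el u" "\<forall>y\<in>S. y \<in> el p \<longleftrightarrow> el y \<subseteq> el x"
    using u(1) assms unfolding limlev_def by blast
  then have "el p = {y \<in> S. el y \<subseteq> el x}" using limlev_S el_SS by blast
  then have "mk D {y \<in> S. el y \<subseteq> el x} = p" using mk_eq p(1) limlev_S S_D by blast
  with p(1) show ?thesis by simp
qed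

lemma el_pow: "x \<in> S \<Longrightarrow> el (mk D {y \<in> S. el y \<subseteq> el x}) = {y \<in> S. el y \<subseteq> el x}"
  by (rule sm_mk(2)[OF sm_Pow])

lemma limlev_level: "x \<in> el u \<Longrightarrow> \<exists>r\<in>el u. lev r \<and> el x \<subseteq> el r"
  using lev_mem_iff[OF limlev_lev u(2)] limlev_S by blast

lemma limlev_common:
  assumes "x \<in> el u" "y \<in> el u"
  shows "\<exists>r\<in>el u. lev r \<and> el x \<subseteq> el r \<and> el y \<subseteq> el r"
proof -
  obtain r where "r \<in> el u" "lev r" "el x \<subseteq> el r" using limlev_level[OF assms(1)] by blast
  moreover obtain s where "s \<in> el u" "lev s" "el y \<subseteq> el s" using limlev_level[OF assms(2)] by blast
  ultimately have rs: "r \<in> el u" "lev r" "el x \<subseteq> el r" "s \<in> el u" "lev s" "el y \<subseteq> el s" .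
  then have S: "r \<in> S" "s \<in> S" using limlev_S by auto
  have "el r \<subseteq> el s \<or> el s \<subseteq> el r"
    using lev_linear[OF rs(2) S(1) rs(5) S(2)] lev_trans[OF rs(5) S(2), of r]
      lev_trans[OF rs(2) S(1), of s] by auto
  then show ?thesis using rs by blast
qed

lemma limlev_pair_set:
  assumes "x \<in> el u" "y \<in> el u" shows "mk D {x, y} \<in> el u"
proof -
  obtain r where r: "r \<in> el u" "el x \<subseteq> el r" "el y \<subseteq> el r" using limlev_common[OF assms] by blast
  have S: "x \<in> S" "y \<in> S" "r \<in> S" using assms r limlev_S by auto
  have "el (mk D {x, y}) \<subseteq> el (mk D {y \<in> S. el y \<subseteq> el r})"
    unfolding el_pow[OF S(3)] sm_mk(2)[OF sm_pair[OF S(1,2)]] using r S by blast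
  then show ?thesis
    using limlev_subset[OF limlev_pow[OF r(1)]] sm_mk(1)[OF sm_pair[OF S(1,2)]] by blast
qed

lemma limlev_pair:
  assumes "x \<in> el u" "y \<in> el u" shows "pair D x y \<in> el u"
  unfolding pair_def using limlev_pair_set[OF assms] limlev_pair_set[of x x] assms
  by (intro limlev_pair_set) auto

lemma limlev_pairD:
  assumes "pair D x y \<in> el u" "x \<in> S" "y \<in> S" shows "x \<in> el u \<and> y \<in> el u"
proof -
  note P = pair_parts[OF assms(2,3)]
  have "mk D {x, y} \<in> el u" using limlev_trans[OF assms(1)] P(6) by blast
  then show ?thesis using limlev_trans P(4) by blast
qed

lemma limlev_union:
  assumes "x \<in> el u" shows "mk D (\<Union>y\<in>el x. el y) \<in> el u"
proof -
  obtain r where r: "r \<in> el u" "lev r" "el x \<subseteq> el r" using limlev_level[OF assms] by blast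
  have S: "x \<in> S" "r \<in> S" using assms r limlev_S by auto
  have "el (mk D (\<Union>y\<in>el x. el y)) \<subseteq> el r"
    unfolding sm_mk(2)[OF sm_Union[OF S(1)]] using lev_trans[OF r(2) S(2)] r(3) by blast
  then show ?thesis using limlev_subset[OF r(1)] sm_mk(1)[OF sm_Union[OF S(1)]] by blast
qed

text \<open>Kuratowski pairs of members of \<open>r\<close> belong to the second power set of
  \<open>r\<close>, and \<open>u\<close> is closed under power sets and subsets of members.\<close>

lemma limlev_times:
  assumes "x \<in> el u" "y \<in> el u" "z \<in> S" "el z \<subseteq> {pair D v w |v w. v \<in> el x \<and> w \<in> el y}"
  shows "z \<in> el u"
proof -
  obtain r where r: "r \<in> el u" "el x \<subseteq> el r" "el y \<subseteq> el r" using limlev_common[OF assms(1,2)] by blast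
  define P where "P x = mk D {y \<in> S. el y \<subseteq> el x}" for x
  have PP: "P r \<in> el u" "P (P r) \<in> el u" using r(1) by (auto simp: P_def intro: limlev_pow)
  have elP: "el (P x) = {y \<in> S. el y \<subseteq> el x}" if "x \<in> S" for x
    unfolding P_def using that by (rule el_pow)
  have "el z \<subseteq> el (P (P r))"
  proof
    fix p assume "p \<in> el z"
    then obtain v w where vw: "p = pair D v w" "v \<in> el r" "w \<in> el r" using assms(4) r by blast
    have rS: "r \<in> S" "v \<in> S" "w \<in> S" using r(1) vw limlev_S el_SS by blast+
    note Q = pair_parts[OF rS(2,3)]
    have "mk D {v} \<in> el (P r)" "mk D {v, w} \<in> el (P r)" using elP[OF rS(1)] Q vw by auto
    then show "p \<in> el (P (P r))" using elP[OF limlev_S[OF PP(1)]] Q vw(1) by auto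
  qed
  then show ?thesis by (rule limlev_subset[OF PP(2) assms(3)])
qed

lemma limlev_succ:
  assumes "x \<in> el u" shows "mk D (insert x (el x)) \<in> el u"
proof -
  obtain r where r: "r \<in> el u" "lev r" "el x \<subseteq> el r" using limlev_level[OF assms] by blast
  have S: "x \<in> S" "r \<in> S" using assms r limlev_S by auto
  have sm: "sm (insert x (el x))" using S by (intro sm_insert sm_el)
  have "el (mk D (insert x (el x))) \<subseteq> el (mk D {y \<in> S. el y \<subseteq> el r})"
    unfolding el_pow[OF S(2)] sm_mk(2)[OF sm]
    using r(3) S lev_trans[OF r(2) S(2)] el_SS[OF _ S(1)] by blast
  then show ?thesis using limlev_subset[OF limlev_pow[OF r(1)]] sm_mk(1)[OF sm] by blast
qed

lemma limlev_transitive: "\<forall>x\<in>el u. el x \<subseteq> el u"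
  using limlev_trans by blast

lemmas sub_mem = trans_sub_mem[OF u(2) limlev_transitive]
lemmas mem_sub = trans_mem_sub[OF u(2) limlev_transitive]
lemmas els_sub = trans_els_sub[OF u(2) limlev_transitive]
lemmas st_sub = trans_st_sub[OF u(2) limlev_transitive]

text \<open>Pairing is absolute, because the two sets inside a Kuratowski pair stay in
  \<open>u\<close>.\<close>

lemma pr_sub:
  assumes "p \<in> sub D u" "x \<in> sub D u" "y \<in> sub D u"
  shows "pr (sub D u) p x y \<longleftrightarrow> x \<in> el u \<and> y \<in> el u \<and> p = pair D x y"
proof -
  have upr: "upr (sub D u) q z w \<longleftrightarrow> el q = {z, w}"
    if "q \<in> sub D u" "z \<in> sub D u" "w \<in> sub D u" for q z w
  proof -
    have "upr (sub D u) q z w \<longleftrightarrow> (\<forall>t\<in>sub D u. t \<in> el q \<longleftrightarrow> t = z \<or> t = w)"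
      unfolding upr_def using mem_sub that(1) by blast
    also have "\<dots> \<longleftrightarrow> el q = {z, w}"
      using that sub_iff[OF u(2)] sub_mem by blast
    finally show ?thesis .
  qed
  show ?thesis
  proof
    assume "pr (sub D u) p x y"
    then obtain a b where ab: "a \<in> sub D u" "b \<in> sub D u" "el a = {x}" "el b = {x, y}" "el p = {a, b}"
      using upr assms unfolding pr_def by auto
    then have xy: "x \<in> el u" "y \<in> el u" using sub_iff[OF u(2)] by auto
    have "a = mk D {x}" "b = mk D {x, y}" using ab sub_D mk_eq by metis+
    then have "p = pair D x y" unfolding pair_def using ab assms(1) sub_D mk_eq by metis
    with xy show "x \<in> el u \<and> y \<in> el u \<and> p = pair D x y" by blast
  next
    assume r: "x \<in> el u \<and> y \<in> el u \<and> p = pair D x y"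
    then have "x \<in> S" "y \<in> S" using limlev_S by auto
    note P = pair_parts[OF this]
    have "mk D {x} \<in> el u" "mk D {x, y} \<in> el u"
      using r limlev_pair_set[of x x] limlev_pair_set[of x y] by auto
    then have M: "mk D {x} \<in> sub D u" "mk D {x, y} \<in> sub D u" using sub_mem by auto
    then have "upr (sub D u) (mk D {x}) x x" "upr (sub D u) (mk D {x, y}) x y"
      "upr (sub D u) p (mk D {x}) (mk D {x, y})"
      using upr assms P r by simp_all
    then show "pr (sub D u) p x y" unfolding pr_def using M by blast
  qed
qed

lemma rel_sub:
  assumes "F \<in> sub D u" "x \<in> sub D u" "y \<in> sub D u"
  shows "rel (sub D u) F x y \<longleftrightarrow> x \<in> el u \<and> y \<in> el u \<and> pair D x y \<in> el F"
proof -
  have "rel (sub D u) F x y \<longleftrightarrow> (\<exists>p\<in>sub D u. (x \<in> el u \<and> y \<in> el u \<and> p = pair D x y) \<and> p \<in> el F)"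
    unfolding rel_def using pr_sub[OF _ assms(2,3)] mem_sub[OF assms(1)] by blast
  also have "\<dots> \<longleftrightarrow> x \<in> el u \<and> y \<in> el u \<and> pair D x y \<in> el F"
    using sub_mem sub_iff[OF u(2)] assms(1) by blast
  finally show ?thesis .
qed

lemma relb_sub:
  assumes "F \<in> sub D u" "A \<in> sub D u" "B \<in> sub D u"
  shows "relb (sub D u) F A B \<longleftrightarrow> (\<forall>p\<in>el F. \<exists>x\<in>el A. \<exists>y\<in>el B. p = pair D x y)"
proof -
  have "relb (sub D u) F A B \<longleftrightarrow> (\<forall>p\<in>sub D u. p \<in> el F \<longrightarrow>
    (\<exists>x\<in>sub D u. \<exists>y\<in>sub D u. x \<in> el A \<and> y \<in> el B \<and> x \<in> el u \<and> y \<in> el u \<and> p = pair D x y))"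
    unfolding relb_def
  proof (intro ball_cong refl imp_cong bex_cong)
    fix p x y assume *: "p \<in> sub D u" "x \<in> sub D u" "y \<in> sub D u"
    show "(x \<epsilon> A \<and> y \<epsilon> B \<and> pr (sub D u) p x y) =
      (x \<in> el A \<and> y \<in> el B \<and> x \<in> el u \<and> y \<in> el u \<and> p = pair D x y)"
      using mem_sub[OF assms(2) *(2)] mem_sub[OF assms(3) *(3)] pr_sub[OF *] by simp
  qed (use mem_sub assms in auto)
  also have "\<dots> \<longleftrightarrow> (\<forall>p\<in>el F. \<exists>x\<in>el A. \<exists>y\<in>el B. p = pair D x y)"
    using sub_mem sub_iff[OF u(2)] assms by (smt (verit, best) subsetD)
  finally show ?thesis .
qed

end

section \<open>Universes as models of class theory\<close>

lemma univ_limlev: "univ u \<Longrightarrow> limlev u"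
  by (simp add: univ_def)

theorem univ_gb:
  assumes un: "univ u" and u: "u \<in> S"
  shows "gb E (sub D u)"
proof -
  note lim = univ_limlev[OF un]
  let ?U = "sub D u"
  note mem = mem_sub[OF lim u] and st = st_sub[OF lim u] and relU = rel_sub[OF lim u]
    and elU = sub_mem[OF lim u] and iffU = sub_iff[OF u] and uS = limlev_S[OF lim u]
  have down: "y \<in> el u" if "x \<in> ?U" "y \<in> el x" for x y using that iffU by blast
  have downU: "y \<in> ?U" if "x \<in> ?U" "y \<in> el x" for x y using down[OF that] elU by blast
  have ext: "sat ?U E e (ax_extensionality 0)" for e
    unfolding sat_ax_extensionality
  proof (intro ballI impI)
    fix X Y assume XY: "X \<in> ?U" "Y \<in> ?U" and "\<forall>z\<in>?U. z \<epsilon> X \<longleftrightarrow> z \<epsilon> Y"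
    then have "\<forall>z\<in>?U. z \<in> el X \<longleftrightarrow> z \<in> el Y" using mem by blast
    then have "el X = el Y" using XY downU by blast
    then show "X = Y" using XY sub_D el_inject by blast
  qed
  have pairing: "sat ?U E e (ax_pairing 0)" for e
    unfolding sat_ax_pairing
  proof (intro ballI impI)
    fix x y assume "x \<in> ?U" "y \<in> ?U" "st ?U x" "st ?U y"
    then have xy: "x \<in> el u" "y \<in> el u" using st by auto
    then have p: "mk D {x, y} \<in> el u" "el (mk D {x, y}) = {x, y}"
      using limlev_pair_set[OF lim u] sm_mk(2)[OF sm_pair] uS by auto
    then show "\<exists>p\<in>?U. st ?U p \<and> upr ?U p x y"
      using elU st mem unfolding upr_def by (intro bexI[of _ "mk D {x, y}"]) auto
  qed
  have union: "sat ?U E e (ax_union 0)" for e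
    unfolding sat_ax_union
  proof (intro ballI impI)
    fix X assume X: "X \<in> ?U" "st ?U X"
    then have Xu: "X \<in> el u" using st by auto
    let ?W = "mk D (\<Union>y\<in>el X. el y)"
    have W: "?W \<in> el u" "el ?W = (\<Union>y\<in>el X. el y)"
      using limlev_union[OF lim u Xu] sm_mk(2)[OF sm_Union[OF uS[OF Xu]]] by auto
    have "w \<epsilon> ?W \<longleftrightarrow> (\<exists>x\<in>?U. x \<epsilon> X \<and> w \<epsilon> x)" if w: "w \<in> ?U" for w
    proof -
      have "w \<epsilon> ?W \<longleftrightarrow> (\<exists>x\<in>el X. w \<in> el x)" using mem[OF elU[OF W(1)] w] W(2) by simp
      also have "\<dots> \<longleftrightarrow> (\<exists>x\<in>?U. x \<epsilon> X \<and> w \<epsilon> x)" using mem w X(1) downU by blast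
      finally show ?thesis .
    qed
    then show "\<exists>W\<in>?U. st ?U W \<and> (\<forall>w\<in>?U. w \<epsilon> W \<longleftrightarrow> (\<exists>x\<in>?U. x \<epsilon> X \<and> w \<epsilon> x))"
      using W(1) elU st by blast
  qed
  have power: "sat ?U E e (ax_power 0)" for e
    unfolding sat_ax_power
  proof (intro ballI impI)
    fix X assume X: "X \<in> ?U" "st ?U X"
    then have Xu: "X \<in> el u" using st by auto
    let ?W = "mk D {y \<in> S. el y \<subseteq> el X}"
    have W: "?W \<in> el u" "el ?W = {y \<in> S. el y \<subseteq> el X}"
      using limlev_pow[OF lim u Xu] sm_mk(2)[OF sm_Pow[OF uS[OF Xu]]] by auto
    have "w \<epsilon> ?W \<longleftrightarrow> (\<forall>z\<in>?U. z \<epsilon> w \<longrightarrow> z \<epsilon> X)" if w: "w \<in> ?U" for w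
    proof -
      have "w \<epsilon> ?W \<longleftrightarrow> el w \<subseteq> el X" using mem[OF elU[OF W(1)] w] W(2) w iffU by simp
      also have "\<dots> \<longleftrightarrow> (\<forall>z\<in>?U. z \<epsilon> w \<longrightarrow> z \<epsilon> X)" using mem w X(1) downU by blast
      finally show ?thesis .
    qed
    then show "\<exists>W\<in>?U. st ?U W \<and> (\<forall>w\<in>?U. st ?U w \<longrightarrow> (w \<epsilon> W \<longleftrightarrow> (\<forall>z\<in>?U. z \<epsilon> w \<longrightarrow> z \<epsilon> X)))"
      using W(1) elU st by blast
  qed
  have infinity: "sat ?U E e (ax_infinity 0)" for e
    unfolding sat_ax_infinity
  proof -
    obtain I where I: "I \<in> el u" "ind_set I" using un unfolding univ_def by blast
    have IU: "I \<in> ?U" using elU I by blast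
    obtain z where z: "z \<in> el I" "\<forall>y\<in>S. y \<notin> el z" using I(2) unfolding ind_set_def by blast
    have zU: "z \<in> ?U" using downU IU z by blast
    have 1: "\<exists>z\<in>?U. (\<forall>y\<in>?U. \<not> y \<epsilon> z) \<and> z \<epsilon> I"
      using zU z mem[OF zU] mem[OF IU] iffU by blast
    have 2: "\<exists>y\<in>?U. y \<epsilon> I \<and> (\<forall>w\<in>?U. w \<epsilon> y \<longleftrightarrow> w \<epsilon> x \<or> w = x)" if x: "x \<in> ?U" "x \<epsilon> I" for x
    proof -
      have "x \<in> el I" using x mem[OF IU] by blast
      then obtain y where y: "y \<in> el I" "\<forall>w\<in>S. w \<in> el y \<longleftrightarrow> w \<in> el x \<or> w = x"
        using I(2) unfolding ind_set_def by blast
      have yU: "y \<in> ?U" using downU IU y by blast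
      then show ?thesis using y mem[OF yU] mem[OF x(1)] mem[OF IU yU] iffU by blast
    qed
    show "\<exists>I\<in>?U. st ?U I \<and> (\<exists>z\<in>?U. (\<forall>y\<in>?U. \<not> y \<epsilon> z) \<and> z \<epsilon> I) \<and>
      (\<forall>x\<in>?U. x \<epsilon> I \<longrightarrow> (\<exists>y\<in>?U. y \<epsilon> I \<and> (\<forall>w\<in>?U. w \<epsilon> y \<longleftrightarrow> w \<epsilon> x \<or> w = x)))"
      using IU st[OF IU] I(1) 1 2 by blast
  qed
  have replacement: "sat ?U E e (ax_replacement 0)" for e
    unfolding sat_ax_replacement
  proof (intro ballI impI)
    fix F X assume F: "F \<in> ?U" "clsfun ?U F" and X: "X \<in> ?U" "st ?U X"
    then have Xu: "X \<in> el u" using st by auto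
    have FS: "F \<in> S" using F iffU by blast
    \<comment> \<open>\<open>F\<close> may be defined on all of \<open>u\<close>, whereas
      \<open>univ\<close> speaks of functions with domain in \<open>u\<close>. So \<open>G\<close>
      is \<open>F\<close> restricted to \<open>X\<close>, and \<open>d\<close> is the domain of
      \<open>G\<close>.\<close>
    have sm1: "sm {z \<in> el F. \<exists>x\<in>el X. \<exists>y\<in>S. z = pair D x y}"
      by (intro sm_sep sm_el FS dfb_intro dft_const uS[OF Xu])
    have sm2: "sm {x \<in> el X. \<exists>y\<in>S. pair D x y \<in> el F}"
      by (intro sm_sep sm_el FS dfb_intro dft_const uS[OF Xu])
    from sm1 obtain G where G: "G \<in> S" "el G = {z \<in> el F. \<exists>x\<in>el X. \<exists>y\<in>S. z = pair D x y}"
      by (rule smE)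
    from sm2 obtain d where d: "d \<in> S" "el d = {x \<in> el X. \<exists>y\<in>S. pair D x y \<in> el F}"
      by (rule smE)
    have XS: "x \<in> S" if "x \<in> el X" for x using that uS[OF Xu] el_SS by blast
    have Gp: "pair D x y \<in> el G \<longleftrightarrow> x \<in> el X \<and> pair D x y \<in> el F" if "x \<in> S" "y \<in> S" for x y
      unfolding G(2) using that pair_inject XS by blast
    have Fu: "x \<in> el u \<and> y \<in> el u" if "x \<in> S" "y \<in> S" "pair D x y \<in> el F" for x y
      using limlev_pairD[OF lim u _ that(1,2)] down[OF F(1) that(3)] by blast
    have "func G"
      unfolding func_def
    proof (intro ballI impI)
      fix x y z assume S: "x \<in> S" "y \<in> S" "z \<in> S" and "pair D x y \<in> el G \<and> pair D x z \<in> el G"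
      then have p: "pair D x y \<in> el F" "pair D x z \<in> el F" using Gp by auto
      then have m: "x \<in> el u" "y \<in> el u" "z \<in> el u" using Fu S by auto
      then have "rel ?U F x y" "rel ?U F x z" using relU[OF F(1)] p elU by auto
      then show "y = z" using F(2) m elU unfolding clsfun_def by blast
    qed
    then have "fdom G d" unfolding fdom_def d(2) using Gp by auto
    moreover have "d \<in> el u" using limlev_subset[OF lim u Xu d(1)] d(2) by blast
    moreover have "el G \<subseteq> el u" using G(2) down[OF F(1)] by blast
    ultimately have "ran_in G u" using un G(1) unfolding univ_def by blast
    then obtain r where r: "r \<in> el u" "\<forall>y\<in>S. y \<in> el r \<longleftrightarrow> (\<exists>x\<in>S. pair D x y \<in> el G)"
      unfolding ran_in_def by blast
    have rU: "r \<in> ?U" using r elU by blast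
    have "y \<epsilon> r \<longleftrightarrow> (\<exists>x\<in>?U. x \<epsilon> X \<and> rel ?U F x y)" if y: "y \<in> ?U" for y
    proof -
      have yS: "y \<in> S" using y iffU by blast
      have "y \<epsilon> r \<longleftrightarrow> (\<exists>x\<in>S. x \<in> el X \<and> pair D x y \<in> el F)"
        using mem[OF rU y] r(2) yS Gp by auto
      also have "\<dots> \<longleftrightarrow> (\<exists>x\<in>?U. x \<epsilon> X \<and> rel ?U F x y)"
      proof
        assume "\<exists>x\<in>S. x \<in> el X \<and> pair D x y \<in> el F"
        then obtain x where x: "x \<in> S" "x \<in> el X" "pair D x y \<in> el F" by blast
        then have m: "x \<in> el u" "y \<in> el u" using Fu yS by auto
        then have "rel ?U F x y" using relU[OF F(1)] elU x(3) by blast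
        then show "\<exists>x\<in>?U. x \<epsilon> X \<and> rel ?U F x y" using elU[OF m(1)] x(2) mem[OF X(1)] by blast
      next
        assume "\<exists>x\<in>?U. x \<epsilon> X \<and> rel ?U F x y"
        then show "\<exists>x\<in>S. x \<in> el X \<and> pair D x y \<in> el F"
          using relU[OF F(1) _ y] mem[OF X(1)] uS by blast
      qed
      finally show ?thesis .
    qed
    then show "\<exists>Y\<in>?U. st ?U Y \<and> (\<forall>y\<in>?U. y \<epsilon> Y \<longleftrightarrow> (\<exists>x\<in>?U. x \<epsilon> X \<and> rel ?U F x y))"
      using rU st[OF rU] r(1) by blast
  qed
  have regular: "sat ?U E e (ax_regularity 0)" for e
    unfolding sat_ax_regularity
  proof (intro ballI impI)
    fix X assume X: "X \<in> ?U" "\<exists>x\<in>?U. x \<epsilon> X"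
    then have "el X \<noteq> {}" using mem[OF X(1)] by blast
    then obtain x where x: "x \<in> el X" "el x \<inter> el X = {}"
      using regularity[OF cl_el] X sub_D by metis
    have xU: "x \<in> ?U" using x X downU by blast
    then have "\<not> (\<exists>y\<in>?U. y \<epsilon> x \<and> y \<epsilon> X)" using mem[OF xU] mem[OF X(1)] x(2) by blast
    then show "\<exists>x\<in>?U. x \<epsilon> X \<and> \<not> (\<exists>y\<in>?U. y \<epsilon> x \<and> y \<epsilon> X)"
      using xU x(1) mem[OF X(1) xU] by blast
  qed
  have choice: "sat ?U E e (ax_choice 0)" for e
    unfolding sat_ax_choice
  proof (intro ballI impI)
    fix X assume X: "X \<in> ?U" "st ?U X" and ne: "\<forall>x\<in>?U. x \<epsilon> X \<longrightarrow> (\<exists>y\<in>?U. y \<epsilon> x)"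
    then have Xu: "X \<in> el u" using st by auto
    have "el x \<noteq> {}" if "x \<in> el X" for x
    proof -
      have xU: "x \<in> ?U" using downU X that by blast
      then have "x \<epsilon> X" using mem[OF X(1) xU] that by blast
      then show ?thesis using ne xU mem[OF xU] by blast
    qed
    from choice[OF uS[OF Xu] this] obtain f where f: "f \<in> S"
      "\<And>x. x \<in> el X \<Longrightarrow> \<exists>!y. y \<in> S \<and> pair D x y \<in> el f"
      "\<And>x y. x \<in> S \<Longrightarrow> y \<in> S \<Longrightarrow> pair D x y \<in> el f \<Longrightarrow> y \<in> el x" by metis
    let ?W = "mk D (\<Union>y\<in>el X. el y)"
    have W: "?W \<in> el u" "el ?W = (\<Union>y\<in>el X. el y)"
      using limlev_union[OF lim u Xu] sm_mk(2)[OF sm_Union[OF uS[OF Xu]]] by auto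
    \<comment> \<open>The choice function found in \<open>D\<close> is only known to be a set; cut
      down to pairs from \<open>X\<close> and its union it becomes a member of
      \<open>u\<close>.\<close>
    have "sm {z \<in> {pair D x y |x y. x \<in> el X \<and> y \<in> el ?W}. z \<in> el f}"
      by (intro sm_sep sm_times sm_el uS[OF Xu] uS[OF W(1)] dfb_intro dft_const f(1))
    then obtain F where F: "F \<in> S" "el F = {z \<in> {pair D x y |x y. x \<in> el X \<and> y \<in> el ?W}. z \<in> el f}"
      by (rule smE)
    have Fu: "F \<in> el u" by (rule limlev_times[OF lim u Xu W(1) F(1)]) (use F(2) in blast)
    have FU: "F \<in> ?U" using Fu elU by blast
    have XS: "x \<in> S" if "x \<in> el X" for x using that uS[OF Xu] el_SS by blast
    have Fp: "pair D x y \<in> el F \<longleftrightarrow> x \<in> el X \<and> pair D x y \<in> el f" if "x \<in> S" "y \<in> S" for x y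
    proof
      assume "pair D x y \<in> el F"
      then obtain x' y' where *: "pair D x y = pair D x' y'" "x' \<in> el X" "y' \<in> el ?W" "pair D x y \<in> el f"
        using F(2) by blast
      then have "x' \<in> S" "y' \<in> S" using XS uS[OF W(1)] el_SS by blast+
      then show "x \<in> el X \<and> pair D x y \<in> el f" using * that pair_inject by metis
    next
      assume "x \<in> el X \<and> pair D x y \<in> el f"
      then show "pair D x y \<in> el F" using f(3)[OF that] F(2) W(2) by blast
    qed
    have "funb ?U F X ?W"
      unfolding funb_def
    proof (intro conjI ballI impI)
      show "relb ?U F X ?W"
        unfolding relb_sub[OF lim u FU X(1) elU[OF W(1)]] using F(2) by blast
      fix x assume x: "x \<in> ?U" "x \<epsilon> X"
      then have xX: "x \<in> el X" using mem[OF X(1)] by blast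
      then obtain y where y: "y \<in> S" "pair D x y \<in> el f"
          "\<And>z. z \<in> S \<Longrightarrow> pair D x z \<in> el f \<Longrightarrow> z = y" using f(2) by blast
      have "y \<in> el x" using f(3) XS[OF xX] y by blast
      then have yu: "y \<in> el u" "x \<in> el u" using down[OF x(1)] down[OF X(1) xX] by auto
      have relF: "rel ?U F x z \<longleftrightarrow> z \<in> el u \<and> pair D x z \<in> el f" if "z \<in> ?U" for z
        using relU[OF FU x(1) that] Fp[OF XS[OF xX]] yu(2) xX that iffU by blast
      show "\<exists>y\<in>?U. rel ?U F x y \<and> (\<forall>z\<in>?U. rel ?U F x z \<longrightarrow> z = y)"
        using relF elU[OF yu(1)] yu(1) y uS by blast
    qed
    moreover have "y \<epsilon> x" if "x \<in> ?U" "y \<in> ?U" "rel ?U F x y" for x y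
    proof -
      have "x \<in> S" "y \<in> S" using that iffU by auto
      moreover have "pair D x y \<in> el f" using relU[OF FU that(1,2)] that(3) F(2) by blast
      ultimately have "y \<in> el x" by (rule f(3))
      then show ?thesis using mem that by blast
    qed
    ultimately show "\<exists>f\<in>?U. st ?U f \<and> (\<exists>W\<in>?U. st ?U W \<and> funb ?U f X W) \<and>
        (\<forall>x\<in>?U. \<forall>y\<in>?U. rel ?U f x y \<longrightarrow> y \<epsilon> x)"
      using FU st[OF FU] Fu elU[OF W(1)] st[OF elU[OF W(1)]] W(1) by blast
  qed
  show ?thesis
  proof unfold_locales
    show "?U \<noteq> {}" using self_sub[OF u] by blast
    fix p :: fm and e :: "nat \<Rightarrow> 'a" assume "p \<in> GB_AC" "range e \<subseteq> ?U"
    then show "sat ?U E e p"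
      using ext pairing union power infinity replacement regular choice comprehension_sub[OF u limlev_transitive[OF lim u]]
      unfolding GB_AC_def by auto
  qed
qed

text \<open>Translates a counterexample over \<open>u\<close> into the language of \<open>D\<close>.
  As \<open>sub D u\<close> is itself a model, characterizations such as \<open>U.hom_iff\<close>
  apply to it, and only \<open>pair\<close>, \<open>ord\<close>, \<open>graph\<close>,
  \<open>fun_on\<close> and \<open>ghom\<close> have to be compared between the two models.\<close>

lemma swcex_sub:
  assumes un: "univ u" and u: "u \<in> S" and Sq: "Q \<in> sub D u" and cex: "swcex (sub D u) Q"
  shows "p \<in> el Q \<Longrightarrow> \<exists>a\<in>el u. \<exists>V\<in>el u. \<exists>A\<in>el u. ord a \<and> graph V A \<and> p = pair D a (pair D V A)"
    and "a \<in> el u \<Longrightarrow> ord a \<Longrightarrow> \<exists>V\<in>el u. \<exists>A\<in>el u. graph V A \<and> pair D a (pair D V A) \<in> el Q"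
    and "func Q"
    and "a \<in> el b \<Longrightarrow> b \<in> el u \<Longrightarrow> ord b \<Longrightarrow> graph V A \<Longrightarrow> graph V' A' \<Longrightarrow>
      pair D a (pair D V A) \<in> el Q \<Longrightarrow> pair D b (pair D V' A') \<in> el Q \<Longrightarrow>
      (\<exists>h\<in>S. \<exists>f. fun_on h V' f V \<and> ghom f V' A' V A) \<and>
      \<not> (\<exists>h\<in>S. \<exists>f. fun_on h V f V' \<and> ghom f V A V' A')"
proof -
  note lim = univ_limlev[OF un]
  let ?U = "sub D u"
  note mem = mem_sub[OF lim u] and st = st_sub[OF lim u] and relU = rel_sub[OF lim u]
    and elU = sub_mem[OF lim u] and iffU = sub_iff[OF u] and uS = limlev_S[OF lim u]
    and els = els_sub[OF lim u] and trans = limlev_trans[OF lim u]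
  interpret U: gb E ?U by (rule univ_gb[OF un u])
  have StU: "St ?U = el u" by (rule trans_St_sub[OF u limlev_transitive[OF lim u]])
  have pairU: "pair ?U x y = pair D x y" if "x \<in> el u" "y \<in> el u" for x y
  proof -
    have p: "pair D x y \<in> ?U" using elU limlev_pair[OF lim u that] by blast
    have "pr ?U (pair D x y) x y" using pr_sub[OF lim u p] that elU by blast
    then show ?thesis using U.pr_iff[OF p] that elU by simp
  qed
  have ordU: "ordn ?U a \<longleftrightarrow> a \<in> el u \<and> ord a" if a: "a \<in> ?U" for a
  proof (cases "a \<in> el u")
    case True
    have down: "x \<in> ?U" if "x \<in> el a" for x using that True trans elU by blast
    have "(\<forall>x\<in>?U. x \<epsilon> a \<longrightarrow> (\<forall>z\<in>?U. z \<epsilon> x \<longrightarrow> z \<epsilon> a)) \<longleftrightarrow> (\<forall>x\<in>el a. el x \<subseteq> el a)"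
    proof -
      have "(\<forall>x\<in>?U. x \<epsilon> a \<longrightarrow> (\<forall>z\<in>?U. z \<epsilon> x \<longrightarrow> z \<epsilon> a)) \<longleftrightarrow>
        (\<forall>x\<in>?U. x \<in> el a \<longrightarrow> (\<forall>z\<in>?U. z \<in> el x \<longrightarrow> z \<in> el a))"
        using mem a by (simp cong: ball_cong)
      also have "\<dots> \<longleftrightarrow> (\<forall>x\<in>el a. el x \<subseteq> el a)"
        using down elU iffU by blast
      finally show ?thesis .
    qed
    moreover have "(\<forall>x\<in>?U. \<forall>y\<in>?U. x \<epsilon> a \<and> y \<epsilon> a \<longrightarrow> x \<epsilon> y \<or> x = y \<or> y \<epsilon> x) \<longleftrightarrow>
        (\<forall>x\<in>el a. \<forall>y\<in>el a. x \<in> el y \<or> x = y \<or> y \<in> el x)"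
    proof -
      have "(\<forall>x\<in>?U. \<forall>y\<in>?U. x \<epsilon> a \<and> y \<epsilon> a \<longrightarrow> x \<epsilon> y \<or> x = y \<or> y \<epsilon> x) \<longleftrightarrow>
        (\<forall>x\<in>?U. \<forall>y\<in>?U. x \<in> el a \<and> y \<in> el a \<longrightarrow> x \<in> el y \<or> x = y \<or> y \<in> el x)"
        using mem a by (simp cong: ball_cong)
      also have "\<dots> \<longleftrightarrow> (\<forall>x\<in>el a. \<forall>y\<in>el a. x \<in> el y \<or> x = y \<or> y \<in> el x)"
        using down by blast
      finally show ?thesis .
    qed
    ultimately show ?thesis unfolding ordn_def ord_def using st[OF a] True by simp
  next
    case False
    then show ?thesis unfolding ordn_def using st[OF a] by simp
  qed
  have graphU: "U.graph V A \<longleftrightarrow> V \<in> el u \<and> A \<in> el u \<and> graph V A" for V A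
  proof (cases "V \<in> el u \<and> A \<in> el u")
    case True
    have "(\<forall>p\<in>els ?U A. \<exists>x\<in>els ?U V. \<exists>y\<in>els ?U V. p = pair ?U x y) \<longleftrightarrow>
      (\<forall>p\<in>el A. \<exists>x\<in>el V. \<exists>y\<in>el V. p = pair D x y)"
    proof -
      have "els ?U V = el V" "els ?U A = el A" using els elU True by auto
      moreover have "pair ?U x y = pair D x y" if "x \<in> el V" "y \<in> el V" for x y
        using pairU that trans True by blast
      ultimately show ?thesis by (metis (no_types, lifting))
    qed
    then show ?thesis unfolding U.graph_def graph_def StU using True uS by auto
  next
    case False
    then show ?thesis unfolding U.graph_def StU by blast
  qed
  have fun_onU: "U.fun_on h V f W \<longleftrightarrow> fun_on h V f W" if "h \<in> ?U" "V \<in> el u" "W \<in> el u" for h V f W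
  proof (cases "\<forall>x\<in>el V. f x \<in> el W")
    case True
    then have "pair ?U x (f x) = pair D x (f x)" if "x \<in> el V" for x
      using pairU trans that \<open>V \<in> el u\<close> \<open>W \<in> el u\<close> by blast
    then have "{pair ?U x (f x) |x. x \<in> el V} = {pair D x (f x) |x. x \<in> el V}" by force
    moreover have "els ?U V = el V" "els ?U W = el W" "els ?U h = el h" using els elU that by auto
    ultimately show ?thesis unfolding U.fun_on_def fun_on_def by simp
  next
    case False
    moreover have "els ?U V = el V" "els ?U W = el W" using els elU that by auto
    ultimately show ?thesis unfolding U.fun_on_def fun_on_def by auto
  qed
  have ghomU: "U.ghom f V A W B \<longleftrightarrow> ghom f V A W B"
    if "V \<in> el u" "A \<in> el u" "W \<in> el u" "B \<in> el u" for f V A W B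
  proof (cases "\<forall>x\<in>el V. f x \<in> el W")
    case True
    have e: "els ?U V = el V" "els ?U W = el W" "els ?U A = el A" "els ?U B = el B"
      using els elU that by auto
    have "pair ?U x y = pair D x y" "pair ?U (f x) (f y) = pair D (f x) (f y)"
      if "x \<in> el V" "y \<in> el V" for x y
      using pairU trans that \<open>V \<in> el u\<close> \<open>W \<in> el u\<close> True by blast+
    then show ?thesis unfolding U.ghom_def ghom_def e by (simp cong: ball_cong)
  next
    case False
    moreover have "els ?U V = el V" "els ?U W = el W" using els elU that by auto
    ultimately show ?thesis unfolding U.ghom_def ghom_def by auto
  qed
  have grU: "gr ?U g \<longleftrightarrow> (\<exists>V\<in>el u. \<exists>A\<in>el u. graph V A \<and> g = pair D V A)" if "g \<in> ?U" for g
    unfolding U.gr_iff[OF that] graphU using pairU by metis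
  have homU: "hom ?U h (pair D V A) (pair D V' A') \<longleftrightarrow> (\<exists>f. fun_on h V f V' \<and> ghom f V A V' A')"
    if "h \<in> ?U" "V \<in> el u" "A \<in> el u" "V' \<in> el u" "A' \<in> el u" "graph V A" "graph V' A'" for h V A V' A'
    using U.hom_iff[of V A V' A' h] that graphU pairU fun_onU ghomU by simp
  have seq1: "\<forall>p\<in>?U. p \<epsilon> Q \<longrightarrow> (\<exists>a\<in>?U. \<exists>g\<in>?U. ordn ?U a \<and> gr ?U g \<and> pr ?U p a g)"
    and seq2: "\<forall>a\<in>?U. ordn ?U a \<longrightarrow> (\<exists>g\<in>?U. rel ?U Q a g \<and> (\<forall>g'\<in>?U. rel ?U Q a g' \<longrightarrow> g' = g))"
    using cex unfolding swcex_def gseq_def by blast+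
  have seq3: "(a \<epsilon> a' \<or> a = a' \<longrightarrow> (\<exists>h\<in>?U. st ?U h \<and> hom ?U h g' g)) \<and> no_hom_up ?U a a' g g'"
    if "a \<in> ?U" "a' \<in> ?U" "g \<in> ?U" "g' \<in> ?U" "ordn ?U a" "ordn ?U a'" "rel ?U Q a g" "rel ?U Q a' g'"
    for a a' g g'
    using cex that unfolding swcex_def by blast
  show 1: "\<exists>a\<in>el u. \<exists>V\<in>el u. \<exists>A\<in>el u. ord a \<and> graph V A \<and> p = pair D a (pair D V A)"
    if "p \<in> el Q" for p
  proof -
    have pU: "p \<in> ?U" "p \<epsilon> Q" using that Sq iffU elU mem[OF Sq] by blast+
    then obtain a g where ag: "a \<in> ?U" "g \<in> ?U" "ordn ?U a" "gr ?U g" "pr ?U p a g"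
      using seq1 by blast
    then show ?thesis using ordU grU pr_sub[OF lim u pU(1)] by blast
  qed
  show 2: "\<exists>V\<in>el u. \<exists>A\<in>el u. graph V A \<and> pair D a (pair D V A) \<in> el Q" if "a \<in> el u" "ord a" for a
  proof -
    have aU: "a \<in> ?U" "ordn ?U a" using that elU ordU by blast+
    then obtain g where g: "g \<in> ?U" "rel ?U Q a g" using seq2 by blast
    then have gu: "g \<in> el u" "pair D a g \<in> el Q" using relU[OF Sq aU(1)] by blast+
    from 1[OF gu(2)] obtain a' V A where *: "a' \<in> el u" "V \<in> el u" "A \<in> el u" "graph V A"
      "pair D a g = pair D a' (pair D V A)" by blast
    then show ?thesis using gu(2) by auto
      (metis limlev_pair[OF lim u] pair_inject uS gu(1) that(1))
  qed
  show func: "func Q"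
    unfolding func_def
  proof (intro ballI impI, elim conjE)
    fix x y z assume S: "x \<in> S" "y \<in> S" "z \<in> S" and p: "pair D x y \<in> el Q" "pair D x z \<in> el Q"
    from 1[OF p(1)] obtain a V A where "a \<in> el u" "V \<in> el u" "A \<in> el u" "ord a"
      "pair D x y = pair D a (pair D V A)" by blast
    moreover from this have "pair D V A \<in> S" "a \<in> S" using uS pair_S by auto
    ultimately have x: "x \<in> el u" "ord x" using pair_inject S by metis+
    have yz: "y \<in> el u" "z \<in> el u"
      using limlev_pairD[OF lim u _ S(1,2)] limlev_pairD[OF lim u _ S(1,3)] p Sq iffU by blast+
    have "rel ?U Q x y" "rel ?U Q x z" using relU[OF Sq] elU x yz p by blast+
    then show "y = z" using seq2 elU x yz ordU by blast
  qed
  show "(\<exists>h\<in>S. \<exists>f. fun_on h V' f V \<and> ghom f V' A' V A) \<and>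
      \<not> (\<exists>h\<in>S. \<exists>f. fun_on h V f V' \<and> ghom f V A V' A')"
    if ab: "a \<in> el b" "b \<in> el u" "ord b" and G: "graph V A" "graph V' A'"
      and Q: "pair D a (pair D V A) \<in> el Q" "pair D b (pair D V' A') \<in> el Q" for a b V A V' A'
  proof -
    have a: "a \<in> el u" "ord a" using ab trans ord_mem uS by blast+
    have S: "a \<in> S" "b \<in> S" "V \<in> S" "A \<in> S" "V' \<in> S" "A' \<in> S" "pair D V A \<in> S" "pair D V' A' \<in> S"
      using a ab uS G pair_S by (auto simp: graph_def)
    have Qu: "pair D a (pair D V A) \<in> el u" "pair D b (pair D V' A') \<in> el u"
      using Q Sq iffU by blast+
    have g: "pair D V A \<in> el u" "pair D V' A' \<in> el u"
      using limlev_pairD[OF lim u Qu(1)] limlev_pairD[OF lim u Qu(2)] S by auto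
    have VA: "V \<in> el u" "A \<in> el u" "V' \<in> el u" "A' \<in> el u"
      using limlev_pairD[OF lim u g(1)] limlev_pairD[OF lim u g(2)] S by auto
    have "rel ?U Q a (pair D V A)" "rel ?U Q b (pair D V' A')"
      using relU[OF Sq] elU a ab g Q by auto
    from seq3[OF elU[OF a(1)] elU[OF ab(2)] elU[OF g(1)] elU[OF g(2)] _ _ this]
    have *: "\<exists>h\<in>?U. st ?U h \<and> hom ?U h (pair D V' A') (pair D V A)"
        "\<not> (\<exists>h\<in>?U. st ?U h \<and> hom ?U h (pair D V A) (pair D V' A'))"
      using ordU elU a ab mem[OF elU[OF ab(2)] elU[OF a(1)]] unfolding no_hom_up_def by auto
    from *(1) obtain h where h: "h \<in> ?U" "hom ?U h (pair D V' A') (pair D V A)" by blast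
    then have "\<exists>f. fun_on h V' f V \<and> ghom f V' A' V A" using homU VA G by blast
    moreover have "h \<in> S" using h iffU by blast
    \<comment> \<open>A homomorphism in \<open>D\<close> between graphs of \<open>u\<close> already
      belongs to \<open>u\<close>, so the absence of homomorphisms passes from \<open>u\<close> to
      \<open>D\<close>.\<close>
    moreover have False if h: "h \<in> S" "fun_on h V f V'" "ghom f V A V' A'" for h f
    proof -
      have "h \<in> el u"
        by (rule limlev_times[OF lim u VA(1) VA(3) h(1)]) (use h(2) in \<open>auto simp: fun_on_def\<close>)
      then have "h \<in> ?U" "st ?U h" using elU st by auto
      moreover from this have "hom ?U h (pair D V A) (pair D V' A')" using homU VA G h by blast
      ultimately show False using *(2) by blast
    qed
    ultimately show ?thesis by blast
  qed
qed

subsection \<open>Embeddings between levels\<close>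

text \<open>The axiom of choice is applied to the sets \<open>g i\<close> of admissible pairs
  \<open>pair D i y\<close>. As the index is part of each pair, the chosen pairs themselves make up
  the function \<open>P\<close>.\<close>

lemma choice_function:
  assumes I: "I \<in> S" and B: "B \<in> S" and Q: "\<And>i j. dfb (\<lambda>e. Q (e i) (e j))"
    and ex: "\<And>i. i \<in> el I \<Longrightarrow> \<exists>y\<in>el B. Q i y"
  obtains P where "P \<in> S" "func P" "\<And>i. i \<in> el I \<Longrightarrow> \<exists>y\<in>el B. pair D i y \<in> el P"
    "\<And>i y. i \<in> S \<Longrightarrow> y \<in> S \<Longrightarrow> pair D i y \<in> el P \<Longrightarrow> i \<in> el I \<and> Q i y"
proof -
  define g where "g i = mk D {z \<in> S. \<exists>y\<in>el B. z = pair D i y \<and> Q i y}" for i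
  have BS: "y \<in> S" if "y \<in> el B" for y using that B el_SS by blast
  have IS: "i \<in> S" if "i \<in> el I" for i using that I el_SS by blast
  have sm: "sm {z \<in> S. \<exists>y\<in>el B. z = pair D i y \<and> Q i y}" if i: "i \<in> S" for i
  proof (rule sm_subset)
    have "dfb (\<lambda>e. Q i (e j))" for j
      by (rule dfb_app2[of Q, OF Q dft_const[OF i] dft_var])
    then show "cl {z \<in> S. \<exists>y\<in>el B. z = pair D i y \<and> Q i y}"
      by (intro cl_comp dfb_intro dft_const B i)
    show "sm {pair D x y |x y. x \<in> {i} \<and> y \<in> el B}" by (intro sm_times sm_sing sm_el i B)
  qed blast
  have g: "g i \<in> S" "el (g i) = {z \<in> S. \<exists>y\<in>el B. z = pair D i y \<and> Q i y}" if "i \<in> S" for i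
    unfolding g_def using sm_mk[OF sm[OF that]] by auto
  have dg: "dft (\<lambda>e. g (e i))" for i
    unfolding g_def
  proof (rule dft_mk)
    have "dfb (\<lambda>e. \<exists>y\<in>el B. e 0 = pair D (e (Suc i)) y \<and> Q (e (Suc i)) y)"
      by (intro dfb_intro dft_const B Q)
    also have "?this \<longleftrightarrow> dfb (\<lambda>e. e 0 \<in> {z \<in> S. \<exists>y\<in>el B. z = pair D (e (Suc i)) y \<and> Q (e (Suc i)) y})"
      by (rule dfb_cong) auto
    finally show "dfb (\<lambda>e. e 0 \<in> {z \<in> S. \<exists>y\<in>el B. z = pair D (e (Suc i)) y \<and> Q (e (Suc i)) y})" .
  qed (intro sm, auto)
  have smX: "sm (g ` el I)" by (rule sm_image[OF I dg])
  then obtain X where X: "X \<in> S" "el X = g ` el I" by (rule smE)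
  have ne: "el x \<noteq> {}" if x: "x \<in> el X" for x
  proof -
    obtain i where i: "i \<in> el I" "x = g i" using x X by auto
    then obtain y where "y \<in> el B" "Q i y" using ex by blast
    then have "pair D i y \<in> el x" using g(2)[OF IS[OF i(1)]] i pair_S[OF IS[OF i(1)] BS] by blast
    then show ?thesis by blast
  qed
  from choice[OF X(1) ne] obtain h where h: "h \<in> S"
    "\<And>x. x \<in> el X \<Longrightarrow> \<exists>!y. y \<in> S \<and> pair D x y \<in> el h"
    "\<And>x y. x \<in> S \<Longrightarrow> y \<in> S \<Longrightarrow> pair D x y \<in> el h \<Longrightarrow> y \<in> el x" by metis
  have hun: "z = z'" if "i \<in> el I" "z \<in> S" "z' \<in> S" "pair D (g i) z \<in> el h" "pair D (g i) z' \<in> el h"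
    for i z z'
    using h(2)[of "g i"] that X(2) by blast
  have "sm {z \<in> S. \<exists>i\<in>el I. pair D (g i) z \<in> el h}"
  proof (rule class_function_image[OF I])
    show "dfb (\<lambda>e. pair D (g (e 0)) (e (Suc 0)) \<in> el h)"
      by (intro dfb_intro dg dft_const h(1))
  qed (rule hun)
  then obtain P where P: "P \<in> S" "el P = {z \<in> S. \<exists>i\<in>el I. pair D (g i) z \<in> el h}" by (rule smE)
  have key: "i \<in> el I \<and> Q i y \<and> pair D (g i) (pair D i y) \<in> el h"
    if iy: "i \<in> S" "y \<in> S" "pair D i y \<in> el P" for i y
  proof -
    from iy(3) obtain i' where i': "i' \<in> el I" "pair D (g i') (pair D i y) \<in> el h" using P(2) by blast
    have "pair D i y \<in> el (g i')" 
      by (rule h(3)[OF g(1)[OF IS[OF i'(1)]] pair_S[OF iy(1,2)] i'(2)])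
    then obtain y' where y': "y' \<in> el B" "pair D i y = pair D i' y'" "Q i' y'"
      using g(2)[OF IS[OF i'(1)]] by blast
    then have "i = i' \<and> y = y'" using pair_inject[OF iy(1,2) IS[OF i'(1)] BS[OF y'(1)]] by blast
    then have "i = i'" "Q i y" using y' by auto
    then show ?thesis using i' by blast
  qed
  show thesis
  proof (rule that[OF P(1)])
    show "func P"
      unfolding func_def
    proof (intro ballI impI, elim conjE)
      fix x y z assume S: "x \<in> S" "y \<in> S" "z \<in> S" and p: "pair D x y \<in> el P" "pair D x z \<in> el P"
      have "pair D x y = pair D x z"
        using key[OF S(1,2) p(1)] key[OF S(1,3) p(2)]
          hun[OF _ pair_S[OF S(1,2)] pair_S[OF S(1,3)]] by blast
      then show "y = z" using pair_inject S by blast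
    qed
    show "\<exists>y\<in>el B. pair D i y \<in> el P" if i: "i \<in> el I" for i
    proof -
      obtain z where z: "z \<in> S" "pair D (g i) z \<in> el h" using h(2)[of "g i"] X(2) i by blast
      then have "z \<in> el (g i)" using h(3)[OF g(1)[OF IS[OF i]]] by blast
      then obtain y where "y \<in> el B" "z = pair D i y" using g(2)[OF IS[OF i]] by blast
      then show ?thesis using z i P(2) by blast
    qed
    show "i \<in> el I \<and> Q i y" if "i \<in> S" "y \<in> S" "pair D i y \<in> el P" for i y
      using key[OF that] by blast
  qed
qed

definition pw :: "'a \<Rightarrow> 'a" where
  "pw x = mk D {y \<in> S. el y \<subseteq> el x}"

lemma pw: "x \<in> S \<Longrightarrow> pw x \<in> S" "x \<in> S \<Longrightarrow> y \<in> el (pw x) \<longleftrightarrow> y \<in> S \<and> el y \<subseteq> el x"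
  using sm_mk[OF sm_Pow[of x]] by (simp_all add: pw_def)

text \<open>Points of \<open>F\<close> have the form \<open>(\<alpha>, (v, \<G>))\<close> with \<open>v\<close> a vertex of the graph \<open>\<G>\<close>.\<close>

definition edges :: "'a \<Rightarrow> 'a \<Rightarrow> bool" where
  "edges F G \<longleftrightarrow> (\<forall>a\<in>S. \<forall>v\<in>S. \<forall>w\<in>S. \<forall>V\<in>S. \<forall>A\<in>S.
    pair D a (pair D v (pair D V A)) \<in> el F \<and> pair D a (pair D w (pair D V A)) \<in> el G \<longrightarrow>
    pair D v w \<in> el A)"

text \<open>With \<open>edges\<close> this expresses by binary relations that the \<open>F x\<close>
  are families of vertices which respect arcs. Since the values of \<open>F\<close> carry their
  graph along, \<open>edges\<close> compares two families without mentioning the sequence.\<close>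

definition verts :: "'a \<Rightarrow> 'a \<Rightarrow> bool" where
  "verts F Q \<longleftrightarrow> func F \<and> (\<forall>a\<in>S. \<forall>V\<in>S. \<forall>A\<in>S. pair D a (pair D V A) \<in> el Q \<longrightarrow>
    (\<exists>v\<in>el V. pair D a (pair D v (pair D V A)) \<in> el F))"

text \<open>Relations 0 and 1 make \<open>f\<close> preserve and reflect membership; 2 keeps levels
  and inclusion in them; 3, where the carrier \<open>A\<close> enters, marks the top element. 4, 5,
  7 and 11 are failures of properties that \<open>v\<close> is to have, and 6, 8, 9 and 10 transport
  data from \<open>v\<close> to its image.\<close>

definition srel :: "nat \<Rightarrow> 'a \<Rightarrow> 'a \<Rightarrow> 'a \<Rightarrow> bool" where
  "srel k A x y =
    (if k = 0 then x \<in> el y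
     else if k = 1 then x \<notin> el y
     else if k = 2 then lev y \<and> el x \<subseteq> el y
     else if k = 3 then \<forall>z\<in>el A. el z \<subseteq> el y
     else if k = 4 then \<not> (\<exists>p\<in>el y. \<forall>z\<in>S. z \<in> el p \<longleftrightarrow> el z \<subseteq> el x)
     else if k = 5 then \<not> (\<exists>I\<in>el y. ind_set I)
     else if k = 6 then fdom x y
     else if k = 7 then \<not> ran_in x y
     else if k = 8 then univ y \<and> el x \<subseteq> el y \<and> swcex (sub D y) x
     else if k = 9 then edges x y
     else if k = 10 then verts x y
     else \<forall>z\<in>S. z \<notin> el y)"

lemma dfb_swcex: "dfb (\<lambda>e. swcex (sub D (e i)) (e j))"
  using dfb_sat[of i "\<lambda>_. j" sw_body] by (simp add: sat_sw_body)

lemma dfb_srel: "dfb (\<lambda>e. srel k (e i) (e j) (e l))"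
proof -
  have dfb_If: "dfb (\<lambda>e. if C then P e else Q e)" if "dfb P" "dfb Q" for C P Q
    using that by (cases C) auto
  show ?thesis
    unfolding srel_def edges_def verts_def
    by (intro dfb_If) (intro dfb_intro dfb_swcex)+
qed

section \<open>The critical level of a homomorphism and its closure properties\<close>

context
  fixes a b f H
  assumes a: "a \<in> S" "lev a" and b: "b \<in> S" "lev b" and H: "H \<in> S" "fun_on H (pw a) f (pw b)"
    and pres: "\<And>k x y. k < 12 \<Longrightarrow> x \<in> el (pw a) \<Longrightarrow> y \<in> el (pw a) \<Longrightarrow>
      srel k (pw a) x y \<Longrightarrow> srel k (pw b) (f x) (f y)"
    and nontriv: "pw a \<noteq> pw b \<or> (\<exists>x\<in>el (pw a). f x \<noteq> x)"
begin

abbreviation (input) "dm x \<equiv> x \<in> S \<and> el x \<subseteq> el a"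

lemma emb_dom: "dm x \<Longrightarrow> f x \<in> S \<and> el (f x) \<subseteq> el b"
  using H(2) pw(2)[OF a(1)] pw(2)[OF b(1)] by (auto simp: fun_on_def)

lemma emb_pair: "dm x \<Longrightarrow> y \<in> S \<Longrightarrow> pair D x y \<in> el H \<longleftrightarrow> y = f x"
  using fun_on_iff[OF H(2) pw(1)[OF a(1)] pw(1)[OF b(1)]] pw(2)[OF a(1)] by blast

lemma emb_pres: "k < 12 \<Longrightarrow> dm x \<Longrightarrow> dm y \<Longrightarrow> srel k (pw a) x y \<Longrightarrow> srel k (pw b) (f x) (f y)"
  using pres pw(2)[OF a(1)] by blast

lemma emb_mem: "dm x \<Longrightarrow> dm y \<Longrightarrow> f x \<in> el (f y) \<longleftrightarrow> x \<in> el y"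
  using emb_pres[of 0 x y] emb_pres[of 1 x y] by (auto simp: srel_def)

lemma emb_lev: "dm x \<Longrightarrow> dm y \<Longrightarrow> lev y \<Longrightarrow> el x \<subseteq> el y \<Longrightarrow> lev (f y) \<and> el (f x) \<subseteq> el (f y)"
  using emb_pres[of 2 x y] by (auto simp: srel_def)

lemma critical_level:
  obtains v where "dm v" "lev v" "lev (f v)" "v \<in> el (f v)" "\<And>y. y \<in> el v \<Longrightarrow> f y = y"
proof -
  have moved: "\<exists>x. dm x \<and> f x \<noteq> x"
  proof (cases "a = b")
    case True
    then show ?thesis using nontriv pw(2)[OF a(1)] by auto
  next
    case False
    \<comment> \<open>Relation 3 singles out the top element of a power set and gives
      \<open>f a = b\<close>, so \<open>a\<close> itself is moved.\<close>
    have "\<forall>z\<in>el (pw b). el z \<subseteq> el (f a)"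
      using emb_pres[of 3 a a] a pw(2)[OF a(1)] by (auto simp: srel_def)
    then have "el b \<subseteq> el (f a)" using pw(2)[OF b(1)] b by blast
    then have "el b = el (f a)" using emb_dom[of a] a by blast
    then have "b = f a" using el_inject S_D b emb_dom[of a] a by blast
    then have "f a \<noteq> a" using False by metis
    then show ?thesis using a(1) by (intro exI[of _ a]) simp
  qed
  \<comment> \<open>Being moved is expressed through \<open>H\<close>, because only the set
    \<open>H\<close>, not the HOL function \<open>f\<close>, can occur in a formula.\<close>
  define P where "P v \<longleftrightarrow> (\<exists>x\<in>S. el x \<subseteq> el v \<and> el x \<subseteq> el a \<and> pair D x x \<notin> el H)" for v
  have Piff: "P v \<longleftrightarrow> (\<exists>x. dm x \<and> el x \<subseteq> el v \<and> f x \<noteq> x)" for v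
  proof -
    have "pair D x x \<in> el H \<longleftrightarrow> f x = x" if "dm x" for x
      using emb_pair[OF that, of x] that by auto
    then show ?thesis unfolding P_def by blast
  qed
  have "dfb (\<lambda>e. P (e 0))" unfolding P_def by (intro dfb_intro dft_const a H)
  moreover have "P a" using moved Piff by blast
  ultimately obtain v where v: "v \<in> S" "lev v" "P v"
    and min: "\<And>q. q \<in> S \<Longrightarrow> lev q \<Longrightarrow> P q \<Longrightarrow> v = q \<or> v \<in> el q"
    using lev_least[of P a] a by metis
  have va: "el v \<subseteq> el a" using min[OF a] \<open>P a\<close> lev_trans[OF a(2,1)] by blast
  have fix_el: "f y = y" if y: "y \<in> el v" for y
  proof (rule ccontr)
    assume ne: "f y \<noteq> y"
    have yS: "y \<in> S" using y v(1) el_SS by blast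
    obtain r where r: "r \<in> el v" "lev r" "el y \<subseteq> el r" using lev_mem_iff[OF v(2,1) yS] y by blast
    have rS: "r \<in> S" using r v(1) el_SS by blast
    have "el y \<subseteq> el a" using lev_trans[OF v(2,1) y] va by blast
    then have "P r" using Piff ne r(3) yS by blast
    then have "v = r \<or> v \<in> el r" using min rS r(2) by blast
    then have "v \<in> el v" using r(1) lev_trans[OF v(2,1) r(1)] by blast
    then show False using not_in_self[OF v(1)] by blast
  qed
  have dv: "dm v" using v va by blast
  have lv: "lev (f v)" using emb_lev[OF dv dv v(2)] by blast
  have down: "dm y" if "y \<in> el v" for y
    using that v va lev_trans[OF v(2,1) that] el_SS[OF that v(1)] by blast
  have sub: "el v \<subseteq> el (f v)"
    using emb_mem[OF down dv] fix_el by (metis subsetI)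
  \<comment> \<open>If \<open>v\<close> were fixed, a moved subset \<open>x\<close> of
    \<open>v\<close> would be sent by relation 2 to a subset of \<open>v\<close>, and this has the
    same members as \<open>x\<close> since they are all fixed.\<close>
  have "f v \<noteq> v"
  proof
    assume fv: "f v = v"
    from v(3) Piff obtain x where x: "dm x" "el x \<subseteq> el v" "f x \<noteq> x" by blast
    have "el (f x) \<subseteq> el v" using emb_lev[OF x(1) dv v(2) x(2)] fv by simp
    moreover have "y \<in> el (f x) \<longleftrightarrow> y \<in> el x" if "y \<in> el v" for y
      using emb_mem[OF down[OF that] x(1)] fix_el[OF that] by simp
    ultimately have "el (f x) = el x" using x(2) by blast
    then show False using el_inject S_D emb_dom[OF x(1)] x by blast
  qed
  then have "v \<in> el (f v)" using lev_psubset[OF v(2,1) lv _ sub] emb_dom[OF dv] by metis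
  then show thesis using that[of v] dv v(2) lv fix_el by blast
qed

context
  fixes v
  assumes v: "dm v" "lev v" "lev (f v)" "v \<in> el (f v)" and fixed: "\<And>y. y \<in> el v \<Longrightarrow> f y = y"
begin

lemma crit_dom: "y \<in> el v \<Longrightarrow> dm y"
  using v lev_trans[of v y] el_SS[of y v] by blast

lemma crit_dom': "x \<in> S \<Longrightarrow> el x \<subseteq> el v \<Longrightarrow> dm x"
  using v by blast

lemma crit_image_S: "f v \<in> S"
  using emb_dom v by blast

text \<open>The source of the contradictions below: subsets of \<open>v\<close> need not be members
  of \<open>v\<close>, but they are members of \<open>f v\<close>.\<close>

lemma crit_subset: "x \<in> S \<Longrightarrow> el x \<subseteq> el v \<Longrightarrow> x \<in> el (f v)"
  using lev_subset_mem[OF v(3) crit_image_S v(4)] by blast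

lemma crit_mem: "x \<in> el v \<Longrightarrow> y \<in> S \<Longrightarrow> el y \<subseteq> el v \<Longrightarrow> x \<in> el (f y) \<longleftrightarrow> x \<in> el y"
  using emb_mem[OF crit_dom crit_dom'] fixed by metis

text \<open>The power set of \<open>x\<close> is a subset of \<open>v\<close>, hence a member of
  \<open>f v\<close>; if \<open>v\<close> did not contain it, relation 4 would ban it from
  \<open>f v\<close> too.\<close>

lemma crit_limlev: "limlev v"
  unfolding limlev_def
proof (intro conjI ballI v(2))
  fix x assume x: "x \<in> el v"
  show "\<exists>p\<in>el v. \<forall>y\<in>S. y \<in> el p \<longleftrightarrow> el y \<subseteq> el x"
  proof (rule ccontr)
    assume "\<not> ?thesis"
    then have "srel 4 (pw a) x v" by (simp add: srel_def)
    from emb_pres[OF _ crit_dom[OF x] v(1) this]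
    have no: "\<not> (\<exists>p\<in>el (f v). \<forall>y\<in>S. y \<in> el p \<longleftrightarrow> el y \<subseteq> el x)"
      using fixed[OF x] by (simp add: srel_def)
    have xS: "x \<in> S" using crit_dom[OF x] by blast
    have "el (pw x) \<subseteq> el v"
      using pw(2)[OF xS] lev_subset_mem[OF v(2) _ x] v(1) by blast
    then have "pw x \<in> el (f v)" using crit_subset pw(1)[OF xS] by blast
    then show False using no pw(2)[OF xS] by blast
  qed
qed

text \<open>\<open>v\<close> itself is an inductive set that belongs to \<open>f v\<close>, and the
  range of a function included in \<open>v\<close> with domain in \<open>v\<close> is a subset of
  \<open>v\<close>, so it belongs to \<open>f v\<close> as well. Relations 5 and 7 pull both facts
  back to \<open>v\<close>.\<close>

lemma crit_univ: "univ v"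
proof -
  have vS: "v \<in> S" using v by blast
  note lim = crit_limlev
  \<comment> \<open>By relation 11 an empty \<open>v\<close> would have an empty image, but
    \<open>v\<close> is a member of \<open>f v\<close>.\<close>
  have "\<not> (\<forall>z\<in>S. z \<notin> el v)"
  proof
    assume "\<forall>z\<in>S. z \<notin> el v"
    then have "srel 11 (pw a) v v" by (simp add: srel_def)
    from emb_pres[OF _ v(1) v(1) this] have "\<forall>z\<in>S. z \<notin> el (f v)" by (simp add: srel_def)
    then show False using v by blast
  qed
  then obtain x0 where x0: "x0 \<in> el v" by blast
  have ind: "ind_set v"
    unfolding ind_set_def
  proof (intro conjI ballI)
    have "mk D {} \<in> S" "el (mk D {}) = {}" using sm_mk[OF sm_empty] by auto
    moreover from this have "mk D {} \<in> el v" using limlev_subset[OF lim vS x0] by blast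
    ultimately show "\<exists>z\<in>el v. \<forall>y\<in>S. y \<notin> el z" by blast
    fix x assume x: "x \<in> el v"
    then have "x \<in> S" using crit_dom by blast
    then have "el (mk D (insert x (el x))) = insert x (el x)" by (intro sm_mk sm_insert sm_el)
    then show "\<exists>y\<in>el v. \<forall>w\<in>S. w \<in> el y \<longleftrightarrow> w \<in> el x \<or> w = x"
      using limlev_succ[OF lim vS x] by blast
  qed
  have "\<exists>I\<in>el v. ind_set I"
  proof (rule ccontr)
    assume "\<not> ?thesis"
    then have "srel 5 (pw a) v v" by (simp add: srel_def)
    from emb_pres[OF _ v(1) v(1) this] have "\<not> (\<exists>I\<in>el (f v). ind_set I)" by (simp add: srel_def)
    then show False using ind v(4) by blast
  qed
  moreover have "ran_in F v" if F: "F \<in> S" "el F \<subseteq> el v" and d: "d \<in> el v" and fd: "fdom F d" for F d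
  proof (rule ccontr)
    assume "\<not> ran_in F v"
    then have "srel 7 (pw a) F v" by (simp add: srel_def)
    from emb_pres[OF _ crit_dom'[OF F] v(1) this]
    have nr: "\<not> ran_in (f F) (f v)" by (simp add: srel_def)
    have "srel 6 (pw a) F d" using fd by (simp add: srel_def)
    from emb_pres[OF _ crit_dom'[OF F] crit_dom[OF d] this]
    have fd': "fdom (f F) d" using fixed[OF d] by (simp add: srel_def)
    \<comment> \<open>\<open>f F\<close> extends \<open>F\<close> and both have domain
      \<open>d\<close>, so single-valuedness leaves no room for new pairs.\<close>
    have same: "pair D x y \<in> el (f F) \<longleftrightarrow> pair D x y \<in> el F" if xy: "x \<in> S" "y \<in> S" for x y
    proof
      assume "pair D x y \<in> el F"
      then show "pair D x y \<in> el (f F)" using crit_mem[OF _ F] F by blast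
    next
      assume p: "pair D x y \<in> el (f F)"
      then have "x \<in> el d" using fd' xy unfolding fdom_def by blast
      then obtain y' where y': "y' \<in> S" "pair D x y' \<in> el F" using fd xy unfolding fdom_def by blast
      then have "pair D x y' \<in> el (f F)" using crit_mem[OF _ F] F by blast
      then have "y = y'" using fd' p xy y' unfolding fdom_def func_def by blast
      then show "pair D x y \<in> el F" using y' by simp
    qed
    have dS: "d \<in> S" using crit_dom d by blast
    have "sm {y \<in> S. \<exists>x\<in>el d. pair D x y \<in> el F}"
    proof (rule class_function_image[OF dS])
      show "dfb (\<lambda>e. pair D (e 0) (e (Suc 0)) \<in> el F)" by (intro dfb_intro dft_const F)
      show "y = z" if "x \<in> el d" "y \<in> S" "z \<in> S" "pair D x y \<in> el F" "pair D x z \<in> el F" for x y z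
        using fd that el_SS[OF that(1) dS] unfolding fdom_def func_def by blast
    qed
    then obtain r where r: "r \<in> S" "el r = {y \<in> S. \<exists>x\<in>el d. pair D x y \<in> el F}" by (rule smE)
    have "el r \<subseteq> el v"
    proof
      fix y assume "y \<in> el r"
      then obtain x where "x \<in> el d" "y \<in> S" "pair D x y \<in> el F" using r(2) by blast
      then show "y \<in> el v" using limlev_pairD[OF lim vS] F(2) el_SS[OF _ dS] by blast
    qed
    then have "r \<in> el (f v)" using crit_subset r(1) by blast
    moreover have "\<forall>y\<in>S. y \<in> el r \<longleftrightarrow> (\<exists>x\<in>S. pair D x y \<in> el (f F))"
    proof
      fix y assume y: "y \<in> S"
      show "y \<in> el r \<longleftrightarrow> (\<exists>x\<in>S. pair D x y \<in> el (f F))"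
        unfolding r(2) using y same[OF _ y] fd el_SS[OF _ dS] unfolding fdom_def by blast
    qed
    ultimately show False using nr unfolding ran_in_def by blast
  qed
  ultimately show ?thesis unfolding univ_def using lim by blast
qed

text \<open>From a counterexample \<open>Q\<close> over \<open>v\<close> with image \<open>T\<close>: let \<open>l\<close> be the ordinals of \<open>v\<close> and
  \<open>m = l + 1\<close>. A vertex \<open>x\<close> of \<open>T l\<close> and homomorphisms from \<open>T l\<close> to the \<open>Q \<alpha> = T \<alpha>\<close>, \<open>\<alpha> < l\<close>, give
  a function \<open>F x\<close> on \<open>l\<close>, and evaluating the image of \<open>F x\<close> at \<open>m\<close> maps \<open>T l\<close> to \<open>T m\<close>.\<close>

lemma crit_no_swcex:
  assumes Q: "Q \<in> sub D v" and cex: "swcex (sub D v) Q"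
  shows False
proof -
  have vS: "v \<in> S" using v by blast
  note lim = crit_limlev and un = crit_univ
  have QS: "Q \<in> S" "el Q \<subseteq> el v" using Q sub_iff[OF vS] by auto
  define T where "T = f Q"
  \<comment> \<open>Relation 8 bundles being a universe with the counterexample, so that
    \<open>swcex_sub\<close> can be used for \<open>Q\<close> over \<open>v\<close> and for
    \<open>T\<close> over \<open>f v\<close>.\<close>
  have "srel 8 (pw a) Q v" using QS cex un by (simp add: srel_def)
  from emb_pres[OF _ crit_dom'[OF QS] v(1) this]
  have un': "univ (f v)" and T: "el T \<subseteq> el (f v)" "swcex (sub D (f v)) T"
    by (simp_all add: srel_def T_def)
  have TS: "T \<in> S" using emb_dom[OF crit_dom'[OF QS]] by (simp add: T_def)
  note v'S = crit_image_S and lim' = univ_limlev[OF un']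
  have TU: "T \<in> sub D (f v)" using sub_iff[OF v'S] T TS by blast
  note q = swcex_sub[OF un vS Q cex] and t = swcex_sub[OF un' v'S TU T(2)]
  have vv': "el v \<subseteq> el (f v)" using lev_trans[OF v(3) v'S v(4)] .
  have v'el: "x \<in> S" if "x \<in> el (f v)" for x using that v'S el_SS by blast
  have vel: "x \<in> S" if "x \<in> el v" for x using that vS el_SS by blast
  \<comment> \<open>The members of \<open>Q\<close> are members of \<open>v\<close>, hence fixed by
    \<open>f\<close>: the sequence \<open>T\<close> extends \<open>Q\<close>.\<close>
  have QT: "p \<in> el T" if "p \<in> el Q" for p
    using crit_mem[OF _ QS] that QS(2) unfolding T_def by blast
  have "sm {x \<in> el v. ord x}" by (intro sm_sep sm_el vS dfb_intro)
  then obtain l where l: "l \<in> S" "el l = {x \<in> el v. ord x}" by (rule smE)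
  have lv': "l \<in> el (f v)" using crit_subset[OF l(1)] l(2) by blast
  have ord_l: "ord l"
    unfolding ord_def
  proof (intro conjI ballI subsetI)
    fix x y assume x: "x \<in> el l" and "y \<in> el x"
    then show "y \<in> el l"
      using l(2) limlev_trans[OF lim vS, of x] ord_mem[of x y] vel by blast
  next
    fix x y assume "x \<in> el l" "y \<in> el l"
    then show "x \<in> el y \<or> x = y \<or> y \<in> el x" using ord_linear l(2) vel by blast
  qed
  define m where "m = mk D (insert l (el l))"
  have m: "m \<in> S" "el m = insert l (el l)"
    unfolding m_def using l(1) by (intro sm_mk sm_insert sm_el; assumption)+
  have mv': "m \<in> el (f v)" unfolding m_def by (rule limlev_succ[OF lim' v'S lv'])
  have ord_m: "ord m" using ord_l unfolding ord_def m(2) by blast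
  obtain V A where VA: "V \<in> el (f v)" "A \<in> el (f v)" "graph V A" "pair D l (pair D V A) \<in> el T"
    using t(2)[OF lv' ord_l] by blast
  obtain V' A' where VA': "V' \<in> el (f v)" "A' \<in> el (f v)" "graph V' A'" "pair D m (pair D V' A') \<in> el T"
    using t(2)[OF mv' ord_m] by blast
  have S: "V \<in> S" "A \<in> S" "V' \<in> S" "A' \<in> S" "pair D V' A' \<in> S" using VA VA' v'el pair_S by auto
  have VS: "x \<in> S" if "x \<in> el V" for x using that S el_SS by blast
  have VS': "x \<in> S" if "x \<in> el V'" for x using that S el_SS by blast
  \<comment> \<open>\<open>h\<close> acts on \<open>V\<close> as a homomorphism from
    \<open>T l\<close> to the graph that \<open>Q\<close> has at \<open>c\<close>. The condition is
    written with pairs instead of \<open>ghom\<close> so that it is definable in \<open>c\<close>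
    and \<open>h\<close>, as the choice of \<open>P\<close> requires.\<close>
  define hm where "hm c h \<longleftrightarrow> (\<exists>W\<in>S. \<exists>B\<in>S. pair D c (pair D W B) \<in> el Q \<and> func h \<and>
    (\<forall>x\<in>el V. \<exists>y\<in>el W. pair D x y \<in> el h) \<and>
    (\<forall>x\<in>el V. \<forall>w\<in>el V. pair D x w \<in> el A \<longrightarrow>
      (\<forall>x'\<in>S. \<forall>w'\<in>S. pair D x x' \<in> el h \<and> pair D w w' \<in> el h \<longrightarrow> pair D x' w' \<in> el B)))" for c h
  have hm_ex: "\<exists>h\<in>el (f v). hm c h" if c: "c \<in> el l" for c
  proof -
    have cv: "c \<in> el v" "ord c" using c l(2) by auto
    obtain W B where W: "W \<in> el v" "B \<in> el v" "graph W B" "pair D c (pair D W B) \<in> el Q"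
      using q(2)[OF cv] by blast
    have WS: "W \<in> S" "B \<in> S" using W vel by auto
    obtain h g where h: "h \<in> S" "fun_on h V g W" "ghom g V A W B"
      using t(4)[OF c lv' ord_l W(3) VA(3) QT[OF W(4)] VA(4)] by blast
    have "h \<in> el (f v)"
      by (rule limlev_times[OF lim' v'S VA(1) _ h(1), of W])
        (use h(2) W(1) vv' in \<open>auto simp: fun_on_def\<close>)
    moreover have hg: "pair D x y \<in> el h \<longleftrightarrow> x \<in> el V \<and> y = g x" if "x \<in> S" "y \<in> S" for x y
      by (rule fun_on_iff[OF h(2) S(1) WS(1) that])
    have gW: "g x \<in> el W" "g x \<in> S" if "x \<in> el V" for x
      using h(2) that el_SS[OF _ WS(1)] unfolding fun_on_def by blast+
    have "hm c h"
      unfolding hm_def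
    proof (rule bexI[OF _ WS(1)], rule bexI[OF _ WS(2)], intro conjI W(4))
      show "func h" unfolding func_def using hg by blast
      show "\<forall>x\<in>el V. \<exists>y\<in>el W. pair D x y \<in> el h" using hg gW VS by blast
      show "\<forall>x\<in>el V. \<forall>w\<in>el V. pair D x w \<in> el A \<longrightarrow>
        (\<forall>x'\<in>S. \<forall>w'\<in>S. pair D x x' \<in> el h \<and> pair D w w' \<in> el h \<longrightarrow> pair D x' w' \<in> el B)"
        using h(3) hg VS unfolding ghom_def by blast
    qed
    ultimately show ?thesis by blast
  qed
  have hm_dfb: "dfb (\<lambda>e. hm (e i) (e j))" for i j
    unfolding hm_def by (intro dfb_intro dft_const QS S)
  obtain P where P: "P \<in> S" "func P" "\<And>c. c \<in> el l \<Longrightarrow> \<exists>h\<in>el (f v). pair D c h \<in> el P"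
    "\<And>c h. c \<in> S \<Longrightarrow> h \<in> S \<Longrightarrow> pair D c h \<in> el P \<Longrightarrow> c \<in> el l \<and> hm c h"
    by (rule choice_function[OF l(1) v'S hm_dfb hm_ex], assumption) (rule that)
  have hmD: "func h \<and> (\<forall>x\<in>el V. \<exists>y\<in>el W. pair D x y \<in> el h) \<and>
    (\<forall>x\<in>el V. \<forall>w\<in>el V. pair D x w \<in> el A \<longrightarrow>
      (\<forall>x'\<in>S. \<forall>w'\<in>S. pair D x x' \<in> el h \<and> pair D w w' \<in> el h \<longrightarrow> pair D x' w' \<in> el B))"
    if c: "c \<in> S" "h \<in> S" "pair D c h \<in> el P" and W: "W \<in> S" "B \<in> S" "pair D c (pair D W B) \<in> el Q" for c h W B
  proof -
    from P(4)[OF c] obtain W' B' where W': "W' \<in> S" "B' \<in> S" "pair D c (pair D W' B') \<in> el Q"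
      and h: "func h \<and> (\<forall>x\<in>el V. \<exists>y\<in>el W'. pair D x y \<in> el h) \<and>
      (\<forall>x\<in>el V. \<forall>w\<in>el V. pair D x w \<in> el A \<longrightarrow>
        (\<forall>x'\<in>S. \<forall>w'\<in>S. pair D x x' \<in> el h \<and> pair D w w' \<in> el h \<longrightarrow> pair D x' w' \<in> el B'))"
      unfolding hm_def by blast
    have "pair D W B = pair D W' B'"
      using q(3) W W' c(1) pair_S unfolding func_def by blast
    then have "W' = W" "B' = B" using pair_inject W W' by auto
    with h show ?thesis by simp
  qed
  note hm_func = hmD[THEN conjunct1]
    and hm_total = hmD[THEN conjunct2, THEN conjunct1, rule_format]
    and hm_edge = hmD[THEN conjunct2, THEN conjunct2, rule_format]
  \<comment> \<open>Its members are the triples of \<open>c\<close>, the image of \<open>x\<close>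
    under the homomorphism that \<open>P\<close> chooses at \<open>c\<close>, and the graph of
    \<open>Q\<close> at \<open>c\<close>. Separation inside \<open>el v\<close> makes this a set,
    and \<open>FI\<close> shows that no triple is lost.\<close>
  define Fs where "Fs x = {z \<in> el v. \<exists>c\<in>S. \<exists>y\<in>S. \<exists>W\<in>S. \<exists>B\<in>S. \<exists>h\<in>S.
    z = pair D c (pair D y (pair D W B)) \<and> pair D c (pair D W B) \<in> el Q \<and>
    pair D c h \<in> el P \<and> pair D x y \<in> el h}" for x
  define F where "F x = mk D (Fs x)" for x
  have smFs: "sm (Fs x)" if "x \<in> S" for x
    unfolding Fs_def by (intro sm_sep sm_el vS dfb_intro dft_const that QS P)
  have F: "F x \<in> S" "el (F x) = Fs x" if "x \<in> S" for x
    unfolding F_def using sm_mk[OF smFs[OF that]] by auto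
  have dF: "dft (\<lambda>e. F (e i))" for i
    unfolding F_def
  proof (rule dft_mk)
    show "dfb (\<lambda>e. e 0 \<in> Fs (e (Suc i)))"
      unfolding Fs_def mem_Collect_eq by (intro dfb_intro dft_const vS QS P)
  qed (intro smFs, auto)
  have Fv: "el (F x) \<subseteq> el v" if "x \<in> S" for x using F(2)[OF that] by (auto simp: Fs_def)
  have FI: "pair D c (pair D y (pair D W B)) \<in> el (F x)"
    if x: "x \<in> el V" and c: "c \<in> S" "h \<in> S" "pair D c h \<in> el P"
      and W: "W \<in> S" "B \<in> S" "pair D c (pair D W B) \<in> el Q" and y: "y \<in> S" "pair D x y \<in> el h" for x c h W B y
  proof -
    have xS: "x \<in> S" using VS x .
    obtain y' where y': "y' \<in> el W" "pair D x y' \<in> el h" using hm_total[OF c W x] by blast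
    have "y' \<in> S" using y'(1) W(1) el_SS by blast
    then have "y' = y" using hm_func[OF c W] xS y y'(2) unfolding func_def by blast
    then have yW: "y \<in> el W" using y' by simp
    have "pair D c (pair D W B) \<in> el v" using W(3) QS(2) by blast
    then have cv: "c \<in> el v" "pair D W B \<in> el v"
      using limlev_pairD[OF lim vS _ c(1) pair_S[OF W(1,2)]] by auto
    then have "W \<in> el v" using limlev_pairD[OF lim vS _ W(1,2)] by auto
    then have "y \<in> el v" using yW limlev_trans[OF lim vS] by blast
    from limlev_pair[OF lim vS cv(1) limlev_pair[OF lim vS this cv(2)]]
    have "pair D c (pair D y (pair D W B)) \<in> el v" .
    then show ?thesis unfolding F(2)[OF xS] Fs_def using c W y by blast
  qed
  have FE: "\<exists>h\<in>S. pair D c (pair D W B) \<in> el Q \<and> pair D c h \<in> el P \<and> pair D x y \<in> el h"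
    if x: "x \<in> S" and CS: "c \<in> S" "y \<in> S" "W \<in> S" "B \<in> S"
      and p: "pair D c (pair D y (pair D W B)) \<in> el (F x)" for x c y W B
  proof -
    from p obtain c' y' W' B' h where *: "c' \<in> S" "y' \<in> S" "W' \<in> S" "B' \<in> S" "h \<in> S"
      "pair D c (pair D y (pair D W B)) = pair D c' (pair D y' (pair D W' B'))"
      "pair D c' (pair D W' B') \<in> el Q" "pair D c' h \<in> el P" "pair D x y' \<in> el h"
      unfolding F(2)[OF x] Fs_def by blast
    then have "c' = c" "y' = y" "W' = W" "B' = B" using CS by (simp_all add: pair_inject pair_S)
    then show ?thesis using * by blast
  qed
  have func_F: "func (F x)" if x: "x \<in> el V" for x
    unfolding func_def
  proof (intro ballI impI, elim conjE)
    have xS: "x \<in> S" using VS x .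
    fix c z1 z2 assume CS: "c \<in> S" "z1 \<in> S" "z2 \<in> S"
      and p: "pair D c z1 \<in> el (F x)" "pair D c z2 \<in> el (F x)"
    have get: "\<exists>y\<in>S. \<exists>W\<in>S. \<exists>B\<in>S. \<exists>h\<in>S. z = pair D y (pair D W B) \<and>
        pair D c (pair D W B) \<in> el Q \<and> pair D c h \<in> el P \<and> pair D x y \<in> el h"
      if zS: "z \<in> S" and z: "pair D c z \<in> el (F x)" for z
    proof -
      from z obtain c' y W B h where *: "c' \<in> S" "y \<in> S" "W \<in> S" "B \<in> S" "h \<in> S"
        "pair D c z = pair D c' (pair D y (pair D W B))"
        "pair D c' (pair D W B) \<in> el Q" "pair D c' h \<in> el P" "pair D x y \<in> el h"
        unfolding F(2)[OF xS] Fs_def by blast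
      then have "c' = c" "z = pair D y (pair D W B)"
        using CS(1) zS by (simp_all add: pair_inject pair_S)
      then show ?thesis using * by blast
    qed
    obtain y W B h where 1: "y \<in> S" "W \<in> S" "B \<in> S" "h \<in> S" "z1 = pair D y (pair D W B)"
      "pair D c (pair D W B) \<in> el Q" "pair D c h \<in> el P" "pair D x y \<in> el h"
      using get[OF CS(2) p(1)] by blast
    obtain y' W' B' h' where 2: "y' \<in> S" "W' \<in> S" "B' \<in> S" "h' \<in> S" "z2 = pair D y' (pair D W' B')"
      "pair D c (pair D W' B') \<in> el Q" "pair D c h' \<in> el P" "pair D x y' \<in> el h'"
      using get[OF CS(3) p(2)] by blast
    have "pair D W B = pair D W' B'"
      using q(3) CS(1) pair_S[OF 1(2,3)] pair_S[OF 2(2,3)] 1(6) 2(6) unfolding func_def by blast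
    moreover have "h = h'" using P(2) CS(1) 1(4,7) 2(4,7) unfolding func_def by blast
    moreover from this have "y = y'"
      using hm_func[OF CS(1) 1(4,7) 1(2,3,6)] xS 1(1,8) 2(1,8) unfolding func_def by blast
    ultimately show "z1 = z2" using 1(5) 2(5) by simp
  qed
  have "verts (F x) Q" if x: "x \<in> el V" for x
    unfolding verts_def
  proof (intro conjI func_F[OF x] ballI impI)
    fix c W B assume CS: "c \<in> S" "W \<in> S" "B \<in> S" and p: "pair D c (pair D W B) \<in> el Q"
    obtain c' W' B' where "c' \<in> el v" "W' \<in> el v" "B' \<in> el v" "ord c'"
      "pair D c (pair D W B) = pair D c' (pair D W' B')"
      using q(1)[OF p] by blast
    then have "c \<in> el l" using CS vel l(2) by (auto simp: pair_inject pair_S)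
    then obtain h where h: "h \<in> S" "pair D c h \<in> el P" using P(3) v'el by blast
    obtain y where y: "y \<in> el W" "pair D x y \<in> el h" using hm_total[OF CS(1) h CS(2,3) p x] by blast
    then have "y \<in> S" using CS el_SS by blast
    then show "\<exists>y\<in>el W. pair D c (pair D y (pair D W B)) \<in> el (F x)"
      using FI[OF x CS(1) h CS(2,3) p _ y(2)] y(1) by blast
  qed
  then have "srel 10 (pw a) (F x) Q" if "x \<in> el V" for x using that by (simp add: srel_def)
  from emb_pres[OF _ crit_dom'[OF F(1) Fv] crit_dom'[OF QS] this]
  have vertsT: "verts (f (F x)) T" if "x \<in> el V" for x
    using that VS by (simp add: srel_def T_def)
  have "edges (F x) (F w)" if x: "x \<in> el V" and w: "w \<in> el V" and xw: "pair D x w \<in> el A" for x w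
    unfolding edges_def
  proof (intro ballI impI, elim conjE)
    fix c y z W B assume CS: "c \<in> S" "y \<in> S" "z \<in> S" "W \<in> S" "B \<in> S"
      and p: "pair D c (pair D y (pair D W B)) \<in> el (F x)" "pair D c (pair D z (pair D W B)) \<in> el (F w)"
    obtain h where h: "h \<in> S" "pair D c (pair D W B) \<in> el Q" "pair D c h \<in> el P" "pair D x y \<in> el h"
      using FE[OF VS[OF x] CS(1,2,4,5) p(1)] by blast
    obtain h' where h': "h' \<in> S" "pair D c h' \<in> el P" "pair D w z \<in> el h'"
      using FE[OF VS[OF w] CS(1,3,4,5) p(2)] by blast
    have "h' = h" using P(2) CS(1) h h' unfolding func_def by blast
    then show "pair D y z \<in> el B"
      using hm_edge[OF CS(1) h(1,3) CS(4,5) h(2) x w xw CS(2,3)] h(4) h'(3) by blast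
  qed
  then have "srel 9 (pw a) (F x) (F w)" if "x \<in> el V" "w \<in> el V" "pair D x w \<in> el A" for x w
    using that by (simp add: srel_def)
  from emb_pres[OF _ crit_dom'[OF F(1) Fv] crit_dom'[OF F(1) Fv] this]
  have edgesT: "edges (f (F x)) (f (F w))" if "x \<in> el V" "w \<in> el V" "pair D x w \<in> el A" for x w
    using that VS by (simp add: srel_def)
  \<comment> \<open>By relation 10 \<open>f (F x)\<close> selects a vertex of every graph of
    \<open>T\<close>, in particular at \<open>m\<close>, beyond the domain of
    \<open>F x\<close>.\<close>
  define k where "k x = (SOME y. y \<in> el V' \<and> pair D m (pair D y (pair D V' A')) \<in> el (f (F x)))" for x
  have k: "k x \<in> el V'" "pair D m (pair D (k x) (pair D V' A')) \<in> el (f (F x))" if "x \<in> el V" for x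
  proof -
    have "\<exists>y. y \<in> el V' \<and> pair D m (pair D y (pair D V' A')) \<in> el (f (F x))"
      using vertsT[OF that] m(1) S VA'(4) unfolding verts_def by blast
    from someI_ex[OF this] show "k x \<in> el V'" "pair D m (pair D (k x) (pair D V' A')) \<in> el (f (F x))"
      by (simp_all add: k_def)
  qed
  have k_unique: "y = k x" if x: "x \<in> el V" and y: "y \<in> S" "pair D m (pair D y (pair D V' A')) \<in> el (f (F x))" for x y
  proof -
    have "pair D y (pair D V' A') = pair D (k x) (pair D V' A')"
      using vertsT[OF x] m(1) y(2) k(2)[OF x] pair_S[OF y(1) S(5)] pair_S[OF VS'[OF k(1)[OF x]] S(5)]
      unfolding verts_def func_def by blast
    then show ?thesis using pair_inject[OF y(1) S(5) VS'[OF k(1)[OF x]] S(5)] by blast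
  qed
  \<comment> \<open>\<open>H\<close> provides \<open>f (F x)\<close> as the set \<open>Z\<close>, so
    the graph of \<open>k\<close> is definable and \<open>k\<close> is a homomorphism in the sense
    of the model.\<close>
  have "sm {z \<in> {pair D x y |x y. x \<in> el V \<and> y \<in> el V'}. \<exists>x\<in>el V. \<exists>y\<in>S. z = pair D x y \<and>
      (\<exists>Z\<in>S. pair D (F x) Z \<in> el H \<and> pair D m (pair D y (pair D V' A')) \<in> el Z)}"
    by (intro sm_sep sm_times sm_el dfb_intro dF dft_const S m(1) H(1))
  then obtain K where K: "K \<in> S" "el K = {z \<in> {pair D x y |x y. x \<in> el V \<and> y \<in> el V'}.
      \<exists>x\<in>el V. \<exists>y\<in>S. z = pair D x y \<and>
      (\<exists>Z\<in>S. pair D (F x) Z \<in> el H \<and> pair D m (pair D y (pair D V' A')) \<in> el Z)}"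
    by (rule smE)
  have "fun_on K V k V'"
    unfolding fun_on_def
  proof (intro conjI ballI k(1))
    have Z: "(\<exists>Z\<in>S. pair D (F x) Z \<in> el H \<and> pair D m (pair D y (pair D V' A')) \<in> el Z) \<longleftrightarrow> y = k x"
      if x: "x \<in> el V" and y: "y \<in> S" for x y
    proof -
      have d: "dm (F x)" using crit_dom'[OF F(1) Fv] VS[OF x] by blast
      have "(\<exists>Z\<in>S. pair D (F x) Z \<in> el H \<and> pair D m (pair D y (pair D V' A')) \<in> el Z) \<longleftrightarrow>
        pair D m (pair D y (pair D V' A')) \<in> el (f (F x))"
        using emb_pair[OF d] emb_dom[OF d] by blast
      also have "\<dots> \<longleftrightarrow> y = k x" using k_unique[OF x y] k(2)[OF x] by blast
      finally show ?thesis .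
    qed
    show "el K = {pair D x (k x) |x. x \<in> el V}"
    proof
      show "el K \<subseteq> {pair D x (k x) |x. x \<in> el V}" unfolding K(2) using Z by blast
      show "{pair D x (k x) |x. x \<in> el V} \<subseteq> el K" unfolding K(2) using Z k(1) VS' by blast
    qed
  qed
  moreover have "ghom k V A V' A'"
    unfolding ghom_def
  proof (intro conjI ballI impI k(1))
    fix x w assume x: "x \<in> el V" and w: "w \<in> el V" and "pair D x w \<in> el A"
    then have "edges (f (F x)) (f (F w))" by (rule edgesT)
    then show "pair D (k x) (k w) \<in> el A'"
      using k[OF x] k[OF w] m(1) S VS' unfolding edges_def by blast
  qed
  moreover have "l \<in> el m" using m(2) by simp
  ultimately show False using t(4)[OF _ mv' ord_m VA(3) VA'(3) VA(4) VA'(4)] K(1) by blast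
qed

end

end

text \<open>A level can be recovered from its power set, so these power sets form a proper class.
  Power sets are taken because \<open>f\<close> has to act on all subsets of the critical level, not
  only on its members.\<close>

theorem universe_from_vp:
  assumes "vp D"
  shows "\<exists>v\<in>S. univ v \<and> (\<forall>Q\<in>sub D v. \<not> swcex (sub D v) Q)"
proof -
  define X where "X = {A \<in> S. \<exists>a\<in>S. lev a \<and> (\<forall>y\<in>S. y \<in> el A \<longleftrightarrow> el y \<subseteq> el a)}"
  have Xpw: "A \<in> X \<longleftrightarrow> (\<exists>a\<in>S. lev a \<and> A = pw a)" for A
  proof
    assume "A \<in> X"
    then obtain a where a: "A \<in> S" "a \<in> S" "lev a" "\<forall>y\<in>S. y \<in> el A \<longleftrightarrow> el y \<subseteq> el a"
      by (auto simp: X_def)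
    then have "el A = el (pw a)" using pw(2)[OF a(2)] el_SS by blast
    then show "\<exists>a\<in>S. lev a \<and> A = pw a" using el_inject S_D pw(1) a by blast
  next
    assume "\<exists>a\<in>S. lev a \<and> A = pw a"
    then show "A \<in> X" using pw by (auto simp: X_def)
  qed
  have clX: "cl X" unfolding X_def by (intro cl_comp dfb_intro)
  have nsX: "\<not> sm X"
  proof
    assume "sm X"
    then obtain x where x: "x \<in> S" "el x = X" by (rule smE)
    have "sm {a \<in> S. \<exists>A\<in>el x. lev a \<and> (\<forall>y\<in>S. y \<in> el A \<longleftrightarrow> el y \<subseteq> el a)}"
    proof (rule class_function_image[OF x(1)])
      show "dfb (\<lambda>e. lev (e (Suc 0)) \<and> (\<forall>y\<in>S. y \<in> el (e 0) \<longleftrightarrow> el y \<subseteq> el (e (Suc 0))))"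
        by (intro dfb_intro)
      fix A a b assume S: "a \<in> S" "b \<in> S"
        and "lev a \<and> (\<forall>y\<in>S. y \<in> el A \<longleftrightarrow> el y \<subseteq> el a)"
        and "lev b \<and> (\<forall>y\<in>S. y \<in> el A \<longleftrightarrow> el y \<subseteq> el b)"
      then have "el a = el b" by blast
      then show "a = b" using el_inject S_D S by blast
    qed
    moreover have "\<exists>A\<in>el x. lev a \<and> (\<forall>y\<in>S. y \<in> el A \<longleftrightarrow> el y \<subseteq> el a)" if "a \<in> S" "lev a" for a
      using that x(2) Xpw pw by blast
    then have "{a \<in> S. \<exists>A\<in>el x. lev a \<and> (\<forall>y\<in>S. y \<in> el A \<longleftrightarrow> el y \<subseteq> el a)} = {a \<in> S. lev a}"
      by blast
    ultimately show False using not_sm_lev by simp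
  qed
  obtain A B f H where AB: "A \<in> X" "B \<in> X" and H: "H \<in> S" "fun_on H A f B"
    and pres: "\<And>k x y. k < 12 \<Longrightarrow> x \<in> el A \<Longrightarrow> y \<in> el A \<Longrightarrow> srel k A x y \<Longrightarrow> srel k B (f x) (f y)"
    and nt: "A \<noteq> B \<or> (\<exists>x\<in>el A. f x \<noteq> x)"
    by (rule vopenka_structures[of 12 srel X, OF dfb_srel assms clX nsX]) (rule that)
  obtain a b where a: "a \<in> S" "lev a" "A = pw a" and b: "b \<in> S" "lev b" "B = pw b"
    using AB Xpw by blast
  note emb = a(1,2) b(1,2) H[unfolded a(3) b(3)] pres[unfolded a(3) b(3)] nt[unfolded a(3) b(3)]
  obtain v where v: "v \<in> S \<and> el v \<subseteq> el a" "lev v" "lev (f v)" "v \<in> el (f v)" "\<And>y. y \<in> el v \<Longrightarrow> f y = y"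
    by (rule critical_level[OF emb]) blast+
  have "univ v" by (rule crit_univ[OF emb v])
  moreover have "\<not> swcex (sub D v) Q" if "Q \<in> sub D v" for Q
    using crit_no_swcex[OF emb v that] by blast
  ultimately show ?thesis using v(1) by blast
qed

end

section \<open>The minimal universe\<close>

context membership
begin

text \<open>The axioms are sentences; this is read off from their semantic characterizations, in
  which the environment does not occur.\<close>

lemma sat_env:
  assumes "p \<in> GB_AC" "range e \<subseteq> D" "range e' \<subseteq> D" "sat D E e p" shows "sat D E e' p"
proof -
  from assms(1) consider q where "p = comprehension q" | "p \<in> {ax_extensionality 0, ax_pairing 0,
    ax_union 0, ax_power 0, ax_infinity 0, ax_replacement 0, ax_regularity 0, ax_choice 0}"
    unfolding GB_AC_def by blast
  then show ?thesis
  proof cases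
    case 1
    show ?thesis using assms(4) unfolding 1 sat_comprehension[OF assms(2)] sat_comprehension[OF assms(3)] .
  next
    case 2
    then show ?thesis
      using assms(4) by (auto simp only: insert_iff empty_iff sat_ax_extensionality sat_ax_pairing
          sat_ax_union sat_ax_power sat_ax_infinity sat_ax_replacement sat_ax_regularity sat_ax_choice)
  qed
qed

lemma sat_weak_principle:
  assumes "W = SWVP \<or> W = WVP" "\<And>Q. Q \<in> D \<Longrightarrow> \<not> swcex D Q" shows "sat D E e W"
  using assms wcex_imp_swcex by (metis sat_SWVP sat_WVP)

lemma no_model:
  assumes W: "W = SWVP \<or> W = WVP" and vp: "GB_AC \<union> {W} \<turnstile> VP"
    and e: "range e \<subseteq> D" and sat: "\<forall>p\<in>GB_AC \<union> {W}. sat D E e p"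
  shows False
proof -
  \<comment> \<open>Soundness holds for every structure in the metatheory. It is applied to
    \<open>D\<close> and later to the subsets of a minimal \<open>u\<close>.\<close>
  have vp_model: "vp D'" if "range e' \<subseteq> D'" "\<forall>p\<in>GB_AC \<union> {W}. sat D' E e' p" for D' and e' :: "nat \<Rightarrow> 'a"
    using soundness[OF vp that] sat_VP by blast
  interpret gb E D
  proof unfold_locales
    show "D \<noteq> {}" using e by auto
    show "sat D E e' p" if "p \<in> GB_AC" "range e' \<subseteq> D" for p e'
      using sat_env[OF that(1) e that(2)] sat that(1) by blast
  qed
  \<comment> \<open>Comprehension holds over every transitive \<open>u\<close>, so the finitely many
    sentences listed here decide whether \<open>u\<close> gives a model.\<close>
  define ax where "ax = [ax_extensionality 0, ax_pairing 0, ax_union 0, ax_power 0, ax_infinity 0,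
            ax_replacement 0, ax_regularity 0, ax_choice 0, W]"
  have ax: "p \<in> GB_AC \<union> {W} \<longleftrightarrow> p \<in> set ax \<or> p \<in> range comprehension" for p
    by (auto simp: ax_def GB_AC_def)
  \<comment> \<open>The finite conjunction is written as a negated bounded existential, the form
    that \<open>dfb_ex_nat\<close> proves definable.\<close>
  define P where "P u \<longleftrightarrow> (\<forall>x\<in>el u. el x \<subseteq> el u) \<and>
    \<not> (\<exists>i<length ax. \<not> sat (sub D u) E (\<lambda>_. u) (ax ! i))" for u
  have PI: "P u" if "\<forall>x\<in>el u. el x \<subseteq> el u" "\<forall>p\<in>GB_AC \<union> {W}. sat (sub D u) E (\<lambda>_. u) p" for u
    unfolding P_def using that ax nth_mem[of _ ax] by blast
  have PD: "\<forall>p\<in>GB_AC \<union> {W}. sat (sub D u) E (\<lambda>_. u) p" and U: "range (\<lambda>_::nat. u) \<subseteq> sub D u"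
    if "u \<in> S" "P u" for u
  proof -
    have tr: "\<forall>x\<in>el u. el x \<subseteq> el u" using that(2) by (auto simp: P_def)
    show U: "range (\<lambda>_::nat. u) \<subseteq> sub D u" using self_sub[OF that(1)] by auto
    have "sat (sub D u) E (\<lambda>_. u) p" if "p \<in> set ax" for p
      using that \<open>P u\<close> by (auto simp: P_def in_set_conv_nth)
    then show "\<forall>p\<in>GB_AC \<union> {W}. sat (sub D u) E (\<lambda>_. u) p"
      using ax comprehension_sub[OF that(1) tr U] by blast
  qed
  have "dfb (\<lambda>e. P (e 0))"
    unfolding P_def by (intro dfb_intro dfb_sat[where v = "\<lambda>_. 0"])
  moreover obtain v where v: "v \<in> S" "univ v" "\<forall>Q\<in>sub D v. \<not> swcex (sub D v) Q"
    using universe_from_vp[OF vp_model[OF e sat]] by blast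
  have "P v"
  proof (rule PI)
    show "\<forall>x\<in>el v. el x \<subseteq> el v" using limlev_trans[OF univ_limlev[OF v(2)] v(1)] by blast
    have "range (\<lambda>_::nat. v) \<subseteq> sub D v" using self_sub[OF v(1)] by auto
    then show "\<forall>p\<in>GB_AC \<union> {W}. sat (sub D v) E (\<lambda>_. v) p"
      using gb.GB_AC[OF univ_gb[OF v(2,1)]] sat_weak_principle[OF W] v(3) by blast
  qed
  ultimately obtain u where u: "u \<in> S" "P u" and min: "\<And>y. y \<in> el u \<Longrightarrow> \<not> P y"
    using v(1) by (elim regularity_pred[where P = P]) auto
  have tr: "\<forall>x\<in>el u. el x \<subseteq> el u" using u(2) by (auto simp: P_def)
  let ?U = "sub D u"
  interpret U: gb E ?U
  proof unfold_locales
    show "?U \<noteq> {}" using self_sub[OF u(1)] by blast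
    show "sat ?U E e' p" if "p \<in> GB_AC" "range e' \<subseteq> ?U" for p e'
      using sat_env[OF that(1) U[OF u] that(2)] PD[OF u] that(1) by blast
  qed
  obtain v where v: "v \<in> el u" "U.univ v" "\<forall>Q\<in>sub ?U v. \<not> swcex (sub ?U v) Q"
    using U.universe_from_vp[OF vp_model[OF U[OF u] PD[OF u]]] trans_St_sub[OF u(1) tr] by auto
  have vS: "v \<in> U.S" using v(1) trans_St_sub[OF u(1) tr] by simp
  note els = trans_els_sub[OF u(1) tr] and elU = trans_sub_mem[OF u(1) tr]
  have elsv: "els ?U x = el x" if "x \<in> el v" for x using els elU bspec[OF tr v(1)] that by blast
  have elv: "els ?U v = el v" using els elU v(1) by blast
  \<comment> \<open>\<open>?U\<close> and \<open>D\<close> have the same subsets of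
    \<open>v\<close>, so the universe found inside \<open>?U\<close> satisfies \<open>P\<close> in
    \<open>D\<close>, against the minimality of \<open>u\<close>.\<close>
  have sub: "sub ?U v = sub D v"
  proof
    show "sub ?U v \<subseteq> sub D v"
    proof
      fix x assume "x \<in> sub ?U v"
      then have "x \<in> ?U" "els ?U x \<subseteq> el v" using elv by (auto simp: sub_def)
      then have "x \<in> D" "el x \<subseteq> el v" using els[of x] sub_D by auto
      then show "x \<in> sub D v" by (simp add: sub_def)
    qed
    show "sub D v \<subseteq> sub ?U v"
    proof
      fix x assume x: "x \<in> sub D v"
      then have "x \<in> D" "el x \<subseteq> el v" by (simp_all add: sub_def)
      then have xU: "x \<in> ?U" using bspec[OF tr v(1)] unfolding sub_def by blast
      then have "els ?U x \<subseteq> els ?U v" using \<open>el x \<subseteq> el v\<close> els[OF xU] elv by simp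
      with xU show "x \<in> sub ?U v" unfolding sub_def[of ?U] by blast
    qed
  qed
  have "P v"
  proof (rule PI)
    show "\<forall>x\<in>el v. el x \<subseteq> el v"
      using U.limlev_trans[OF U.univ_limlev[OF v(2)] vS] elsv elv by auto
    have "range (\<lambda>_::nat. v) \<subseteq> sub ?U v" using U.self_sub[OF vS] by auto
    then show "\<forall>p\<in>GB_AC \<union> {W}. sat (sub D v) E (\<lambda>_. v) p"
      using gb.GB_AC[OF U.univ_gb[OF v(2) vS]] sat_weak_principle[OF W] v(3) unfolding sub by blast
  qed
  with min[OF v(1)] show False by blast
qed

end

theorem mainTheorem5:
  shows "(consistent (GB_AC \<union> {SWVP}) \<longrightarrow> \<not> (GB_AC \<union> {SWVP}) \<turnstile> VP) \<and>
         (consistent (GB_AC \<union> {WVP}) \<longrightarrow> \<not> (GB_AC \<union> {WVP}) \<turnstile> VP)"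
proof -
  have "\<not> GB_AC \<union> {W} \<turnstile> VP" if W: "W = SWVP \<or> W = WVP" and con: "consistent (GB_AC \<union> {W})" for W
  proof
    assume vp: "GB_AC \<union> {W} \<turnstile> VP"
    show False
      by (rule model_existence[OF con]) (rule membership.no_model[OF W vp])
  qed
  then show ?thesis by blast
qed

end
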